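(* Let $(a_1,\dots,a_k)\in\mathcal{A}$, and let $\lambda^*$ be the (unique) maximizer of the differential entropy $h(\cdot)$ over the set $$\Big\{\mu\in\mathcal{M}_1((0,\infty)) \ \Big|\ \int\phi_1\,d\mu=a_1,\ \dots,\ \int\phi_{k-1}\,d\mu=a_{k-1},\ \int\phi_k\,d\mu\le a_k\Big\}.$$ Then, for any fixed positive integer $j$, $$\lim_{\delta\to0}\lim_{n\to\infty}\mathbb{P}\big((X_1,\dots,X_j)\in\cdot\ \big|\ C_n^\delta\big)=(\lambda^* )^{\otimes j},$$ where the limits are in the sense of weak convergence of probability measures.
   Context: Fix an integer $k\ge2$ and functions $\phi_1,\dots,\phi_k:(0,\infty)\to(0,\infty)$ such that: (C1) each $\phi_i$ is $C^1$, increasing, and $\lim_{x\to\infty}\phi_i(x)=\infty$; (C2) for each $i$ and any $c>0$, $\int_0^\infty e^{-c\phi_i}dx<\infty$; (C3) there exists $\kappa>1$ such that for each $1\le i\le k-1$, $\phi_i(x)^\kappa<\phi_{i+1}(x)$ for all sufficiently large $x$; (C4) there exist $C,M>0$ such that $x>C$ implies $\frac1C\phi_i(x)^{-M}<\phi_i'(x)<C\phi_i(x)^M$ for each $i$. $\mathcal{M}_1((0,\infty))$ is the space of Borel probability measures on $(0,\infty)$ with the weak topology, and $\int$ means integration over $(0,\infty)$. Let $\lambda=\frac1Z e^{-\phi_1}dx$ be a probability measure on $(0,\infty)$ ($Z$ normalizing constant). On $\Omega=(0,\infty)^{\mathbb{N}}$ with coordinate projections $X_i$, let $\mathbb{P}=\lambda^{\otimes\mathbb{N}}$.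 Put $S_n^i=\frac1n(\phi_i(X_1)+\dots+\phi_i(X_n))$ and $C_n^\delta=\bigcap_{i=1}^k\{|S_n^i-a_i|\le\delta\}$ for $\delta>0$. The differential entropy is $h(\mu)=-\int\frac{d\mu}{dx}\log\big(\frac{d\mu}{dx}\big)dx$ if $\mu\ll dx$ and $h(\mu)=-\infty$ otherwise. Let $\mathcal{A}_1$ be the interior of the set of $(v_1,\dots,v_{k-1})\in(0,\infty)^{k-1}$ for which there is $\mu\in\mathcal{M}_1((0,\infty))$ with $h(\mu)\ne-\infty$, $\int\phi_i\,d\mu=v_i$ for $1\le i\le k-1$, and $\int\phi_k\,d\mu<\infty$. For $(v_1,\dots,v_{k-1})\in\mathcal{A}_1$ let $g_1(v_1,\dots,v_{k-1})=\inf\{\int\phi_k\,d\mu : \mu\in\mathcal{M}_1((0,\infty)),\ h(\mu)\ne-\infty,\ \int\phi_i\,d\mu=v_i\ (1\le i\le k-1)\}$. It is assumed that $g_1:\mathcal{A}_1\to\mathbb{R}$ is continuous. The admissible set is $\mathcal{A}=\{(v_1,\dots,v_k): (v_1,\dots,v_{k-1})\in\mathcal{A}_1,\ v_k>g_1(v_1,\dots,v_{k-1})\}$. *)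

theory Defs
  imports "HOL-Probability.Probability"
begin

text \<open>
  The half-line $(0,\infty)$ is the carrier of all measures on the line; functions
  \<open>\<phi> i\<close> and test functions have type \<open>real \<Rightarrow> real\<close>, but only their values on \<open>{0<..}\<close> matter.
\<close>

abbreviation pos_borel :: "real measure" where
  "pos_borel \<equiv> restrict_space borel {0<..}"

abbreviation pos_lborel :: "real measure" where
  "pos_lborel \<equiv> restrict_space lborel {0<..}"

abbreviation M1_pos :: "real measure set" where
  "M1_pos \<equiv> space (prob_algebra pos_borel)"

text \<open>
  The Bochner integral is \<open>0\<close> on non-integrable functions, so the integral of
  \<open>f ln f\<close> is taken as the extended-real difference of the integrals of its positive and
  negative parts (here \<open>0 * ln 0 = 0\<close>).  As \<open>\<infinity> - \<infinity> = \<infinity>\<close> in \<^typ>\<open>ereal\<close>,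
  the entropy is \<open>-\<infinity>\<close> when both parts are infinite. Under (C2) this cannot happen for a
  measure with finite \<open>\<phi> 1\<close>-moment: the negative part of \<open>f ln f\<close> is then integrable.
\<close>

definition diff_entropy :: "real measure \<Rightarrow> ereal" where
  "diff_entropy \<mu> =
     (if absolutely_continuous pos_lborel \<mu> then
        (let f = (\<lambda>x. enn2real (RN_deriv pos_lborel \<mu> x))
         in - (enn2ereal (\<integral>\<^sup>+x. ennreal (f x * ln (f x)) \<partial>pos_lborel)
               - enn2ereal (\<integral>\<^sup>+x. ennreal (- (f x * ln (f x))) \<partial>pos_lborel)))
      else - \<infinity>)"

text \<open>
  Moments of the positive functions \<open>\<phi> i\<close> are \<open>[0,\<infinity>]\<close>-valued.  A vector in $R^{k-1}$ is a
  function in \<open>extensional {1..<k}\<close>, the topological space being \<^term>\<open>powertop_real {1..<k}\<close>.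
\<close>

definition moment :: "(real \<Rightarrow> real) \<Rightarrow> real measure \<Rightarrow> ennreal" where
  "moment f \<mu> = (\<integral>\<^sup>+x. ennreal (f x) \<partial>\<mu>)"

definition finite_entropy_class ::
  "nat \<Rightarrow> (nat \<Rightarrow> real \<Rightarrow> real) \<Rightarrow> (nat \<Rightarrow> real) \<Rightarrow> real measure set" where
  "finite_entropy_class k \<phi> v =
     {\<mu> \<in> M1_pos. diff_entropy \<mu> \<noteq> - \<infinity> \<and> (\<forall>i\<in>{1..<k}. moment (\<phi> i) \<mu> = ennreal (v i))}"

definition A1 :: "nat \<Rightarrow> (nat \<Rightarrow> real \<Rightarrow> real) \<Rightarrow> (nat \<Rightarrow> real) set" where
  "A1 k \<phi> = powertop_real {1..<k} interior_of
     {v \<in> (\<Pi>\<^sub>E i\<in>{1..<k}. {0<..}). \<exists>\<mu>\<in>finite_entropy_class k \<phi> v. moment (\<phi> k) \<mu> < \<infinity>}"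

text \<open>On \<open>A1 k \<phi>\<close> the infimum is finite, so passing to a real value loses nothing there.\<close>

definition g1 :: "nat \<Rightarrow> (nat \<Rightarrow> real \<Rightarrow> real) \<Rightarrow> (nat \<Rightarrow> real) \<Rightarrow> real" where
  "g1 k \<phi> v = enn2real (INF \<mu>\<in>finite_entropy_class k \<phi> v. moment (\<phi> k) \<mu>)"

definition admissible :: "nat \<Rightarrow> (nat \<Rightarrow> real \<Rightarrow> real) \<Rightarrow> (nat \<Rightarrow> real) set" where
  "admissible k \<phi> =
     {v \<in> extensional {1..k}.
        restrict v {1..<k} \<in> A1 k \<phi> \<and> v k > g1 k \<phi> (restrict v {1..<k})}"

definition constraint_set ::
  "nat \<Rightarrow> (nat \<Rightarrow> real \<Rightarrow> real) \<Rightarrow> (nat \<Rightarrow> real) \<Rightarrow> real measure set" where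
  "constraint_set k \<phi> a =
     {\<mu> \<in> M1_pos. (\<forall>i\<in>{1..<k}. moment (\<phi> i) \<mu> = ennreal (a i)) \<and> moment (\<phi> k) \<mu> \<le> ennreal (a k)}"

definition ref_measure :: "(nat \<Rightarrow> real \<Rightarrow> real) \<Rightarrow> real measure" where
  "ref_measure \<phi> =
     (let Z = (\<integral>x. exp (- \<phi> 1 x) \<partial>pos_lborel)
      in density pos_lborel (\<lambda>x. ennreal (exp (- \<phi> 1 x) / Z)))"

text \<open>The sequence space is indexed from \<open>0\<close>: the coordinate $X_{i+1}$ is \<open>\<lambda>\<omega>. \<omega> i\<close>.\<close>

definition seq_measure :: "(nat \<Rightarrow> real \<Rightarrow> real) \<Rightarrow> (nat \<Rightarrow> real) measure" where
  "seq_measure \<phi> = (\<Pi>\<^sub>M i\<in>UNIV. ref_measure \<phi>)"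

definition emp_avg :: "(real \<Rightarrow> real) \<Rightarrow> nat \<Rightarrow> (nat \<Rightarrow> real) \<Rightarrow> real" where
  "emp_avg f n \<omega> = (\<Sum>m<n. f (\<omega> m)) / real n"

definition cond_event ::
  "nat \<Rightarrow> (nat \<Rightarrow> real \<Rightarrow> real) \<Rightarrow> (nat \<Rightarrow> real) \<Rightarrow> nat \<Rightarrow> real \<Rightarrow> (nat \<Rightarrow> real) set" where
  "cond_event k \<phi> a n \<delta> =
     {\<omega> \<in> space (seq_measure \<phi>). \<forall>i\<in>{1..k}. \<bar>emp_avg (\<phi> i) n \<omega> - a i\<bar> \<le> \<delta>}"

text \<open>
  If the conditioning event has probability \<open>0\<close>, then \<^const>\<open>uniform_measure\<close> is the null
  measure; convergence to a probability measure thus forces positive probability eventually.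
\<close>

definition cond_law ::
  "nat \<Rightarrow> (nat \<Rightarrow> real \<Rightarrow> real) \<Rightarrow> (nat \<Rightarrow> real) \<Rightarrow> nat \<Rightarrow> nat \<Rightarrow> real \<Rightarrow> (nat \<Rightarrow> real) measure" where
  "cond_law k \<phi> a j n \<delta> =
     distr (uniform_measure (seq_measure \<phi>) (cond_event k \<phi> a n \<delta>))
       (\<Pi>\<^sub>M i\<in>{..<j}. pos_borel) (\<lambda>\<omega>. restrict \<omega> {..<j})"

definition weakly_converges ::
  "'a topology \<Rightarrow> ('i \<Rightarrow> 'a measure) \<Rightarrow> 'a measure \<Rightarrow> 'i filter \<Rightarrow> bool" where
  "weakly_converges X \<mu> \<nu> F \<longleftrightarrow>
     (\<forall>f :: 'a \<Rightarrow> real. continuous_map X euclideanreal f \<and> bounded (f ` topspace X) \<longrightarrow>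
        ((\<lambda>i. \<integral>x. f x \<partial>\<mu> i) \<longlongrightarrow> (\<integral>x. f x \<partial>\<nu>)) F)"

abbreviation pos_power_top :: "nat \<Rightarrow> (nat \<Rightarrow> real) topology" where
  "pos_power_top j \<equiv> product_topology (\<lambda>_. top_of_set {0<..}) {..<j}"

text \<open>
  $\lim_{\delta\to0}\lim_{n\to\infty}$ of measures on $(0,\infty)^j$: the inner limits exist as
  probability measures for all small \<open>\<delta> > 0\<close>, and they converge as \<open>\<delta>\<close> decreases to \<open>0\<close>.
\<close>

definition iterated_weak_limit ::
  "nat \<Rightarrow> (nat \<Rightarrow> real \<Rightarrow> (nat \<Rightarrow> real) measure) \<Rightarrow> (nat \<Rightarrow> real) measure \<Rightarrow> bool" where
  "iterated_weak_limit j L \<nu> \<longleftrightarrow>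
     (\<exists>N :: real \<Rightarrow> (nat \<Rightarrow> real) measure.
        (\<forall>\<^sub>F \<delta> in at_right 0.
           N \<delta> \<in> space (prob_algebra (\<Pi>\<^sub>M i\<in>{..<j}. pos_borel)) \<and>
           weakly_converges (pos_power_top j) (\<lambda>n. L n \<delta>) (N \<delta>) sequentially) \<and>
        weakly_converges (pos_power_top j) N \<nu> (at_right 0))"

end

theory Submission
  imports Defs "HOL-Real_Asymp.Real_Asymp"
begin

text \<open>
  Write $\lambda$ for the reference law with density $e^{-\phi_1}/Z$, and call
  $H(q) = \int q \ln q\, d\lambda$ the relative entropy of a density $q$ with respect to $\lambda$.
  Since $h(q\lambda) = \int \phi_1 q\, d\lambda + \ln Z - H(q)$, maximizing $h$ under a
  prescribed $\phi_1$-moment is minimizing $H$ under the moment constraints.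

  For $\delta \ge 0$ let $p_\delta$ minimize $H$ over the densities whose moments satisfy
  $|\int \phi_i q\, d\lambda - a_i| \le \delta$ for $i < k$ and
  $\int \phi_k q\, d\lambda \le a_k + \delta$.  This set is convex and closed in $L^1$: the
  lower moments are continuous on it because $\phi_i = o(\phi_k)$, and the top moment is lower
  semicontinuous by Fatou.  The gap in the convexity of $x \ln x$ at a midpoint controls the
  $L^1$-distance, so minimizing sequences are Cauchy.  This gives existence and uniqueness of
  $p_\delta$, and also $p_\delta \to p_0$ in $L^1$ as $\delta \to 0$ (\<open>opt_tendsto\<close>).

  For fixed $\delta > 0$ the law of $(X_1, \dots, X_j)$ given $C_n^\delta$ tends to the
  $j$-fold power of $p_\delta\lambda$.  The argument is Csiszar's for the Gibbs conditioning
  principle.  Under the conditioned law the coordinates are exchangeable, and their common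
  marginal density $q$ meets the relaxed constraints, being the mean of empirical measures that
  do so.  Minimality of $p_\delta$ then yields the Pythagorean inequality
  $\int q \ln p_\delta\, d\lambda \ge H(p_\delta)$ (in a regularized form,
  \<open>rel_ent_pythagoras\<close>).  Applying Jensen's inequality under the conditioned law to
  $t \sum_b f(\mbox{block } b) + \sum_i \ln p_\delta(X_i)$, where $b$ runs over
  $m \approx n/j$ disjoint blocks of $j$ coordinates, gives
  \[ E[f \mid C_n^\delta] \le \int f\, d(p_\delta\lambda)^{\otimes j} + O(t)
       + \frac{-\ln P(C_n^\delta) - n H(p_\delta)}{t m} \]
  (\<open>conditional_law_upper_bound\<close>); the same holds for $-f$.

  It remains to see that $P(C_n^\delta) \ge e^{-n (H(p_\delta) + o(1))}$
  (\<open>log_prob_lower_bound\<close>).  By a change of measure this follows once $p_\delta$ is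
  approximated, with almost the same entropy, by densities strictly inside all the constraints
  $|\int \phi_i q\, d\lambda - a_i| < \delta$, $i \le k$.  Here the top moment of
  $p_\delta$ may be too small.  But a mass $w/L$ placed where $\phi_k \approx L$ raises it by
  $w$, and as $L \to \infty$ this changes the lower moments and the entropy by $o(1)$ only,
  because $\phi_i \le \phi_k^{1/\kappa}$ there (\<open>cheap_excursion\<close>).  This is why the
  limiting variational problem has an inequality in its last constraint.
\<close>

section \<open>Densities of finite entropy\<close>

text \<open>
  Nonnegativity is required everywhere, not just almost everywhere, which keeps the pointwise
  estimates below free of null sets.
\<close>

definition fin_ent :: "'a measure \<Rightarrow> ('a \<Rightarrow> real) set" where
  "fin_ent M = {q \<in> borel_measurable M. (\<forall>x. 0 \<le> q x) \<and> integrable M q \<and> (\<integral>x. q x \<partial>M) = 1 \<and>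
     integrable M (\<lambda>x. q x * ln (q x))}"

definition rel_ent :: "'a measure \<Rightarrow> ('a \<Rightarrow> real) \<Rightarrow> real" where
  "rel_ent M q = (\<integral>x. q x * ln (q x) \<partial>M)"

abbreviation mix :: "real \<Rightarrow> ('a \<Rightarrow> real) \<Rightarrow> ('a \<Rightarrow> real) \<Rightarrow> 'a \<Rightarrow> real" where
  "mix e p q \<equiv> (\<lambda>x. (1 - e) * p x + e * q x)"

abbreviation law :: "'a measure \<Rightarrow> ('a \<Rightarrow> real) \<Rightarrow> 'a measure" where
  "law M q \<equiv> density M (\<lambda>x. ennreal (q x))"

abbreviation L1_dist :: "'a measure \<Rightarrow> ('a \<Rightarrow> real) \<Rightarrow> ('a \<Rightarrow> real) \<Rightarrow> real" where
  "L1_dist M p q \<equiv> (\<integral>x. \<bar>p x - q x\<bar> \<partial>M)"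

abbreviation entropy_gap :: "'a measure \<Rightarrow> ('a \<Rightarrow> real) \<Rightarrow> ('a \<Rightarrow> real) \<Rightarrow> real" where
  "entropy_gap M p q \<equiv> rel_ent M p + rel_ent M q - 2 * rel_ent M (mix (1/2) p q)"

lemma fin_entD:
  assumes "q \<in> fin_ent M"
  shows "q \<in> borel_measurable M" "\<And>x. 0 \<le> q x" "integrable M q" "(\<integral>x. q x \<partial>M) = 1"
    "integrable M (\<lambda>x. q x * ln (q x))"
  using assms by (auto simp: fin_ent_def)

lemma fin_entI:
  assumes "q \<in> borel_measurable M" "\<And>x. 0 \<le> q x" "integrable M q" "(\<integral>x. q x \<partial>M) = 1" "integrable M (\<lambda>x. q x * ln (q x))"
  shows "q \<in> fin_ent M"
  using assms by (simp add: fin_ent_def)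

text \<open>
  This is $\ln z \le z - 1$ at $z = y/x$.  As \<open>ln 0 = 0\<close>, the third hypothesis is needed to
  exclude \<open>y = 0 < x\<close>, where the claim fails for small \<open>x\<close>.
\<close>

lemma gibbs_ineq:
  fixes x y :: real
  assumes "0 \<le> x" "0 \<le> y" "y = 0 \<Longrightarrow> x = 0"
  shows "x * ln y \<le> x * ln x + y - x"
proof (cases "x = 0")
  case False
  with assms(3) have "y \<noteq> 0" by blast
  with False assms have xy: "0 < x" "0 < y" by auto
  then have "ln (y / x) \<le> y / x - 1" by (intro ln_le_minus_one) auto
  then have "x * (ln y - ln x) \<le> x * (y / x - 1)" using xy
    by (intro mult_left_mono) (auto simp: ln_div)
  then show ?thesis using xy by (simp add: algebra_simps)
qed (use assms in auto)

lemma xlnx_ge: "x \<ge> 0 \<Longrightarrow> x * ln x \<ge> - (1::real)"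
  using gibbs_ineq[of x 1] by auto

lemma xlnx_le_bound: "0 \<le> x \<Longrightarrow> x \<le> B \<Longrightarrow> \<bar>x * ln x\<bar> \<le> 1 + B * \<bar>ln B\<bar>" for x B :: real
proof -
  assume x: "0 \<le> x" "x \<le> B"
  have "x * ln x \<le> B * \<bar>ln B\<bar>"
  proof (cases "x \<le> 1")
    case True
    have "x * ln x \<le> 0" using x True by (cases "x = 0") (auto intro: mult_nonneg_nonpos)
    then show ?thesis using x by (smt (verit) mult_nonneg_nonneg abs_ge_zero)
  next
    case False
    then show ?thesis using x by (intro mult_mono) (auto intro: order_trans[OF ln_mono abs_ge_self])
  qed
  moreover have "- 1 \<le> x * ln x" using xlnx_ge[OF x(1)] .
  moreover have "0 \<le> B * \<bar>ln B\<bar>" using x by simp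
  ultimately show ?thesis by linarith
qed

text \<open>
  Gibbs' inequality bounds $p \ln m$ from above by $p \ln p + m - p$, and $m \ge c p$ bounds it
  from below by $p \ln p + p \ln c$.
\<close>

lemma integrable_ln_dominated:
  assumes p: "p \<in> fin_ent M" and m: "integrable M m" and c: "c > 0" and pm: "\<And>x. c * p x \<le> m x"
  shows "integrable M (\<lambda>x. p x * ln (m x))"
    and "(\<integral>x. p x * ln (m x) \<partial>M) \<le> rel_ent M p + (\<integral>x. m x \<partial>M) - 1"
proof -
  note [measurable] = fin_entD(1)[OF p] borel_measurable_integrable[OF m]
  have p0: "0 \<le> p x" for x using fin_entD(2)[OF p] .
  have m0: "0 \<le> m x" for x using pm[of x] p0[of x] c by (meson mult_nonneg_nonneg less_imp_le order_trans)
  have up: "p x * ln (m x) \<le> p x * ln (p x) + m x - p x" for x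
  proof (rule gibbs_ineq[OF p0 m0])
    assume "m x = 0"
    then have "c * p x \<le> 0" using pm[of x] by simp
    then show "p x = 0" using p0[of x] c by (simp add: mult_le_0_iff)
  qed
  have lo: "p x * ln c + p x * ln (p x) \<le> p x * ln (m x)" for x
  proof (cases "p x = 0")
    case False
    with p0[of x] have px: "p x > 0" by simp
    then have "ln (c * p x) \<le> ln (m x)" using pm[of x] c mult_pos_pos[OF c px] by (subst ln_le_cancel_iff) linarith+
    then have "p x * (ln c + ln (p x)) \<le> p x * ln (m x)" using px c by (simp add: ln_mult)
    then show ?thesis by (simp add: algebra_simps)
  qed simp
  show I: "integrable M (\<lambda>x. p x * ln (m x))"
  proof (rule Bochner_Integration.integrable_bound)
    show "integrable M (\<lambda>x. \<bar>p x * ln (p x)\<bar> + m x + p x + p x * \<bar>ln c\<bar>)"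
      using fin_entD[OF p] m by auto
    show "AE x in M. norm (p x * ln (m x)) \<le> norm (\<bar>p x * ln (p x)\<bar> + m x + p x + p x * \<bar>ln c\<bar>)"
    proof (rule AE_I2)
      fix x
      have "p x * ln c \<ge> - (p x * \<bar>ln c\<bar>)" using p0[of x] by (metis abs_ge_minus_self abs_mult abs_of_nonneg minus_le_iff)
      then have "\<bar>p x * ln (m x)\<bar> \<le> \<bar>p x * ln (p x)\<bar> + m x + p x + p x * \<bar>ln c\<bar>"
        using up[of x] lo[of x] p0[of x] m0[of x] mult_nonneg_nonneg[OF p0[of x] abs_ge_zero[of "ln c"]] by linarith
      then show "norm (p x * ln (m x)) \<le> norm (\<bar>p x * ln (p x)\<bar> + m x + p x + p x * \<bar>ln c\<bar>)"
        unfolding real_norm_def using abs_ge_self order_trans by blast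
    qed
  qed simp
  have "(\<integral>x. p x * ln (m x) \<partial>M) \<le> (\<integral>x. p x * ln (p x) + m x - p x \<partial>M)"
    using I fin_entD[OF p] m up by (intro integral_mono) auto
  also have "\<dots> = rel_ent M p + (\<integral>x. m x \<partial>M) - 1"
    using fin_entD[OF p] m by (simp add: rel_ent_def)
  finally show "(\<integral>x. p x * ln (m x) \<partial>M) \<le> rel_ent M p + (\<integral>x. m x \<partial>M) - 1" .
qed

text \<open>
  A mixture dominates a multiple of either component, so both cross entropies are finite.  The
  cross entropy of $q$ relative to $p$ itself can be infinite, since $p$ may vanish where $q$ does
  not; this is why $p$ is compared with mixtures throughout.
\<close>

lemma mix_props:
  assumes p: "p \<in> fin_ent M" and q: "q \<in> fin_ent M" and e: "0 < e" "e < 1"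
  shows mix_fin_ent: "mix e p q \<in> fin_ent M"
    and mix_integrable: "integrable M (\<lambda>x. p x * ln (mix e p q x))" "integrable M (\<lambda>x. q x * ln (mix e p q x))"
    and mix_le: "(\<integral>x. p x * ln (mix e p q x) \<partial>M) \<le> rel_ent M p" "(\<integral>x. q x * ln (mix e p q x) \<partial>M) \<le> rel_ent M q"
    and mix_eq: "rel_ent M (mix e p q) = (1 - e) * (\<integral>x. p x * ln (mix e p q x) \<partial>M) + e * (\<integral>x. q x * ln (mix e p q x) \<partial>M)"
proof -
  have m: "integrable M (mix e p q)" and m1: "(\<integral>x. mix e p q x \<partial>M) = 1"
    using fin_entD[OF p] fin_entD[OF q] by auto
  have pm: "(1 - e) * p x \<le> mix e p q x" and qm: "e * q x \<le> mix e p q x" for x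
    using fin_entD(2)[OF p, of x] fin_entD(2)[OF q, of x] e by auto
  note P = integrable_ln_dominated[OF p m _ pm] and Q = integrable_ln_dominated[OF q m _ qm]
  show I: "integrable M (\<lambda>x. p x * ln (mix e p q x))" "integrable M (\<lambda>x. q x * ln (mix e p q x))"
    using P(1) Q(1) e by auto
  show "(\<integral>x. p x * ln (mix e p q x) \<partial>M) \<le> rel_ent M p" "(\<integral>x. q x * ln (mix e p q x) \<partial>M) \<le> rel_ent M q"
    using P(2) Q(2) e m1 by auto
  have eq: "mix e p q x * ln (mix e p q x) = (1 - e) * (p x * ln (mix e p q x)) + e * (q x * ln (mix e p q x))" for x
    by (simp add: algebra_simps)
  have [measurable]: "p \<in> borel_measurable M" "q \<in> borel_measurable M" using p q by (auto dest: fin_entD)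
  have "integrable M (\<lambda>x. mix e p q x * ln (mix e p q x))" unfolding eq using I by simp
  then show "mix e p q \<in> fin_ent M"
    using m m1 fin_entD(2)[OF p] fin_entD(2)[OF q] e unfolding fin_ent_def by auto
  show "rel_ent M (mix e p q) = (1 - e) * (\<integral>x. p x * ln (mix e p q x) \<partial>M) + e * (\<integral>x. q x * ln (mix e p q x) \<partial>M)"
    unfolding rel_ent_def eq using I by simp
qed

lemma rel_ent_mix_le:
  assumes "p \<in> fin_ent M" "q \<in> fin_ent M" "0 < e" "e < 1"
  shows "rel_ent M (mix e p q) \<le> (1 - e) * rel_ent M p + e * rel_ent M q"
  using mix_le[OF assms] assms(3,4) unfolding mix_eq[OF assms]
  by (intro add_mono mult_left_mono) auto

text \<open>
  The entropy of the mixture $m$ is the convex combination of $\int p \ln m$ and $\int q \ln m$.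
  The first is at most $H(p)$ by Gibbs' inequality, hence at most $H(m)$, so the second is at least
  $H(m)$.
  In the limit $e \to 0$ this is Csiszar's Pythagorean inequality for entropy projections; at
  positive $e$ no logarithm of zero has to be integrated.
\<close>

lemma rel_ent_pythagoras:
  assumes "p \<in> fin_ent M" "q \<in> fin_ent M" "0 < e" "e < 1"
    and le: "rel_ent M p \<le> rel_ent M (mix e p q)"
  shows "rel_ent M p \<le> (\<integral>x. q x * ln (mix e p q x) \<partial>M)"
proof -
  let ?m = "rel_ent M (mix e p q)"
  have "(1 - e) * (\<integral>x. p x * ln (mix e p q x) \<partial>M) \<le> (1 - e) * ?m"
    using mix_le(1)[OF assms(1-4)] le assms(4) by (intro mult_left_mono) auto
  then have "e * ?m \<le> e * (\<integral>x. q x * ln (mix e p q x) \<partial>M)"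
    using mix_eq[OF assms(1-4)] by (simp add: algebra_simps)
  then show ?thesis using le assms(3) by auto
qed

text \<open>
  For the midpoint $m$, the inequality $\ln z \le z - 1$ at $z = \sqrt{m/x}$ gives
  $x \ln x - x \ln m \ge 2 (x - \sqrt{x m})$.  Summed over $x = a, b$ this bounds the convexity
  gap from below by half of $(\sqrt a - \sqrt b)^2$, and weighted AM-GM with weight $s$ passes from
  there to $|a - b| = |\sqrt a - \sqrt b| (\sqrt a + \sqrt b)$.
\<close>

lemma abs_diff_le_convexity_gap:
  fixes a b s :: real
  assumes "0 \<le> a" "0 \<le> b" "0 < s"
  defines "m \<equiv> (a + b) / 2"
  shows "\<bar>a - b\<bar> \<le> 2 * s * (a + b) + (a * ln a + b * ln b - 2 * (m * ln m)) / (2 * s)"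
proof -
  have m: "0 \<le> m" "a + b = 2 * m" using assms by (auto simp: m_def)
  have key: "2 * (x - sqrt x * sqrt m) \<le> x * ln x - x * ln m" if "0 \<le> x" "x > 0 \<Longrightarrow> m > 0" for x
  proof (cases "x = 0")
    case False
    with that have x: "x > 0" "m > 0" by auto
    have "ln (sqrt m / sqrt x) \<le> sqrt m / sqrt x - 1" using x by (intro ln_le_minus_one) auto
    moreover have "ln (sqrt m / sqrt x) = (ln m - ln x) / 2" using x by (simp add: ln_div ln_sqrt)
    ultimately have "x * ((ln m - ln x) / 2) \<le> x * (sqrt m / sqrt x - 1)" using x by (intro mult_left_mono) auto
    moreover have "x * (sqrt m / sqrt x) = sqrt x * sqrt m" using x
      by (metis mult.commute real_sqrt_ge_zero less_imp_le real_div_sqrt times_divide_eq_left times_divide_eq_right)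
    moreover have "x * ((ln m - ln x) / 2) = (x * ln m - x * ln x) / 2" "x * (sqrt m / sqrt x - 1) = x * (sqrt m / sqrt x) - x"
      by (simp_all add: right_diff_distrib)
    ultimately show ?thesis by simp
  qed simp
  have ka: "2 * (a - sqrt a * sqrt m) \<le> a * ln a - a * ln m" using assms by (intro key) auto
  have kb: "2 * (b - sqrt b * sqrt m) \<le> b * ln b - b * ln m" using assms by (intro key) auto
  define u v w where "u = sqrt a" and "v = sqrt b" and "w = sqrt m"
  have sq: "a = u\<^sup>2" "b = v\<^sup>2" "m = w\<^sup>2" using assms(1,2) m by (auto simp: u_def v_def w_def)
  have uv: "u \<ge> 0" "v \<ge> 0" using assms by (auto simp: u_def v_def)
  let ?D = "a * ln a + b * ln b - 2 * (m * ln m)"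
  have "2 * (m * ln m) = a * ln m + b * ln m" using m by (metis distrib_right mult.assoc)
  then have D1: "2 * (u\<^sup>2 - u * w) + 2 * (v\<^sup>2 - v * w) \<le> ?D" using ka kb unfolding u_def[symmetric] v_def[symmetric] w_def[symmetric] sq(1)[symmetric] sq(2)[symmetric] by simp
  have w2: "w\<^sup>2 = (u\<^sup>2 + v\<^sup>2) / 2" using sq m by simp
  have "(u - v)\<^sup>2 \<le> 2 * ((u - w)\<^sup>2 + (v - w)\<^sup>2)"
  proof -
    have "2 * ((u - w)\<^sup>2 + (v - w)\<^sup>2) - (u - v)\<^sup>2 = (u + v - 2 * w)\<^sup>2"
      by (simp add: power2_eq_square algebra_simps)
    then show ?thesis using zero_le_power2[of "u + v - 2 * w"] by linarith
  qed
  also have "\<dots> = 2 * (2 * (u\<^sup>2 - u * w) + 2 * (v\<^sup>2 - v * w))" using w2 by (simp add: power2_eq_square algebra_simps)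
  finally have uvD: "(u - v)\<^sup>2 \<le> 2 * ?D" using mult_left_mono[OF D1, of 2] by (meson order_trans zero_le_numeral)
  have "\<bar>a - b\<bar> = \<bar>u - v\<bar> * (u + v)" unfolding sq using uv
    by (simp add: power2_eq_square square_diff_square_factored abs_mult mult.commute)
  also have "\<dots> \<le> s * (u + v)\<^sup>2 + (u - v)\<^sup>2 / (4 * s)"
  proof -
    have "0 \<le> (2 * s * (u + v) - \<bar>u - v\<bar>)\<^sup>2" by simp
    then have "4 * s * (\<bar>u - v\<bar> * (u + v)) \<le> 4 * s * s * (u + v)\<^sup>2 + (u - v)\<^sup>2"
      by (simp add: power2_eq_square algebra_simps)
    then show ?thesis using \<open>s > 0\<close> by (simp add: field_simps)
  qed
  also have "\<dots> \<le> s * (2 * (a + b)) + (2 * ?D) / (4 * s)"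
  proof (intro add_mono mult_left_mono divide_right_mono uvD)
    show "(u + v)\<^sup>2 \<le> 2 * (a + b)" unfolding sq using sum_squares_bound[of u v] by (simp add: power2_sum)
  qed (use \<open>s > 0\<close> in auto)
  also have "(2 * ?D) / (4 * s) = ?D / (2 * s)"
    using mult_divide_mult_cancel_left[of "2::real" ?D "2 * s"] by simp
  finally show ?thesis by (simp add: algebra_simps)
qed

text \<open>
  Plays the role of Pinsker's inequality: in a convex set, densities of nearly minimal entropy are
  close to each other in $L^1$, because their midpoint cannot have much smaller entropy.
\<close>

lemma L1_dist_le_entropy_gap:
  assumes p: "p \<in> fin_ent M" and q: "q \<in> fin_ent M" and s: "s > 0"
  shows "L1_dist M p q \<le> 4 * s + entropy_gap M p q / (2 * s)"
proof -
  let ?m = "mix (1/2) p q"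
  have m: "?m \<in> fin_ent M" using mix_fin_ent[OF p q, of "1/2"] by simp
  have "L1_dist M p q \<le> (\<integral>x. 2 * s * (p x + q x) + (p x * ln (p x) + q x * ln (q x) - 2 * (?m x * ln (?m x))) / (2 * s) \<partial>M)"
  proof (rule integral_mono)
    fix x
    show "\<bar>p x - q x\<bar> \<le> 2 * s * (p x + q x) + (p x * ln (p x) + q x * ln (q x) - 2 * (?m x * ln (?m x))) / (2 * s)"
      using abs_diff_le_convexity_gap[OF fin_entD(2)[OF p] fin_entD(2)[OF q] s, of x x] by (simp add: add_divide_distrib)
  qed (use fin_entD[OF p] fin_entD[OF q] fin_entD[OF m] in auto)
  also have "\<dots> = 2 * s * (1 + 1) + (rel_ent M p + rel_ent M q - 2 * rel_ent M ?m) / (2 * s)"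
    using fin_entD[OF p] fin_entD[OF q] fin_entD[OF m] by (simp add: rel_ent_def)
  finally show ?thesis by simp
qed

lemma fatou_bound:
  fixes f :: "nat \<Rightarrow> 'a \<Rightarrow> real"
  assumes f: "\<And>n. integrable M (f n)" "\<And>n x. x \<in> space M \<Longrightarrow> 0 \<le> f n x" and g[measurable]: "g \<in> borel_measurable M"
    and lim: "AE x in M. (\<lambda>n. f n x) \<longlonglongrightarrow> g x"
    and bd: "eventually (\<lambda>n. (\<integral>x. f n x \<partial>M) \<le> c) sequentially"
  shows "integrable M g" "(\<integral>x. g x \<partial>M) \<le> c"
proof -
  note [measurable] = borel_measurable_integrable[OF f(1)]
  have g0: "AE x in M. 0 \<le> g x" using lim AE_space
    by eventually_elim (use f(2) LIMSEQ_le_const in blast)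
  obtain N where N: "(\<integral>x. f N x \<partial>M) \<le> c" using bd by (auto simp: eventually_sequentially)
  have c0: "0 \<le> c" using N integral_nonneg_AE[OF AE_I2, of M "f N"] f(2) by (meson order_trans)
  have "(\<integral>\<^sup>+x. ennreal (g x) \<partial>M) = (\<integral>\<^sup>+x. liminf (\<lambda>n. ennreal (f n x)) \<partial>M)"
    using lim by (intro nn_integral_cong_AE) (auto elim!: eventually_mono intro!: lim_imp_Liminf[symmetric])
  also have "\<dots> \<le> liminf (\<lambda>n. \<integral>\<^sup>+x. ennreal (f n x) \<partial>M)" by (intro nn_integral_liminf) auto
  also have "\<dots> = liminf (\<lambda>n. ennreal (\<integral>x. f n x \<partial>M))"
    using f by (intro arg_cong[where f=liminf] ext nn_integral_eq_integral) auto
  also have "\<dots> \<le> ennreal c"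
    by (rule Liminf_le) (use bd in \<open>auto elim!: eventually_mono intro!: ennreal_leI\<close>)
  finally have le: "(\<integral>\<^sup>+x. ennreal (g x) \<partial>M) \<le> ennreal c" .
  show I: "integrable M g" using g0 le
    by (intro integrableI_nonneg) (auto simp: less_top[symmetric] top_unique)
  show "(\<integral>x. g x \<partial>M) \<le> c" using le c0 g0 nn_integral_eq_integral[OF I g0] by simp
qed

text \<open>
  The subsequence that converges almost everywhere is part of the conclusion, because Fatou's
  lemma is applied along it.
\<close>

lemma L1_complete:
  fixes f :: "nat \<Rightarrow> 'a \<Rightarrow> real"
  assumes f: "\<And>n. integrable M (f n)" "\<And>n x. 0 \<le> f n x"
    and cauchy: "\<And>e. e > 0 \<Longrightarrow> \<exists>N. \<forall>m\<ge>N. \<forall>n\<ge>N. L1_dist M (f m) (f n) < e"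
  obtains g r where "integrable M g" "\<And>x. 0 \<le> g x" "(\<lambda>n. L1_dist M (f n) g) \<longlonglongrightarrow> 0"
    "strict_mono r" "AE x in M. (\<lambda>n. f (r n) x) \<longlonglongrightarrow> g x"
proof -
  have "\<exists>N. \<forall>i\<ge>N. \<forall>j\<ge>N. (LINT x|M. norm (f i x - f j x)) < e" if "e > 0" for e
    using cauchy[OF that] by auto
  from cauchy_L1_AE_cauchy_subseq[OF f(1) this] obtain r where r: "strict_mono r" "AE x in M. Cauchy (\<lambda>i. f (r i) x)" by auto
  note [measurable] = borel_measurable_integrable[OF f(1)]
  define g where "g x = max 0 (lim (\<lambda>i. f (r i) x))" for x
  have [measurable]: "g \<in> borel_measurable M" unfolding g_def by measurable
  have g0: "0 \<le> g x" for x by (simp add: g_def)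
  have lim: "AE x in M. (\<lambda>i. f (r i) x) \<longlonglongrightarrow> g x" using r(2)
  proof eventually_elim
    case (elim x)
    then have "(\<lambda>i. f (r i) x) \<longlonglongrightarrow> lim (\<lambda>i. f (r i) x)" using Cauchy_convergent convergent_LIMSEQ_iff by blast
    moreover from this have "0 \<le> lim (\<lambda>i. f (r i) x)" using f(2) LIMSEQ_le_const by blast
    ultimately show ?case by (simp add: g_def)
  qed
  have dist: "integrable M (\<lambda>x. \<bar>f n x - g x\<bar>) \<and> L1_dist M (f n) g \<le> e"
    if N: "\<forall>m\<ge>N. \<forall>n\<ge>N. L1_dist M (f m) (f n) < e" and n: "n \<ge> N" for n N e
  proof -
    have ev: "eventually (\<lambda>i. L1_dist M (f n) (f (r i)) \<le> e) sequentially"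
      using eventually_ge_at_top[of N]
    proof eventually_elim
      case (elim i)
      then have "r i \<ge> N" using seq_suble[OF r(1), of i] by linarith
      then show ?case using N n by (simp add: less_imp_le)
    qed
    have "AE x in M. (\<lambda>i. \<bar>f n x - f (r i) x\<bar>) \<longlonglongrightarrow> \<bar>f n x - g x\<bar>" using lim
      by eventually_elim (intro tendsto_intros)
    from fatou_bound[OF _ _ _ this ev] f show ?thesis by auto
  qed
  obtain N1 where N1: "\<forall>m\<ge>N1. \<forall>n\<ge>N1. L1_dist M (f m) (f n) < 1" using cauchy[of 1] by auto
  have I1: "integrable M (\<lambda>x. \<bar>f N1 x - g x\<bar>)" using dist[OF N1, of N1] by auto
  have "integrable M (\<lambda>x. f N1 x - g x)" using I1 by (simp add: integrable_abs_iff)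
  from Bochner_Integration.integrable_diff[OF f(1)[of N1] this]
have gI: "integrable M g" by simp
  have "(\<lambda>n. L1_dist M (f n) g) \<longlonglongrightarrow> 0"
  proof (rule LIMSEQ_I)
    fix e :: real assume "0 < e"
    then obtain N where N: "\<forall>m\<ge>N. \<forall>n\<ge>N. L1_dist M (f m) (f n) < e / 2" using cauchy[of "e/2"] by auto
    show "\<exists>N. \<forall>n\<ge>N. norm (L1_dist M (f n) g - 0) < e"
    proof (intro exI allI impI)
      fix n assume "N \<le> n"
      with dist[OF N] have "L1_dist M (f n) g \<le> e / 2" by auto
      moreover have "0 \<le> L1_dist M (f n) g" by simp
      ultimately show "norm (L1_dist M (f n) g - 0) < e" using \<open>0 < e\<close> by simp
    qed
  qed
  from that[OF gI g0 this r(1) lim] show thesis .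
qed

text \<open>
  Entropy is lower semicontinuous in $L^1$: the function $x \ln x + 1$ is nonnegative, and
  continuous on $[0,\infty)$ also at $0$, so Fatou's lemma applies.
\<close>

lemma (in prob_space) fin_ent_L1_limit:
  assumes q: "\<And>n. q n \<in> fin_ent M"
    and cauchy: "\<And>e. e > 0 \<Longrightarrow> \<exists>N. \<forall>m\<ge>N. \<forall>n\<ge>N. L1_dist M (q m) (q n) < e"
    and ent: "(\<lambda>n. rel_ent M (q n)) \<longlonglongrightarrow> c"
  obtains p where "p \<in> fin_ent M" "rel_ent M p \<le> c" "(\<lambda>n. L1_dist M (q n) p) \<longlonglongrightarrow> 0"
proof -
  obtain p r where p: "integrable M p" "\<And>x. 0 \<le> p x" "(\<lambda>n. L1_dist M (q n) p) \<longlonglongrightarrow> 0"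
    and r: "strict_mono r" "AE x in M. (\<lambda>n. q (r n) x) \<longlonglongrightarrow> p x"
    using L1_complete[of M q, OF fin_entD(3)[OF q] fin_entD(2)[OF q] cauchy] by blast
  note [measurable] = borel_measurable_integrable[OF p(1)]
  have "(\<lambda>n. \<integral>x. q n x \<partial>M) \<longlonglongrightarrow> (\<integral>x. p x \<partial>M)"
  proof (rule LIMSEQ_I)
    fix e :: real assume "0 < e"
    then obtain N where N: "\<And>n. n \<ge> N \<Longrightarrow> L1_dist M (q n) p < e"
      using LIMSEQ_D[OF p(3), of e] by auto
    have "norm ((\<integral>x. q n x \<partial>M) - (\<integral>x. p x \<partial>M)) < e" if "n \<ge> N" for n
    proof -
      have "(\<integral>x. q n x \<partial>M) - (\<integral>x. p x \<partial>M) = (\<integral>x. q n x - p x \<partial>M)" using fin_entD[OF q] p(1) by simp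
      then show ?thesis using N[OF that] integral_abs_bound[of M "\<lambda>x. q n x - p x"] unfolding real_norm_def by linarith
    qed
    then show "\<exists>N. \<forall>n\<ge>N. norm ((\<integral>x. q n x \<partial>M) - (\<integral>x. p x \<partial>M)) < e" by blast
  qed
  then have p1: "(\<integral>x. p x \<partial>M) = 1" using fin_entD(4)[OF q] LIMSEQ_unique[OF tendsto_const] by fastforce
  let ?u = "\<lambda>x::real. x * ln x"
  have cont: "isCont ?u x" if "x > 0" for x using that by (auto intro!: continuous_intros)
  have u0: "?u \<midarrow>0\<rightarrow> 0"
  proof -
    have 1: "(?u \<longlongrightarrow> 0) (at_right 0)" by real_asymp
    have 2: "((\<lambda>x. x * ln (-x)) \<longlongrightarrow> 0) (at_left (0::real))" by real_asymp
    have "eventually (\<lambda>x. x * ln (-x) = ?u x) (at_left (0::real))"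
      by (auto simp: eventually_at_filter ln_minus)
    then have "(?u \<longlongrightarrow> 0) (at_left 0)" using 2 by (rule Lim_transform_eventually[rotated])
    with 1 show ?thesis by (simp add: filterlim_at_split)
  qed
  have cont: "isCont ?u x" if "x \<ge> 0" for x using that cont u0 by (cases "x = 0") (auto simp: isCont_def)
  have lim: "AE x in M. (\<lambda>n. ?u (q (r n) x) + 1) \<longlonglongrightarrow> ?u (p x) + 1" using r(2)
    by eventually_elim (intro tendsto_intros isCont_tendsto_compose[OF cont] p(2))
  have I: "integrable M (\<lambda>x. ?u (p x) + 1)" and le: "(\<integral>x. ?u (p x) + 1 \<partial>M) \<le> c + e + 1" if "e > 0" for e
  proof -
    have "(\<lambda>n. rel_ent M (q (r n))) \<longlonglongrightarrow> c" using LIMSEQ_subseq_LIMSEQ[OF ent r(1)] by (simp add: o_def)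
    then have "eventually (\<lambda>n. rel_ent M (q (r n)) < c + e) sequentially" using \<open>e > 0\<close> by (simp add: order_tendstoD(2))
    then have ev: "eventually (\<lambda>n. (\<integral>x. ?u (q (r n) x) + 1 \<partial>M) \<le> c + e + 1) sequentially"
      using fin_entD[OF q] by (auto elim!: eventually_mono simp: rel_ent_def prob_space)
    have "0 \<le> ?u (q (r n) x) + 1" for n x using xlnx_ge[OF fin_entD(2)[OF q], of "r n" x] by simp
    from fatou_bound[OF _ this _ lim ev] fin_entD(5)[OF q]
    show "integrable M (\<lambda>x. ?u (p x) + 1)" "(\<integral>x. ?u (p x) + 1 \<partial>M) \<le> c + e + 1" by auto
  qed
  have "integrable M (\<lambda>x. (?u (p x) + 1) - 1)" using I[of 1] by (intro Bochner_Integration.integrable_diff) auto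
  then have Iu: "integrable M (\<lambda>x. ?u (p x))" by simp
  then have pf: "p \<in> fin_ent M" using p p1 by (auto simp: fin_ent_def)
  have "rel_ent M p \<le> c + e" if "e > 0" for e
    using le[OF that] Iu by (simp add: rel_ent_def prob_space)
  then have "rel_ent M p \<le> c" by (rule field_le_epsilon)
  from that[OF pf this p(3)] show thesis .
qed

section \<open>Products of densities\<close>

text \<open>
  From $e^{-x} \ge 1 - x$, so that $e^x \le 1/(1-x) = 1 + x + x^2/(1-x)$.
\<close>

lemma exp_le_quadratic: "\<bar>x\<bar> \<le> 1/2 \<Longrightarrow> exp x \<le> 1 + x + 2 * x\<^sup>2" for x :: real
proof -
  assume x: "\<bar>x\<bar> \<le> 1/2"
  have "1 = exp x * exp (- x)" by (simp add: exp_minus)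
  also have "\<dots> \<ge> exp x * (1 - x)" using exp_ge_add_one_self[of "- x"] by (intro mult_left_mono) auto
  finally have 1: "exp x * (1 - x) \<le> 1" .
  have "0 \<le> x * x * (1 - 2 * x)" using x by (intro mult_nonneg_nonneg[OF zero_le_square]) auto
  then have "1 \<le> (1 + x + 2 * x\<^sup>2) * (1 - x)" by (simp add: power2_eq_square algebra_simps)
  with 1 have "exp x * (1 - x) \<le> (1 + x + 2 * x\<^sup>2) * (1 - x)" by linarith
  moreover have "0 < 1 - x" using x by linarith
  ultimately show ?thesis by (rule mult_right_le_imp_le)
qed

lemma fin_ent_prob_space:
  assumes "q \<in> fin_ent M"
  shows "prob_space (law M q)"
proof
  note q = fin_entD[OF assms]
  have "(\<integral>\<^sup>+x. ennreal (q x) \<partial>M) = 1" using nn_integral_eq_integral[OF q(3)] q(2,4) by simp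
  then show "emeasure (law M q) (space (law M q)) = 1"
    using q(1) by (simp add: emeasure_density cong: nn_integral_cong)
qed

context prob_space begin

abbreviation iid :: "nat set \<Rightarrow> (nat \<Rightarrow> 'a) measure" where
  "iid J \<equiv> PiM J (\<lambda>_. M)"

sublocale iid: product_sigma_finite "\<lambda>_::nat. M"
  by unfold_locales

lemma prob_space_iid: "prob_space (iid J)"
  by (intro prob_space_PiM) unfold_locales

lemma PiM_density:
  assumes J: "finite J" and q: "q \<in> fin_ent M"
  shows "PiM J (\<lambda>_. law M q) = density (iid J) (\<lambda>x. ennreal (\<Prod>i\<in>J. q (x i)))"
proof -
  note [measurable] = fin_entD(1)[OF q]
  let ?N = "law M q"
  interpret N: prob_space ?N by (rule fin_ent_prob_space[OF q])
  have NP: "product_sigma_finite (\<lambda>_::nat. ?N)" by (simp add: product_sigma_finite_def N.sigma_finite_measure_axioms)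
  have "density (iid J) (\<lambda>x. ennreal (\<Prod>i\<in>J. q (x i))) = PiM J (\<lambda>_. ?N)"
  proof (rule product_sigma_finite.PiM_eqI[OF NP J])
    show "sets (density (iid J) (\<lambda>x. ennreal (\<Prod>i\<in>J. q (x i)))) = sets (PiM J (\<lambda>_. ?N))"
      by (simp cong: sets_PiM_cong)
    fix A assume "\<And>i. i \<in> J \<Longrightarrow> A i \<in> sets ?N"
    then have A[measurable]: "\<And>i. i \<in> J \<Longrightarrow> A i \<in> sets M" by simp
    have [measurable]: "Pi\<^sub>E J A \<in> sets (iid J)" using A J by (intro sets_PiM_I_finite) auto
    have "emeasure (density (iid J) (\<lambda>x. ennreal (\<Prod>i\<in>J. q (x i)))) (Pi\<^sub>E J A)
        = (\<integral>\<^sup>+x. ennreal (\<Prod>i\<in>J. q (x i)) * indicator (Pi\<^sub>E J A) x \<partial>iid J)"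
      by (subst emeasure_density) auto
    also have "\<dots> = (\<integral>\<^sup>+x. (\<Prod>i\<in>J. ennreal (q (x i)) * indicator (A i) (x i)) \<partial>iid J)"
    proof (intro nn_integral_cong)
      fix x assume "x \<in> space (iid J)"
      then have "indicator (Pi\<^sub>E J A) x = (\<Prod>i\<in>J. indicator (A i) (x i) :: ennreal)"
        using J by (auto simp: indicator_def space_PiM PiE_def prod_zero_iff Pi_iff split: if_splits)
      then show "ennreal (\<Prod>i\<in>J. q (x i)) * indicator (Pi\<^sub>E J A) x = (\<Prod>i\<in>J. ennreal (q (x i)) * indicator (A i) (x i))"
        using fin_entD(2)[OF q] by (simp add: prod.distrib prod_ennreal)
    qed
    also have "\<dots> = (\<Prod>i\<in>J. \<integral>\<^sup>+x. ennreal (q x) * indicator (A i) x \<partial>M)"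
      using J by (intro iid.product_nn_integral_prod) auto
    also have "\<dots> = (\<Prod>i\<in>J. emeasure ?N (A i))"
      by (intro prod.cong) (auto simp: emeasure_density)
    finally show "emeasure (density (iid J) (\<lambda>x. ennreal (\<Prod>i\<in>J. q (x i)))) (Pi\<^sub>E J A) = (\<Prod>i\<in>J. emeasure ?N (A i))" .
  qed
  then show ?thesis by simp
qed

lemma integral_PiM_density:
  assumes J: "finite J" and q: "q \<in> fin_ent M" and f[measurable]: "f \<in> borel_measurable (iid J)"
  shows "(\<integral>x. f x \<partial>PiM J (\<lambda>_. law M q)) = (\<integral>x. (\<Prod>i\<in>J. q (x i)) * f x \<partial>iid J)"
proof -
  note [measurable] = fin_entD(1)[OF q]
  show ?thesis unfolding PiM_density[OF J q]
    by (subst integral_density) (auto intro!: prod_nonneg fin_entD(2)[OF q])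
qed

text \<open>
  Both products dominate the product of $\min(a,b)$, whose total mass is
  $(1 - \tau)^{|J|} \ge 1 - |J| \tau$, where $\tau$ is half of the $L^1$-distance.  So at most
  $|J| \tau$ of the mass of each of them is left over.
\<close>

lemma PiM_density_diff_le:
  fixes K :: real
  assumes J: "finite J" and a: "a \<in> fin_ent M" and b: "b \<in> fin_ent M"
    and f[measurable]: "f \<in> borel_measurable (iid J)" and K: "\<And>x. x \<in> space (iid J) \<Longrightarrow> \<bar>f x\<bar> \<le> K"
  shows "\<bar>(\<integral>x. f x \<partial>PiM J (\<lambda>_. law M a)) - (\<integral>x. f x \<partial>PiM J (\<lambda>_. law M b))\<bar>
    \<le> K * card J * L1_dist M a b"
proof -
  note [measurable] = fin_entD(1)[OF a] fin_entD(1)[OF b]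
  define c where "c x = min (a x) (b x)" for x
  have [measurable]: "c \<in> borel_measurable M" unfolding c_def by measurable
  have c: "0 \<le> c x" "c x \<le> a x" "c x \<le> b x" for x using fin_entD(2)[OF a] fin_entD(2)[OF b] by (auto simp: c_def)
  have cI: "integrable M c" unfolding c_def using fin_entD(3)[OF a] fin_entD(3)[OF b] by auto
  have abs: "\<bar>a x - b x\<bar> = a x + b x - 2 * c x" for x by (auto simp: c_def)
  have tv: "L1_dist M a b = 2 - 2 * (\<integral>x. c x \<partial>M)"
    unfolding abs using fin_entD[OF a] fin_entD[OF b] cI by simp
  let ?A = "\<lambda>x. \<Prod>i\<in>J. a (x i)" and ?B = "\<lambda>x. \<Prod>i\<in>J. b (x i)" and ?C = "\<lambda>x. \<Prod>i\<in>J. c (x i)"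
  have I: "integrable (iid J) ?A" "integrable (iid J) ?B" "integrable (iid J) ?C"
    using fin_entD(3)[OF a] fin_entD(3)[OF b] cI J by (auto intro!: iid.product_integrable_prod)
  have prod_int: "(\<integral>x. (\<Prod>i\<in>J. g (x i)) \<partial>iid J) = (\<integral>x. g x \<partial>M) ^ card J" if "integrable M g" for g :: "'a \<Rightarrow> real"
    using iid.product_integral_prod[OF J, of "\<lambda>_. g"] that by simp
  have E: "integral\<^sup>L (iid J) ?A = 1" "integral\<^sup>L (iid J) ?B = 1" "integral\<^sup>L (iid J) ?C = (\<integral>x. c x \<partial>M) ^ card J"
    using fin_entD(3,4)[OF a] fin_entD(3,4)[OF b] cI by (simp_all add: prod_int)
  obtain x0 where x0: "x0 \<in> space (iid J)" using prob_space.not_empty[OF prob_space_iid] by blast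
  have K0: "0 \<le> K" using K[OF x0] by (meson abs_ge_zero order_trans)
  have fI: "integrable (iid J) (\<lambda>x. g x * f x)" if g: "integrable (iid J) g" for g
  proof (rule Bochner_Integration.integrable_bound)
    show "integrable (iid J) (\<lambda>x. K * g x)" using g by simp
    show "AE x in iid J. norm (g x * f x) \<le> norm (K * g x)"
      using K K0 by (intro AE_I2) (auto simp: abs_mult mult.commute intro!: mult_right_mono)
  qed (use g in measurable)
  have P0: "0 \<le> ?C x" "?C x \<le> ?A x" "?C x \<le> ?B x" for x
    using c by (auto intro!: prod_nonneg prod_mono)
  have pt: "\<bar>?A x * f x - ?B x * f x\<bar> \<le> K * (?A x - ?C x) + K * (?B x - ?C x)" if "x \<in> space (iid J)" for x
  proof -
    have "\<bar>?A x * f x - ?B x * f x\<bar> = \<bar>?A x - ?B x\<bar> * \<bar>f x\<bar>" by (simp add: abs_mult[symmetric] left_diff_distrib)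
    also have "\<dots> \<le> ((?A x - ?C x) + (?B x - ?C x)) * K"
      using P0[of x] K[OF that] by (intro mult_mono) auto
    finally show ?thesis by (simp add: algebra_simps)
  qed
  have tau: "0 \<le> (\<integral>x. c x \<partial>M)" using c by simp
  have "\<bar>(\<integral>x. ?A x * f x \<partial>iid J) - (\<integral>x. ?B x * f x \<partial>iid J)\<bar> = \<bar>\<integral>x. ?A x * f x - ?B x * f x \<partial>iid J\<bar>"
    using I fI by simp
  also have "\<dots> \<le> (\<integral>x. \<bar>?A x * f x - ?B x * f x\<bar> \<partial>iid J)" by (rule integral_abs_bound)
  also have "\<dots> \<le> (\<integral>x. K * (?A x - ?C x) + K * (?B x - ?C x) \<partial>iid J)"
    using I fI pt by (intro integral_mono) auto
  also have "\<dots> = 2 * K * (1 - (\<integral>x. c x \<partial>M) ^ card J)" using I E by (simp add: algebra_simps)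
  also have "\<dots> \<le> 2 * K * (card J * (1 - (\<integral>x. c x \<partial>M)))"
    using Bernoulli_inequality[of "(\<integral>x. c x \<partial>M) - 1" "card J"] tau K0
    by (intro mult_left_mono) (auto simp: algebra_simps)
  also have "\<dots> = K * card J * L1_dist M a b" unfolding tv by (simp add: algebra_simps)
  finally show ?thesis unfolding integral_PiM_density[OF J a f] integral_PiM_density[OF J b f] .
qed

text \<open>
  Additivity of entropy: $W \ln W$ for $W = \prod_i q(x_i)$ is the sum over $i$ of the products
  whose $i$-th factor is $q \ln q$ and whose other factors are $q$, also where $q$ vanishes.
\<close>

lemma iid_product_fin_ent:
  assumes J: "finite J" and q: "q \<in> fin_ent M"
  shows "(\<lambda>x. \<Prod>i\<in>J. q (x i)) \<in> fin_ent (iid J)" "rel_ent (iid J) (\<lambda>x. \<Prod>i\<in>J. q (x i)) = card J * rel_ent M q"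
proof -
  note [measurable] = fin_entD(1)[OF q]
  let ?W = "\<lambda>x. \<Prod>i\<in>J. q (x i)"
  let ?u = "\<lambda>i l x. if l = i then q x * ln (q x) else q x"
  have uI: "integrable M (?u i l)" for i l using fin_entD(3,5)[OF q] by (cases "l = i") auto
  have ent: "?W x * ln (?W x) = (\<Sum>i\<in>J. \<Prod>l\<in>J. ?u i l (x l))" for x
  proof -
    have t: "(\<Prod>l\<in>J. ?u i l (x l)) = ?W x * ln (q (x i))" if "i \<in> J" for i
    proof -
      have "(\<Prod>l\<in>J. ?u i l (x l)) = ?u i i (x i) * (\<Prod>l\<in>J - {i}. ?u i l (x l))"
        using J that by (rule prod.remove)
      also have "(\<Prod>l\<in>J - {i}. ?u i l (x l)) = (\<Prod>l\<in>J - {i}. q (x l))" by (intro prod.cong) auto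
      finally show ?thesis using prod.remove[OF J that, of "\<lambda>l. q (x l)"] by simp
    qed
    show ?thesis
    proof (cases "\<exists>i\<in>J. q (x i) = 0")
      case True
      then have "?W x = 0" using J by (simp add: prod_zero_iff)
      then show ?thesis using t by simp
    next
      case False
      then have "\<And>i. i \<in> J \<Longrightarrow> q (x i) > 0" using fin_entD(2)[OF q] by (simp add: less_le)
      then have "ln (?W x) = (\<Sum>i\<in>J. ln (q (x i)))" using J by (intro ln_prod) (auto simp: less_imp_neq[symmetric])
      then show ?thesis using t by (simp add: sum_distrib_left)
    qed
  qed
  have I: "integrable (iid J) ?W" "integral\<^sup>L (iid J) ?W = 1"
    using fin_entD(3,4)[OF q] J iid.product_integral_prod[OF J, of "\<lambda>_. q"] by (auto intro!: iid.product_integrable_prod)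
  have uP: "integrable (iid J) (\<lambda>x. \<Prod>l\<in>J. ?u i l (x l))" for i
    using J uI by (intro iid.product_integrable_prod) auto
  have "integrable (iid J) (\<lambda>x. ?W x * ln (?W x))" unfolding ent using uP by auto
  then show "?W \<in> fin_ent (iid J)" using I fin_entD(2)[OF q] by (auto simp: fin_ent_def intro!: prod_nonneg)
  have "(\<integral>x. (\<Prod>l\<in>J. ?u i l (x l)) \<partial>iid J) = rel_ent M q" if "i \<in> J" for i
  proof -
    have "(\<integral>x. (\<Prod>l\<in>J. ?u i l (x l)) \<partial>iid J) = (\<Prod>l\<in>J. integral\<^sup>L M (?u i l))"
      using J uI by (intro iid.product_integral_prod) auto
    also have "\<dots> = (\<Prod>l\<in>J. if l = i then rel_ent M q else 1)"
      using fin_entD(4)[OF q] by (intro prod.cong) (auto simp: rel_ent_def)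
    finally show ?thesis using J that by (simp add: prod.delta)
  qed
  then show "rel_ent (iid J) ?W = card J * rel_ent M q" unfolding rel_ent_def[of "iid J"] ent using uP by simp
qed

text \<open>
  Relative entropy decreases when only $C$ and its complement are observed; the complement
  contributes at least $-1$, as $x \ln x \ge -1$.  So the entropy of any density under which $C$
  is likely bounds $- \ln P(C)$ from above.
\<close>

lemma event_lower_bound:
  assumes W: "W \<in> fin_ent M" and C[measurable]: "C \<in> sets M"
    and pos: "measure (law M W) C > 0" (is "?a > 0")
  shows "prob C > 0" "?a * ln (?a / prob C) \<le> rel_ent M W + 1"
proof -
  note [measurable] = fin_entD(1)[OF W]
  interpret D: prob_space "law M W" by (rule fin_ent_prob_space[OF W])
  have a: "?a = (\<integral>x. W x * indicator C x \<partial>M)"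
  proof -
    have "?a = (\<integral>x. indicator C x \<partial>law M W)" by simp
    also have "\<dots> = (\<integral>x. W x * indicator C x \<partial>M)" by (subst integral_density) (auto simp: fin_entD(2)[OF W])
    finally show ?thesis .
  qed
  have WC: "integrable M (\<lambda>x. W x * indicator C x)" "integrable M (\<lambda>x. W x * ln (W x) * indicator C x)"
    using fin_entD(3,5)[OF W] by (auto intro!: integrable_real_mult_indicator)
  have IC: "integrable M (indicator C :: _ \<Rightarrow> real)" by (auto simp: less_top[symmetric])
  show c: "prob C > 0"
  proof (rule ccontr)
    assume "\<not> prob C > 0"
    then have "prob C = 0" using zero_less_measure_iff by blast
    then have "AE x in M. x \<notin> C" using prob_eq_0[OF C] by simp
    then have "(\<integral>x. W x * indicator C x \<partial>M) = (\<integral>x. 0 \<partial>M)" by (intro integral_cong_AE) auto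
    then show False using pos a by simp
  qed
  define w where "w = ?a / prob C"
  have w: "w > 0" using c pos by (simp add: w_def)
  have "?a * ln w = (\<integral>x. (W x * indicator C x) * ln w \<partial>M)" using a by simp
  also have "\<dots> \<le> (\<integral>x. (W x * ln (W x) * indicator C x) + w * indicator C x - W x * indicator C x \<partial>M)"
  proof (rule integral_mono)
    fix x
    show "W x * indicator C x * ln w \<le> W x * ln (W x) * indicator C x + w * indicator C x - W x * indicator C x"
      using gibbs_ineq[OF fin_entD(2)[OF W, of x] less_imp_le[OF w]] w by (auto simp: indicator_def)
  qed (use WC IC in auto)
  also have "\<dots> = (\<integral>x. W x * ln (W x) * indicator C x \<partial>M) + w * prob C - ?a"
    using WC IC a by simp
  also have "\<dots> = (\<integral>x. W x * ln (W x) * indicator C x \<partial>M)" using c by (simp add: w_def)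
  also have "\<dots> \<le> (\<integral>x. W x * ln (W x) + 1 \<partial>M)"
  proof (rule integral_mono)
    fix x show "W x * ln (W x) * indicator C x \<le> W x * ln (W x) + 1"
      using xlnx_ge[OF fin_entD(2)[OF W, of x]] by (auto simp: indicator_def)
  qed (use WC fin_entD(5)[OF W] in auto)
  also have "\<dots> = rel_ent M W + 1" using fin_entD(5)[OF W] by (simp add: rel_ent_def prob_space)
  finally show "?a * ln (?a / prob C) \<le> rel_ent M W + 1" by (simp add: w_def)
qed

lemma iid_event_lower_bound:
  assumes J: "finite J" and q: "q \<in> fin_ent M" and C: "C \<in> sets (iid J)"
    and pos: "measure (PiM J (\<lambda>_. law M q)) C > 0" (is "?a > 0")
  shows "measure (iid J) C > 0" "?a * ln (?a / measure (iid J) C) \<le> card J * rel_ent M q + 1"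
  using prob_space.event_lower_bound[OF prob_space_iid iid_product_fin_ent(1)[OF J q] C] pos
  unfolding PiM_density[OF J q] iid_product_fin_ent(2)[OF J q] by auto

lemma exchangeable_uniform_measure:
  assumes T[measurable]: "T \<in> M \<rightarrow>\<^sub>M M" and inv: "distr M M T = M" and C[measurable]: "C \<in> sets M"
    and sym: "\<And>x. x \<in> space M \<Longrightarrow> T x \<in> C \<longleftrightarrow> x \<in> C"
  shows "distr (uniform_measure M C) (uniform_measure M C) T = uniform_measure M C"
proof (rule measure_eqI)
  fix A assume "A \<in> sets (distr (uniform_measure M C) (uniform_measure M C) T)"
  then have A[measurable]: "A \<in> sets M" by simp
  have "emeasure (distr (uniform_measure M C) (uniform_measure M C) T) A = emeasure (uniform_measure M C) (T -` A \<inter> space M)"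
    by (subst emeasure_distr) auto
  also have "\<dots> = emeasure M (C \<inter> (T -` A \<inter> space M)) / emeasure M C"
    by (rule emeasure_uniform_measure) auto
  also have "C \<inter> (T -` A \<inter> space M) = T -` (C \<inter> A) \<inter> space M"
    using sym sets.sets_into_space[OF C] by auto
  also have "emeasure M \<dots> = emeasure (distr M M T) (C \<inter> A)" by (subst emeasure_distr) auto
  finally show "emeasure (distr (uniform_measure M C) (uniform_measure M C) T) A = emeasure (uniform_measure M C) A"
    by (simp add: inv emeasure_uniform_measure)
qed simp

section \<open>Conditioning on a symmetric event\<close>

text \<open>
  The density of $Q$ is bounded by $B$, and $x \ln x$ is bounded on $[0,B]$.
\<close>

lemma dominated_has_fin_ent_density:
  assumes Q: "prob_space Q" "sets Q = sets M" and B: "B \<ge> 0"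
    and dom: "\<And>A. A \<in> sets M \<Longrightarrow> emeasure Q A \<le> ennreal B * emeasure M A"
  shows "\<exists>q\<in>fin_ent M. Q = law M q"
proof -
  interpret Q: prob_space Q by fact
  have ac: "absolutely_continuous M Q"
    unfolding absolutely_continuous_def
  proof
    fix A assume "A \<in> null_sets M"
    then have A: "A \<in> sets M" "emeasure M A = 0" by auto
    then show "A \<in> null_sets Q" using dom[OF A(1)] Q by auto
  qed
  obtain r where r[measurable]: "r \<in> borel_measurable M" and r0: "\<And>x. 0 \<le> r x"
    and Qr: "Q = law M r"
  proof -
    obtain D where D: "D \<in> borel_measurable M" "AE x in M. RN_deriv M Q x = ennreal (D x)" "AE x in Q. 0 < D x" "\<And>x. 0 \<le> D x"
      using real_RN_deriv[OF Q.finite_measure_axioms ac Q(2)] by blast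
    have "Q = density M (RN_deriv M Q)" using density_RN_deriv[OF ac Q(2)] by simp
    also have "\<dots> = law M D" using D by (intro density_cong) auto
    finally show thesis using D that by blast
  qed
  have r1: "(\<integral>\<^sup>+x. ennreal (r x) \<partial>M) = 1"
    using Q.emeasure_space_1 unfolding Qr by (simp add: emeasure_density cong: nn_integral_cong)
  have rI: "integrable M r" using r0 r1 by (intro integrableI_nonneg) auto
  have AEb: "AE x in M. r x \<le> B"
  proof -
    define A where "A = {x \<in> space M. r x > B}"
    have A[measurable]: "A \<in> sets M" unfolding A_def by measurable
    have IA: "integrable M (\<lambda>x. r x * indicator A x)" "integrable M (indicator A :: _ \<Rightarrow> real)"
      using rI by (auto intro!: integrable_real_mult_indicator simp: less_top[symmetric])
    have "ennreal (\<integral>x. r x * indicator A x \<partial>M) = (\<integral>\<^sup>+x. ennreal (r x * indicator A x) \<partial>M)"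
      using IA r0 by (intro nn_integral_eq_integral[symmetric]) auto
    also have "\<dots> = emeasure Q A" unfolding Qr by (simp add: emeasure_density ennreal_mult' ennreal_indicator r0)
    also have "\<dots> \<le> ennreal (B * prob A)" using dom[OF A] B by (simp add: emeasure_eq_measure ennreal_mult)
    finally have "(\<integral>x. r x * indicator A x \<partial>M) \<le> B * prob A" using B by (subst (asm) ennreal_le_iff) auto
    then have "(\<integral>x. r x * indicator A x - B * indicator A x \<partial>M) \<le> 0" using IA by simp
    moreover have "0 \<le> (\<integral>x. r x * indicator A x - B * indicator A x \<partial>M)"
      by (intro integral_nonneg_AE AE_I2) (auto simp: indicator_def A_def)
    ultimately have "(\<integral>x. r x * indicator A x - B * indicator A x \<partial>M) = 0" by simp
    moreover have "integrable M (\<lambda>x. r x * indicator A x - B * indicator A x)" using IA by simp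
    ultimately have "AE x in M. r x * indicator A x - B * indicator A x = 0"
      by (subst (asm) integral_nonneg_eq_0_iff_AE) (auto simp: indicator_def A_def)
    then show ?thesis by (rule AE_mp) (auto simp: A_def indicator_def intro!: AE_I2 split: if_splits)
  qed
  define q where "q x = min (r x) B" for x
  have q[measurable]: "q \<in> borel_measurable M" unfolding q_def by measurable
  have qr: "AE x in M. q x = r x" using AEb by eventually_elim (simp add: q_def)
  have q0: "0 \<le> q x" "q x \<le> B" for x using r0 B by (auto simp: q_def)
  have qI: "integrable M q" using rI qr by (subst integrable_cong_AE[where g=r]) auto
  have "(\<integral>x. q x \<partial>M) = (\<integral>x. r x \<partial>M)" using qr by (intro integral_cong_AE) auto
  also have "\<dots> = 1" using r1 nn_integral_eq_integral[OF rI] r0 by simp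
  finally have q1: "(\<integral>x. q x \<partial>M) = 1" .
  have "integrable M (\<lambda>x. q x * ln (q x))"
    using xlnx_le_bound[OF q0] by (intro integrable_const_bound[where B="1 + B * \<bar>ln B\<bar>"]) auto
  then have "q \<in> fin_ent M" using q q0 qI q1 by (auto simp: fin_ent_def)
  moreover have "Q = law M q" unfolding Qr using qr by (intro density_cong) auto
  ultimately show ?thesis by blast
qed

text \<open>
  Points of the finite product are extensional functions, hence the restriction to the index set
  after composing with the permutation.
\<close>

definition symmetric_event :: "nat \<Rightarrow> (nat \<Rightarrow> 'a) set \<Rightarrow> bool" where
  "symmetric_event n C \<longleftrightarrow> (\<forall>\<pi>. \<pi> permutes {..<n} \<longrightarrow>
     (\<forall>x\<in>space (iid {..<n}). (\<lambda>i\<in>{..<n}. x (\<pi> i)) \<in> C \<longleftrightarrow> x \<in> C))"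

lemma permute_conditioned:
  assumes C: "C \<in> sets (iid {..<n})" "symmetric_event n C" and \<pi>: "\<pi> permutes {..<n}"
  defines "U \<equiv> uniform_measure (iid {..<n}) C"
  shows "distr U U (\<lambda>x. \<lambda>i\<in>{..<n}. x (\<pi> i)) = U"
  unfolding U_def
proof (rule prob_space.exchangeable_uniform_measure[OF prob_space_iid])
  have \<pi>n: "\<pi> i < n" if "i < n" for i using \<pi> that permutes_in_image[OF \<pi>, of i] by simp
  show "(\<lambda>x. \<lambda>i\<in>{..<n}. x (\<pi> i)) \<in> iid {..<n} \<rightarrow>\<^sub>M iid {..<n}"
    using \<pi>n by (intro measurable_restrict measurable_component_singleton) auto
  show "distr (iid {..<n}) (iid {..<n}) (\<lambda>x. \<lambda>i\<in>{..<n}. x (\<pi> i)) = iid {..<n}"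
    using permutes_inj_on[OF \<pi>] \<pi>n by (intro distr_PiM_reindex) (auto intro: prob_space_axioms)
qed (use C \<pi> in \<open>auto simp: symmetric_event_def\<close>)

lemma prob_space_conditioned:
  assumes "measure (iid I) C > 0"
  shows "prob_space (uniform_measure (iid I) C)"
proof -
  interpret P: prob_space "iid I" by (rule prob_space_iid)
  show ?thesis using assms by (intro prob_space_uniform_measure) (auto simp: P.emeasure_eq_measure)
qed

text \<open>
  The permutation that exchanges the block $0, \dots, j-1$ with the block $bj, \dots, bj+j-1$
  preserves the conditioned law.
\<close>

lemma integral_block_conditioned:
  fixes f :: "(nat \<Rightarrow> 'a) \<Rightarrow> real"
  assumes C: "C \<in> sets (iid {..<n})" "symmetric_event n C" and b: "b * j + j \<le> n"
    and f[measurable]: "f \<in> borel_measurable (iid {..<j})"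
  defines "U \<equiv> uniform_measure (iid {..<n}) C"
  shows "(\<integral>x. f (\<lambda>i\<in>{..<j}. x (b * j + i)) \<partial>U) = (\<integral>x. f (restrict x {..<j}) \<partial>U)"
proof (cases "b = 0")
  case True
  then show ?thesis by (simp add: restrict_def)
next
  case False
  define B where "B = b * j"
  have jb: "j \<le> B" using False by (simp add: B_def)
  have BN: "B + j \<le> n" using b by (simp add: B_def)
  define \<pi> where "\<pi> l = (if l < j then B + l else if B \<le> l \<and> l < B + j then l - B else l)" for l
  have invol: "\<pi> (\<pi> l) = l" for l using jb by (auto simp: \<pi>_def)
  have "\<pi> l = l" if "l \<ge> n" for l using that BN jb by (auto simp: \<pi>_def)
  then have \<pi>: "\<pi> permutes {..<n}" unfolding permutes_def
  proof (intro conjI allI impI)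
    fix y show "\<exists>!x. \<pi> x = y" using invol by (intro ex1I[of _ "\<pi> y"]) auto
  qed simp
  let ?T = "\<lambda>x. \<lambda>i\<in>{..<n}. x (\<pi> i)"
  have jn: "j \<le> n" using b by simp
  have \<pi>n: "\<pi> i < n" if "i < n" for i using permutes_in_image[OF \<pi>, of i] that by simp
  have "?T \<in> iid {..<n} \<rightarrow>\<^sub>M iid {..<n}"
    using \<pi>n by (intro measurable_restrict measurable_component_singleton) auto
  then have T[measurable]: "?T \<in> U \<rightarrow>\<^sub>M U" unfolding U_def
    by (subst measurable_cong_sets[of _ "iid {..<n}" _ "iid {..<n}"]) auto
  have r[measurable]: "(\<lambda>x. restrict x {..<j}) \<in> U \<rightarrow>\<^sub>M iid {..<j}" unfolding U_def
    using jn by (subst measurable_cong_sets[of _ "iid {..<n}" _ "iid {..<j}"]) (auto intro: measurable_restrict_subset)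
  have "(\<integral>x. f (restrict x {..<j}) \<partial>U) = (\<integral>x. f (restrict x {..<j}) \<partial>distr U U ?T)"
    using permute_conditioned[OF C \<pi>] by (simp add: U_def)
  also have "\<dots> = (\<integral>x. f (restrict (?T x) {..<j}) \<partial>U)" by (subst integral_distr) auto
  also have "\<dots> = (\<integral>x. f (\<lambda>i\<in>{..<j}. x (b * j + i)) \<partial>U)"
    using jn by (intro Bochner_Integration.integral_cong refl arg_cong[where f=f]) (auto simp: \<pi>_def B_def restrict_def fun_eq_iff)
  finally show ?thesis by simp
qed

lemma distr_coordinate_conditioned:
  assumes C: "C \<in> sets (iid {..<n})" "symmetric_event n C" and i: "i < n"
  defines "U \<equiv> uniform_measure (iid {..<n}) C"
  shows "distr U M (\<lambda>x. x i) = distr U M (\<lambda>x. x 0)"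
proof -
  obtain \<pi> where \<pi>: "\<pi> permutes {..<n}" and \<pi>0: "\<pi> 0 = i"
    using permutes_swap_id[of 0 "{..<n}" i] i by (metis lessThan_iff not_less0 not_gr0 transpose_apply_first)
  have \<pi>n: "\<pi> l < n" if "l < n" for l using permutes_in_image[OF \<pi>, of l] that by simp
  let ?T = "\<lambda>x. \<lambda>l\<in>{..<n}. x (\<pi> l)"
  have "?T \<in> iid {..<n} \<rightarrow>\<^sub>M iid {..<n}"
    using \<pi>n by (intro measurable_restrict measurable_component_singleton) auto
  then have T[measurable]: "?T \<in> U \<rightarrow>\<^sub>M U" unfolding U_def
    by (subst measurable_cong_sets[of _ "iid {..<n}" _ "iid {..<n}"]) auto
  have c[measurable]: "(\<lambda>x. x 0) \<in> U \<rightarrow>\<^sub>M M" unfolding U_def using i by simp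
  have "distr U M (\<lambda>x. x 0) = distr (distr U U ?T) M (\<lambda>x. x 0)"
    using permute_conditioned[OF C \<pi>] by (simp add: U_def)
  also have "\<dots> = distr U M (\<lambda>x. ?T x 0)" by (subst distr_distr) (auto simp: o_def)
  also have "\<dots> = distr U M (\<lambda>x. x i)" using i \<pi>0 by (intro distr_cong) auto
  finally show ?thesis by simp
qed

text \<open>
  Conditioning on $C$ increases probabilities by at most the factor $1/P(C)$.
\<close>

lemma marginal_conditioned:
  assumes C[measurable]: "C \<in> sets (iid {..<n})" and n: "0 < n" and c: "measure (iid {..<n}) C > 0"
  defines "U \<equiv> uniform_measure (iid {..<n}) C"
  shows "\<exists>q\<in>fin_ent M. distr U M (\<lambda>x. x 0) = law M q"
proof (rule dominated_has_fin_ent_density)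
  interpret P: prob_space "iid {..<n}" by (rule prob_space_iid)
  interpret U: prob_space U unfolding U_def by (rule prob_space_conditioned[OF c])
  have X[measurable]: "(\<lambda>x. x 0) \<in> U \<rightarrow>\<^sub>M M" "(\<lambda>x. x 0) \<in> iid {..<n} \<rightarrow>\<^sub>M M" unfolding U_def using n by simp_all
  show "prob_space (distr U M (\<lambda>x. x 0))" by (rule U.prob_space_distr) simp
  show "0 \<le> 1 / measure (iid {..<n}) C" by simp
  fix A assume A[measurable]: "A \<in> sets M"
  let ?A = "(\<lambda>x. x 0) -` A \<inter> space (iid {..<n})"
  have "emeasure (distr U M (\<lambda>x. x 0)) A = emeasure U ?A"
    by (subst emeasure_distr) (auto simp: U_def)
  also have "\<dots> = emeasure (iid {..<n}) (C \<inter> ?A) / emeasure (iid {..<n}) C"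
    unfolding U_def by (rule emeasure_uniform_measure) auto
  also have "\<dots> \<le> emeasure (iid {..<n}) ?A / emeasure (iid {..<n}) C"
    by (intro divide_right_mono_ennreal emeasure_mono) auto
  also have "emeasure (iid {..<n}) ?A = emeasure (distr (iid {..<n}) M (\<lambda>x. x 0)) A"
    by (subst emeasure_distr) auto
  also have "distr (iid {..<n}) M (\<lambda>x. x 0) = M"
    using n by (intro distr_PiM_component) (auto intro: prob_space_axioms)
  also have "emeasure M A / emeasure (iid {..<n}) C = ennreal (1 / measure (iid {..<n}) C) * emeasure M A"
    using c by (simp add: emeasure_eq_measure P.emeasure_eq_measure divide_ennreal ennreal_mult[symmetric])
  finally show "emeasure (distr U M (\<lambda>x. x 0)) A \<le> ennreal (1 / measure (iid {..<n}) C) * emeasure M A" .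
qed simp

lemma indep_coordinates:
  assumes n0: "0 < n"
  shows "prob_space.indep_vars (iid {..<n}) (\<lambda>_. M) (\<lambda>i x. x i) {..<n}"
proof -
  interpret P: prob_space "iid {..<n}" by (rule prob_space_iid)
  show ?thesis
  proof (subst P.indep_vars_iff_distr_eq_PiM')
    have "distr (iid {..<n}) (iid {..<n}) (\<lambda>x. restrict x {..<n}) = distr (iid {..<n}) (iid {..<n}) (\<lambda>x. x)"
      by (intro distr_cong) (auto simp: space_PiM PiE_def extensional_restrict)
    then show "distr (iid {..<n}) (iid {..<n}) (\<lambda>x. restrict (\<lambda>i. x i) {..<n}) = (\<Pi>\<^sub>M i\<in>{..<n}. distr (iid {..<n}) M (\<lambda>x. x i))"
      by (auto intro!: PiM_cong distr_PiM_component[symmetric] prob_space_axioms)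
  qed (use n0 in auto)
qed

lemma integral_prod_blocks:
  fixes g :: "(nat \<Rightarrow> 'a) \<Rightarrow> real"
  assumes g[measurable]: "g \<in> borel_measurable (iid {..<j})" and n: "m * j \<le> n"
    and I: "integrable (iid {..<j}) g"
  shows "(\<integral>x. (\<Prod>b<m. g (\<lambda>i\<in>{..<j}. x (b * j + i))) \<partial>iid {..<n}) = (\<integral>x. g x \<partial>iid {..<j}) ^ m"
proof (cases "m = 0 \<or> j = 0")
  case True
  interpret P: prob_space "iid {..<n}" by (rule prob_space_iid)
  interpret P0: prob_space "iid {}" by (rule prob_space_iid)
  show ?thesis
  proof (cases "m = 0")
    case False
    with True have "j = 0" by simp
    then show ?thesis by (simp add: P.prob_space PiM_empty lebesgue_integral_count_space_finite restrict_def)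
  qed (simp add: P.prob_space)
next
  case False
  interpret P: prob_space "iid {..<n}" by (rule prob_space_iid)
  have bl: "b * j + j \<le> n" if "b < m" for b
    using mult_le_mono1[of "Suc b" m j] that n by simp
  have n0: "0 < n" using False n by (cases n) auto
  note ind = indep_coordinates[OF n0]
  let ?K = "\<lambda>b. {b * j..<b * j + j}"
  have disj: "disjoint_family_on ?K {..<m}"
  proof (unfold disjoint_family_on_def, intro ballI impI)
    fix b c assume "b \<noteq> (c::nat)"
    then have "Suc b \<le> c \<or> Suc c \<le> b" by auto
    then have "Suc b * j \<le> c * j \<or> Suc c * j \<le> b * j" using mult_le_mono1 by blast
    then show "?K b \<inter> ?K c = {}" by auto
  qed
  have "P.indep_vars (\<lambda>b. iid (?K b)) (\<lambda>b x. restrict (\<lambda>i. x i) (?K b)) {..<m}"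
    using bl disj by (intro P.indep_vars_restrict[OF ind]) fastforce+
  from P.indep_vars_compose2[OF this, of "\<lambda>b y. g (\<lambda>i\<in>{..<j}. y (b * j + i))" "\<lambda>_. borel"]
  have "P.indep_vars (\<lambda>_. borel) (\<lambda>b x. g (\<lambda>i\<in>{..<j}. restrict x (?K b) (b * j + i))) {..<m}"
    by (auto intro!: measurable_compose[OF _ g] measurable_restrict)
  moreover have "(\<lambda>i\<in>{..<j}. restrict x (?K b) (b * j + i)) = (\<lambda>i\<in>{..<j}. x (b * j + i))" for x :: "nat \<Rightarrow> 'a" and b
    by (auto simp: restrict_def)
  ultimately have indg: "P.indep_vars (\<lambda>_. borel) (\<lambda>b x. g (\<lambda>i\<in>{..<j}. x (b * j + i))) {..<m}" by simp
  have d: "distr (iid {..<n}) (iid {..<j}) (\<lambda>x. \<lambda>i\<in>{..<j}. x (b * j + i)) = iid {..<j}" if "b < m" for b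
    using bl[OF that] by (intro distr_PiM_reindex) (auto intro: prob_space_axioms simp: inj_on_def)
  have T[measurable]: "(\<lambda>x. \<lambda>i\<in>{..<j}. x (b * j + i)) \<in> iid {..<n} \<rightarrow>\<^sub>M iid {..<j}" if "b < m" for b
    using bl[OF that] by (intro measurable_restrict measurable_component_singleton) auto
  have gI: "integrable (iid {..<n}) (\<lambda>x. g (\<lambda>i\<in>{..<j}. x (b * j + i)))" if "b < m" for b
    using I integrable_distr[OF T[OF that], of g] d[OF that] by simp
  have gE: "(\<integral>x. g (\<lambda>i\<in>{..<j}. x (b * j + i)) \<partial>iid {..<n}) = (\<integral>x. g x \<partial>iid {..<j})" if "b < m" for b
    using integral_distr[OF T[OF that] g] d[OF that] by simp
  show ?thesis using P.indep_vars_lebesgue_integral[OF _ indg] gI gE by simp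
qed

text \<open>
  Jensen's inequality $E[G] \le \ln E[e^G]$, by means of the tangent of $\exp$ at $b$.  The
  function $H$ stands for $e^G$ up to a null set: in the application $G$ contains logarithms of a
  density, and $H$ has the density itself as a factor.
\<close>

lemma expectation_le_log_of_exp_bound:
  fixes G H :: "'a \<Rightarrow> real"
  assumes G: "integrable M G" and H: "integrable M H" and le: "AE x in M. exp (G x) \<le> H x"
    and k: "expectation H \<le> exp b"
  shows "expectation G \<le> b"
proof -
  have "AE x in M. exp b * (1 + G x - b) \<le> H x" using le
  proof eventually_elim
    case (elim x)
    have "exp b * (1 + G x - b) \<le> exp b * exp (G x - b)"
    proof (rule mult_left_mono)
      show "1 + G x - b \<le> exp (G x - b)" using exp_ge_add_one_self[of "G x - b"] by linarith
    qed simp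
    also have "\<dots> = exp (G x)" by (simp add: exp_add[symmetric])
    finally show ?case using elim by simp
  qed
  then have "expectation (\<lambda>x. exp b * (1 + G x - b)) \<le> expectation H" using G H by (intro integral_mono_AE) auto
  moreover have "expectation (\<lambda>x. exp b * (1 + G x - b)) = exp b * (1 + expectation G - b)" using G by (simp add: prob_space)
  ultimately have "exp b * (1 + expectation G - b) \<le> exp b * 1" using k by linarith
  then show ?thesis by (subst (asm) mult_le_cancel_left_pos) auto
qed

lemma integral_uniform_measure_real:
  fixes F :: "'a \<Rightarrow> real"
  assumes F[measurable]: "F \<in> borel_measurable M" and C[measurable]: "C \<in> sets M" and c: "prob C > 0"
  shows "(\<integral>x. F x \<partial>uniform_measure M C) = (\<integral>x. indicator C x * F x \<partial>M) / prob C"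
    "integrable (uniform_measure M C) F \<longleftrightarrow> integrable M (\<lambda>x. indicator C x * F x)"
proof -
  have U: "uniform_measure M C = density M (\<lambda>x. ennreal (indicator C x / prob C))"
    unfolding uniform_measure_def using c
    using divide_ennreal[of 1 "prob C"] by (intro density_cong AE_I2) (auto simp: emeasure_eq_measure indicator_def)
  have "(\<integral>x. F x \<partial>uniform_measure M C) = (\<integral>x. (indicator C x / prob C) *\<^sub>R F x \<partial>M)"
    unfolding U by (subst integral_density) (auto simp: c)
  then show "(\<integral>x. F x \<partial>uniform_measure M C) = (\<integral>x. indicator C x * F x \<partial>M) / prob C" by simp
  show "integrable (uniform_measure M C) F \<longleftrightarrow> integrable M (\<lambda>x. indicator C x * F x)"
  proof -
    have "integrable (uniform_measure M C) F \<longleftrightarrow> integrable M (\<lambda>x. indicator C x * F x / prob C)"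
      unfolding U using c by (subst integrable_density) auto
    also have "\<dots> \<longleftrightarrow> integrable M (\<lambda>x. indicator C x * F x)"
    proof
      assume "integrable M (\<lambda>x. indicator C x * F x / prob C)"
      from integrable_mult_right[OF this, of "prob C"] show "integrable M (\<lambda>x. indicator C x * F x)" using c by simp
    qed simp
    finally show ?thesis .
  qed
qed

text \<open>
  Let $U$ be the conditioned law, $q$ the density of its marginals and $r$ the mixture of $p$ and
  $q$ with a small weight $e$ of $q$.  Jensen's inequality under $U$ is applied to
  $G = t \sum_{b<m} f(\mbox{block } b) + \sum_{i<n} \ln r(x_i)$.
  By exchangeability $E_U[G] = t m E_U[f] + n \int q \ln r$, and the last integral is at least
  $H(p)$ by the Pythagorean inequality.  On the other side, $E_U[e^G]$ is at most $1/P(C)$ times the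
  unconditioned expectation of $e^{t \sum_b f} \prod_i r(x_i)$.  There the product changes the
  i.i.d. law to the one with density $r$, the blocks become independent, and the expectation is the
  $m$-th power of that of $e^{t f}$, which is expanded to second order in $t$.  Finally $e$ tends
  to $0$.
\<close>

lemma conditional_law_upper_bound:
  fixes f :: "(nat \<Rightarrow> 'a) \<Rightarrow> real" and K t :: real and m n j :: nat
  assumes p: "p \<in> fin_ent M"
    and C[measurable]: "C \<in> sets (iid {..<n})" and sym: "symmetric_event n C" and c: "measure (iid {..<n}) C > 0"
    and m: "0 < m" "0 < j" "m * j \<le> n"
    and min: "\<And>q e. q \<in> fin_ent M \<Longrightarrow> distr (uniform_measure (iid {..<n}) C) M (\<lambda>x. x 0) = law M q \<Longrightarrow>
      0 < e \<Longrightarrow> e < 1 \<Longrightarrow> rel_ent M p \<le> rel_ent M (mix e p q)"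
    and f[measurable]: "f \<in> borel_measurable (iid {..<j})" and K: "\<And>x. x \<in> space (iid {..<j}) \<Longrightarrow> \<bar>f x\<bar> \<le> K"
    and t: "0 < t" "t * K \<le> 1/2"
  shows "(\<integral>x. f (restrict x {..<j}) \<partial>uniform_measure (iid {..<n}) C)
    \<le> (\<integral>x. f x \<partial>PiM {..<j} (\<lambda>_. law M p)) + 2 * t * K\<^sup>2
      + (- ln (measure (iid {..<n}) C) - n * rel_ent M p) / (t * m)"
proof -
  define U where "U = uniform_measure (iid {..<n}) C"
  define P where "P = iid {..<n}"
  define c where "c = measure (iid {..<n}) C"
  interpret P: prob_space P unfolding P_def by (rule prob_space_iid)
  interpret U: prob_space U unfolding U_def by (rule prob_space_conditioned[OF c])
  have c0: "c > 0" using c by (simp add: c_def)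
  have "1 * j \<le> m * j" using m(1) by (intro mult_le_mono1) auto
  then have jn: "j \<le> n" "0 < n" using m by linarith+
  have setsU[measurable_cong]: "sets U = sets P" by (simp add: U_def P_def)
  have [measurable]: "C \<in> sets P" by (simp add: P_def)
  have spU: "space U = space P" by (simp add: U_def P_def)
  have X[measurable]: "(\<lambda>x. x i) \<in> P \<rightarrow>\<^sub>M M" if "i < n" for i using that by (simp add: P_def)
  obtain q where q: "q \<in> fin_ent M" and Uq: "distr U M (\<lambda>x. x 0) = law M q"
    using marginal_conditioned[OF C jn(2) c] U_def by auto
  have Uqi: "distr U M (\<lambda>x. x i) = law M q" if "i < n" for i
    using distr_coordinate_conditioned[OF C sym that] Uq by (simp add: U_def)
  note [measurable] = fin_entD(1)[OF p] fin_entD(1)[OF q]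
  obtain x0 where x0: "x0 \<in> space (iid {..<j})" using prob_space.not_empty[OF prob_space_iid] by blast
  have K0: "0 \<le> K" using K[OF x0] by (meson abs_ge_zero order_trans)
  let ?F = "\<lambda>p. \<integral>x. f x \<partial>PiM {..<j} (\<lambda>_. law M p)"
  let ?blk = "\<lambda>b x. \<lambda>i\<in>{..<j}. x (b * j + i)"
  have bl: "b * j + j \<le> n" if "b < m" for b
    using mult_le_mono1[of "Suc b" m j] that m by simp
  have blk[measurable]: "?blk b \<in> P \<rightarrow>\<^sub>M iid {..<j}" if "b < m" for b
    unfolding P_def using bl[OF that] by (intro measurable_restrict measurable_component_singleton) auto
  have main: "(\<integral>x. f (restrict x {..<j}) \<partial>U) \<le> ?F (mix e p q) + 2 * t * K\<^sup>2 + (- ln c - n * rel_ent M p) / (t * m)"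
    if e: "0 < e" "e < 1" for e
  proof -
    define r where "r = mix e p q"
    have r: "r \<in> fin_ent M" using mix_fin_ent[OF p q e] by (simp add: r_def)
    note [measurable] = fin_entD(1)[OF r]
    have qr: "integrable M (\<lambda>x. q x * ln (r x))" using mix_integrable(2)[OF p q e] by (simp add: r_def)
    have pyth: "rel_ent M p \<le> (\<integral>x. q x * ln (r x) \<partial>M)"
      using rel_ent_pythagoras[OF p q e] min[OF q] Uq e by (auto simp: r_def U_def)
    define S where "S x = t * (\<Sum>b<m. f (?blk b x))" for x
    define G where "G x = S x + (\<Sum>i<n. ln (r (x i)))" for x
    define H where "H x = exp (S x) * (\<Prod>i<n. r (x i))" for x
    have [measurable]: "S \<in> borel_measurable P" unfolding S_def by measurable
    have [measurable]: "G \<in> borel_measurable P" "H \<in> borel_measurable P" unfolding G_def H_def by measurable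
    \<comment> \<open>the marginal density q vanishes wherever r does, so under U no coordinate visits a zero of r\<close>
    have pos: "AE x in U. r (x i) > 0" if i: "i < n" for i
    proof -
      have "AE x in law M q. r x > 0"
      proof (subst AE_density; (intro AE_I2)?)
        fix x show "0 < ennreal (q x) \<longrightarrow> 0 < r x" using e fin_entD(2)[OF p, of x] by (auto simp: r_def intro: add_nonneg_pos)
      qed simp
      then have "AE x in distr U M (\<lambda>x. x i). r x > 0" unfolding Uqi[OF i] .
      then show ?thesis using i by (subst (asm) AE_distr_iff) auto
    qed
    have "AE x in U. \<forall>i\<in>{..<n}. r (x i) > 0" using pos by (intro AE_finite_allI) auto
    then have GH: "AE x in U. exp (G x) \<le> H x"
      by eventually_elim (simp add: G_def H_def exp_add exp_sum)
    have lnI: "integrable U (\<lambda>x. ln (r (x i)))" and lnE: "(\<integral>x. ln (r (x i)) \<partial>U) = (\<integral>x. q x * ln (r x) \<partial>M)" if i: "i < n" for i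
    proof -
      have "integrable (distr U M (\<lambda>x. x i)) (\<lambda>x. ln (r x))" unfolding Uqi[OF i]
        by (subst integrable_density) (use fin_entD(2)[OF q] qr in auto)
      then show "integrable U (\<lambda>x. ln (r (x i)))" using i by (subst (asm) integrable_distr_eq) auto
      have "(\<integral>x. ln (r (x i)) \<partial>U) = (\<integral>x. ln (r x) \<partial>distr U M (\<lambda>x. x i))" using i by (subst integral_distr) auto
      also have "\<dots> = (\<integral>x. q x * ln (r x) \<partial>M)" unfolding Uqi[OF i]
        by (subst integral_density) (use fin_entD(2)[OF q] in auto)
      finally show "(\<integral>x. ln (r (x i)) \<partial>U) = (\<integral>x. q x * ln (r x) \<partial>M)" .
    qed
    have fb: "\<bar>f (?blk b x)\<bar> \<le> K" if "b < m" "x \<in> space P" for b x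
      using K measurable_space[OF blk[OF that(1)] that(2)] by auto
    have fI: "integrable U (\<lambda>x. f (?blk b x))" if "b < m" for b
      using fb[OF that] by (intro U.integrable_const_bound[where B=K]) (auto simp: spU that measurable_cong_sets[OF setsU])
    have fE: "(\<integral>x. f (?blk b x) \<partial>U) = (\<integral>x. f (restrict x {..<j}) \<partial>U)" if "b < m" for b
      using integral_block_conditioned[OF C sym bl[OF that] f] by (simp add: U_def)
    have fsI: "integrable U (\<lambda>x. \<Sum>b<m. f (?blk b x))" using fI by (intro Bochner_Integration.integrable_sum) auto
    have lsI: "integrable U (\<lambda>x. \<Sum>i<n. ln (r (x i)))" using lnI by (intro Bochner_Integration.integrable_sum) auto
    have fsE: "(\<integral>x. (\<Sum>b<m. f (?blk b x)) \<partial>U) = m * (\<integral>x. f (restrict x {..<j}) \<partial>U)"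
      using fI fE by (subst Bochner_Integration.integral_sum) auto
    have lsE: "(\<integral>x. (\<Sum>i<n. ln (r (x i))) \<partial>U) = n * (\<integral>x. q x * ln (r x) \<partial>M)"
      using lnI lnE by (subst Bochner_Integration.integral_sum) auto
    have GI: "integrable U G" unfolding G_def S_def
      by (rule Bochner_Integration.integrable_add[OF integrable_mult_right[OF fsI] lsI])
    have EG: "(\<integral>x. G x \<partial>U) = t * m * (\<integral>x. f (restrict x {..<j}) \<partial>U) + n * (\<integral>x. q x * ln (r x) \<partial>M)"
      unfolding G_def S_def Bochner_Integration.integral_add[OF integrable_mult_right[OF fsI] lsI] integral_mult_right_zero fsE lsE by simp
    have Sb: "\<bar>S x\<bar> \<le> t * (m * K)" if "x \<in> space P" for x
    proof -
      have "\<bar>\<Sum>b<m. f (?blk b x)\<bar> \<le> (\<Sum>b<m. K)" using fb that by (intro order_trans[OF sum_abs sum_mono]) auto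
      then show ?thesis using t(1) by (simp add: S_def abs_mult)
    qed
    have WI: "integrable P (\<lambda>x. \<Prod>i<n. r (x i))"
      using fin_entD(3)[OF iid_product_fin_ent(1)[OF _ r, of "{..<n}"]] by (simp add: P_def)
    have W0: "0 \<le> (\<Prod>i<n. r (x i))" for x using fin_entD(2)[OF r] by (intro prod_nonneg) auto
    have HI: "integrable P H"
    proof (rule Bochner_Integration.integrable_bound)
      show "integrable P (\<lambda>x. exp (t * (m * K)) * (\<Prod>i<n. r (x i)))" using WI by simp
      show "AE x in P. norm (H x) \<le> norm (exp (t * (m * K)) * (\<Prod>i<n. r (x i)))"
      proof (rule AE_I2)
        fix x assume "x \<in> space P"
        then have "S x \<le> t * (m * K)" using Sb[of x] by auto
        then show "norm (H x) \<le> norm (exp (t * (m * K)) * (\<Prod>i<n. r (x i)))"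
          using W0[of x] by (auto simp: H_def abs_mult intro!: mult_right_mono)
      qed
    qed simp
    have H0: "0 \<le> H x" for x using W0 by (simp add: H_def)
    have HU: "integrable U H" and EHU: "(\<integral>x. H x \<partial>U) \<le> (\<integral>x. H x \<partial>P) / c"
    proof -
      have I: "integrable P (\<lambda>x. indicator C x * H x)" using integrable_real_mult_indicator[OF _ HI, of C] by (simp add: mult.commute)
      show "integrable U H" unfolding U_def P_def[symmetric]
        using P.integral_uniform_measure_real(2)[of H C] c I by (simp add: P_def[symmetric])
      have "(\<integral>x. indicator C x * H x \<partial>P) \<le> (\<integral>x. H x \<partial>P)"
        using I HI H0 by (intro integral_mono) (auto simp: indicator_def)
      then show "(\<integral>x. H x \<partial>U) \<le> (\<integral>x. H x \<partial>P) / c"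
        using P.integral_uniform_measure_real(1)[of H C] c by (simp add: U_def P_def[symmetric] c_def divide_right_mono)
    qed
    let ?N = "law M r"
    interpret N: prob_space ?N by (rule fin_ent_prob_space[OF r])
    interpret NJ: prob_space "PiM {..<j} (\<lambda>_. ?N)" by (rule N.prob_space_iid)
    have setsN: "sets (PiM {..<j} (\<lambda>_. ?N)) = sets (iid {..<j})" for j by (intro sets_PiM_cong) auto
    have fN[measurable]: "f \<in> borel_measurable (PiM {..<j} (\<lambda>_. ?N))" using f by (simp add: measurable_cong_sets[OF setsN])
    have spN: "space (PiM {..<j} (\<lambda>_. ?N)) = space (iid {..<j})" by (simp add: space_PiM)
    have fNI: "integrable (PiM {..<j} (\<lambda>_. ?N)) f"
      using K by (intro NJ.integrable_const_bound[where B=K]) (auto simp: spN)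
    have eNI: "integrable (PiM {..<j} (\<lambda>_. ?N)) (\<lambda>x. exp (t * f x))"
    proof (intro NJ.integrable_const_bound[where B="exp (t * K)"] AE_I2)
      fix x assume "x \<in> space (PiM {..<j} (\<lambda>_. ?N))"
      then have "f x \<le> K" using K[of x] spN by auto
      then show "norm (exp (t * f x)) \<le> exp (t * K)" using t by simp
    qed simp
    have "(\<integral>x. H x \<partial>P) = (\<integral>x. (\<Prod>i<n. r (x i)) * exp (S x) \<partial>P)" by (simp add: H_def mult.commute)
    also have "\<dots> = (\<integral>x. exp (S x) \<partial>PiM {..<n} (\<lambda>_. ?N))"
      using integral_PiM_density[OF _ r, of "{..<n}" "\<lambda>x. exp (S x)"] by (simp add: P_def[symmetric])
    also have "\<dots> = (\<integral>x. (\<Prod>b<m. exp (t * f (?blk b x))) \<partial>PiM {..<n} (\<lambda>_. ?N))"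
      by (simp add: S_def exp_sum sum_distrib_left)
    also have "\<dots> = (\<integral>x. exp (t * f x) \<partial>PiM {..<j} (\<lambda>_. ?N)) ^ m"
      using m eNI by (intro N.integral_prod_blocks) auto
    also have "\<dots> \<le> exp (t * ?F r + 2 * (t * K)\<^sup>2) ^ m"
    proof (rule power_mono)
      have "(\<integral>x. exp (t * f x) \<partial>PiM {..<j} (\<lambda>_. ?N)) \<le> (\<integral>x. 1 + t * f x + 2 * (t * K)\<^sup>2 \<partial>PiM {..<j} (\<lambda>_. ?N))"
      proof (rule integral_mono)
        fix x assume "x \<in> space (PiM {..<j} (\<lambda>_. ?N))"
        then have fx: "\<bar>f x\<bar> \<le> K" using K spN by auto
        then have tf: "\<bar>t * f x\<bar> \<le> t * K" using t by (simp add: abs_mult)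
        then have "(t * f x)\<^sup>2 \<le> (t * K)\<^sup>2" using abs_le_square_iff[of "t * f x" "t * K"] K0 t by simp
        moreover have "\<bar>t * f x\<bar> \<le> 1/2" using tf t by linarith
        ultimately show "exp (t * f x) \<le> 1 + t * f x + 2 * (t * K)\<^sup>2"
          using exp_le_quadratic[of "t * f x"] by linarith
      qed (use eNI fNI in auto)
      also have "\<dots> = 1 + (t * ?F r + 2 * (t * K)\<^sup>2)" using fNI by (simp add: NJ.prob_space)
      also have "\<dots> \<le> exp (t * ?F r + 2 * (t * K)\<^sup>2)" by (rule exp_ge_add_one_self)
      finally show "(\<integral>x. exp (t * f x) \<partial>PiM {..<j} (\<lambda>_. ?N)) \<le> exp (t * ?F r + 2 * (t * K)\<^sup>2)" .
    qed simp
    also have "\<dots> = exp (m * (t * ?F r + 2 * (t * K)\<^sup>2))" by (simp add: exp_of_nat_mult)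
    finally have EH: "(\<integral>x. H x \<partial>P) \<le> exp (m * (t * ?F r + 2 * (t * K)\<^sup>2))" .
    have "(\<integral>x. G x \<partial>U) \<le> m * (t * ?F r + 2 * (t * K)\<^sup>2) - ln c"
    proof (rule U.expectation_le_log_of_exp_bound[OF GI HU GH])
      have "(\<integral>x. H x \<partial>U) \<le> exp (m * (t * ?F r + 2 * (t * K)\<^sup>2)) / c"
        using EHU EH c0 by (meson divide_right_mono less_imp_le order_trans)
      then show "(\<integral>x. H x \<partial>U) \<le> exp (m * (t * ?F r + 2 * (t * K)\<^sup>2) - ln c)" using c0 by (simp add: exp_diff)
    qed
    then have "t * m * (\<integral>x. f (restrict x {..<j}) \<partial>U) \<le> m * (t * ?F r + 2 * (t * K)\<^sup>2) - ln c - n * (\<integral>x. q x * ln (r x) \<partial>M)"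
      unfolding EG by linarith
    also have "\<dots> \<le> m * (t * ?F r + 2 * (t * K)\<^sup>2) - ln c - n * rel_ent M p"
      using mult_left_mono[OF pyth, of "real n"] by simp
    also have "\<dots> = (t * m) * (?F r + 2 * t * K\<^sup>2 + (- ln c - n * rel_ent M p) / (t * m))"
      using t m by (simp add: field_simps power2_eq_square)
    finally show ?thesis using t m by (subst (asm) mult_le_cancel_left_pos) (auto simp: r_def)
  qed
  have Fe: "?F (mix e p q) \<le> ?F p + K * j * (2 * e)" if e: "0 < e" "e < 1" for e
  proof -
    have "L1_dist M (mix e p q) p \<le> (\<integral>x. e * (q x + p x) \<partial>M)"
    proof (rule integral_mono)
      fix x
      have "mix e p q x - p x = e * (q x - p x)" by (simp add: algebra_simps)
      then show "\<bar>mix e p q x - p x\<bar> \<le> e * (q x + p x)"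
        using e fin_entD(2)[OF p, of x] fin_entD(2)[OF q, of x] by (auto simp: abs_mult intro!: mult_left_mono)
    qed (use fin_entD(3)[OF p] fin_entD(3)[OF q] in auto)
    also have "\<dots> = 2 * e" using fin_entD(3,4)[OF p] fin_entD(3,4)[OF q] by simp
    finally have "K * j * L1_dist M (mix e p q) p \<le> K * j * (2 * e)" using K0 by (intro mult_left_mono) auto
    then show ?thesis
      using PiM_density_diff_le[OF finite_lessThan mix_fin_ent[OF p q e] p f K] by auto
  qed
  let ?R = "?F p + 2 * t * K\<^sup>2 + (- ln c - n * rel_ent M p) / (t * m)"
  have "((\<lambda>e. ?R + K * j * (2 * e)) \<longlongrightarrow> ?R + K * j * (2 * 0)) (at_right 0)" by (intro tendsto_intros)
  moreover have "eventually (\<lambda>e. (\<integral>x. f (restrict x {..<j}) \<partial>U) \<le> ?R + K * j * (2 * e)) (at_right 0)"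
  proof -
    have "eventually (\<lambda>e::real. 0 < e \<and> e < 1) (at_right 0)"
      unfolding eventually_at_right_field by (auto intro!: exI[of _ 1])
    then show ?thesis
    proof eventually_elim
      case (elim e) then show ?case using main[of e] Fe[of e] by linarith
    qed
  qed
  ultimately have "(\<integral>x. f (restrict x {..<j}) \<partial>U) \<le> ?R + K * j * (2 * 0)"
    by (intro tendsto_lowerbound) auto
  then show ?thesis by (simp add: U_def c_def)
qed

end

section \<open>Entropy minimization under moment constraints\<close>

text \<open>
  The problem in abstract form, with $\psi_i$ in place of $\phi_i$.  By \<open>dominated_\<psi>\<close> the lower
  functions are $o(\psi_k)$, so that no part of a lower moment can be lost in a limit.  By
  \<open>excursion\<close> there are events on which $\psi_k \approx L$ is large while the lower functions and
  the logarithmic cost of the event are $o(L)$; they serve to increase the top moment at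
  negligible cost.
  The density \<open>q0\<close> meets the constraints with room to spare in the last one.
\<close>

locale moment_constraints = prob_space M for M :: "'a measure" +
  fixes \<psi> :: "nat \<Rightarrow> 'a \<Rightarrow> real" and k :: nat and a :: "nat \<Rightarrow> real" and q0 :: "'a \<Rightarrow> real"
  assumes k: "1 \<le> k"
    and measurable_\<psi>[measurable]: "\<And>i. i \<in> {1..k} \<Longrightarrow> \<psi> i \<in> borel_measurable M"
    and nonneg_\<psi>: "\<And>i x. i \<in> {1..k} \<Longrightarrow> x \<in> space M \<Longrightarrow> 0 \<le> \<psi> i x"
    and dominated_\<psi>: "\<And>i e. i \<in> {1..<k} \<Longrightarrow> 0 < e \<Longrightarrow> \<exists>B\<ge>0. \<forall>x\<in>space M. \<psi> i x \<le> e * \<psi> k x + B"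
    and q0: "q0 \<in> fin_ent M" "\<And>i. i \<in> {1..k} \<Longrightarrow> integrable M (\<lambda>x. \<psi> i x * q0 x)"
      "\<And>i. i \<in> {1..<k} \<Longrightarrow> (\<integral>x. \<psi> i x * q0 x \<partial>M) = a i" "(\<integral>x. \<psi> k x * q0 x \<partial>M) < a k"
    and excursion: "\<And>e. 0 < e \<Longrightarrow> \<exists>L B. 1 / e \<le> L \<and> B \<in> sets M \<and> 0 < prob B \<and> - ln (prob B) \<le> e * L \<and>
      (\<forall>x\<in>B. L \<le> \<psi> k x \<and> \<psi> k x \<le> L + 1 \<and> (\<forall>i\<in>{1..<k}. \<psi> i x \<le> e * L))"
begin

definition mom :: "nat \<Rightarrow> ('a \<Rightarrow> real) \<Rightarrow> real" where
  "mom i q = (\<integral>x. \<psi> i x * q x \<partial>M)"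

definition with_moments :: "('a \<Rightarrow> real) set" where
  "with_moments = {q \<in> fin_ent M. \<forall>i\<in>{1..k}. integrable M (\<lambda>x. \<psi> i x * q x)}"

text \<open>
  The top moment is bounded from above only: the limiting density may have a smaller one, the rest
  being carried by excursions of vanishing mass.
\<close>

definition feas :: "real \<Rightarrow> ('a \<Rightarrow> real) set" where
  "feas d = {q \<in> with_moments. (\<forall>i\<in>{1..<k}. \<bar>mom i q - a i\<bar> \<le> d) \<and> mom k q \<le> a k + d}"

definition minimizer :: "real \<Rightarrow> ('a \<Rightarrow> real) \<Rightarrow> bool" where
  "minimizer d p \<longleftrightarrow> p \<in> feas d \<and> (\<forall>q\<in>feas d. rel_ent M p \<le> rel_ent M q)"

lemma with_momentsD:
  "q \<in> with_moments \<Longrightarrow> q \<in> fin_ent M" "q \<in> with_moments \<Longrightarrow> i \<in> {1..k} \<Longrightarrow> integrable M (\<lambda>x. \<psi> i x * q x)"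
  by (auto simp: with_moments_def)

lemma feasD:
  assumes "q \<in> feas d"
  shows "q \<in> fin_ent M" "q \<in> with_moments" "\<And>i. i \<in> {1..<k} \<Longrightarrow> \<bar>mom i q - a i\<bar> \<le> d" "mom k q \<le> a k + d"
  using assms by (auto simp: feas_def with_moments_def)

lemma q0_feas: "0 \<le> d \<Longrightarrow> q0 \<in> feas d"
  using q0 by (auto simp: feas_def with_moments_def mom_def)

lemma feas_mono: "d \<le> d' \<Longrightarrow> feas d \<subseteq> feas d'"
  by (fastforce simp: feas_def)

lemma mix_with_moments:
  assumes p: "p \<in> with_moments" and q: "q \<in> with_moments" and e: "0 < e" "e < 1"
  shows "mix e p q \<in> with_moments" and "i \<in> {1..k} \<Longrightarrow> mom i (mix e p q) = (1 - e) * mom i p + e * mom i q"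
proof -
  have eq: "\<psi> i x * mix e p q x = (1 - e) * (\<psi> i x * p x) + e * (\<psi> i x * q x)" for i x
    by (simp add: algebra_simps)
  have "integrable M (\<lambda>x. \<psi> i x * mix e p q x)" if "i \<in> {1..k}" for i
    unfolding eq using with_momentsD(2)[OF p that] with_momentsD(2)[OF q that] by simp
  then show "mix e p q \<in> with_moments"
    using mix_fin_ent[OF with_momentsD(1)[OF p] with_momentsD(1)[OF q] e] unfolding with_moments_def by auto
  show "i \<in> {1..k} \<Longrightarrow> mom i (mix e p q) = (1 - e) * mom i p + e * mom i q"
    unfolding mom_def eq using with_momentsD(2)[OF p] with_momentsD(2)[OF q] by simp
qed

lemma feas_mix:
  assumes p: "p \<in> feas d" and q: "q \<in> feas d" and e: "0 < e" "e < 1"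
  shows "mix e p q \<in> feas d"
proof -
  note M = mix_with_moments[OF feasD(2)[OF p] feasD(2)[OF q] e]
  have "\<bar>mom i (mix e p q) - a i\<bar> \<le> d" if i: "i \<in> {1..<k}" for i
  proof -
    have "\<bar>mom i (mix e p q) - a i\<bar> = \<bar>(1 - e) * (mom i p - a i) + e * (mom i q - a i)\<bar>"
      using M(2)[of i] i by (simp add: algebra_simps)
    also have "\<dots> \<le> (1 - e) * \<bar>mom i p - a i\<bar> + e * \<bar>mom i q - a i\<bar>"
      using e by (intro order_trans[OF abs_triangle_ineq]) (simp add: abs_mult)
    also have "\<dots> \<le> (1 - e) * d + e * d"
      using e feasD(3)[OF p i] feasD(3)[OF q i] by (intro add_mono mult_left_mono) auto
    finally show ?thesis by (simp add: algebra_simps)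
  qed
  moreover have "mom k (mix e p q) \<le> a k + d"
  proof -
    have "mom k (mix e p q) \<le> (1 - e) * (a k + d) + e * (a k + d)"
      using e feasD(4)[OF p] feasD(4)[OF q] M(2)[of k] k by (auto intro!: add_mono mult_left_mono)
    then show ?thesis by (simp add: algebra_simps)
  qed
  ultimately show ?thesis using M(1) by (auto simp: feas_def)
qed

lemma moment_diff_le:
  assumes p: "p \<in> with_moments" and q: "q \<in> with_moments" and i: "i \<in> {1..<k}"
    and B: "0 \<le> e" "\<And>x. x \<in> space M \<Longrightarrow> \<psi> i x \<le> e * \<psi> k x + B"
  shows "\<bar>mom i q - mom i p\<bar> \<le> e * (mom k q + mom k p) + B * L1_dist M q p"
proof -
  have ik: "i \<in> {1..k}" "k \<in> {1..k}" using i k by auto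
  note I = with_momentsD(2)[OF p ik(1)] with_momentsD(2)[OF q ik(1)] with_momentsD(2)[OF p ik(2)] with_momentsD(2)[OF q ik(2)]
    fin_entD(3)[OF with_momentsD(1)[OF p]] fin_entD(3)[OF with_momentsD(1)[OF q]]
  have "\<bar>mom i q - mom i p\<bar> = \<bar>\<integral>x. \<psi> i x * q x - \<psi> i x * p x \<partial>M\<bar>" using I by (simp add: mom_def)
  also have "\<dots> \<le> (\<integral>x. \<bar>\<psi> i x * q x - \<psi> i x * p x\<bar> \<partial>M)" by (rule integral_abs_bound)
  also have "\<dots> \<le> (\<integral>x. e * (\<psi> k x * q x + \<psi> k x * p x) + B * \<bar>q x - p x\<bar> \<partial>M)"
  proof (rule integral_mono)
    fix x assume x: "x \<in> space M"
    have q0p0: "0 \<le> q x" "0 \<le> p x" using fin_entD(2)[OF with_momentsD(1)[OF q]] fin_entD(2)[OF with_momentsD(1)[OF p]] by simp_all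
    have "\<bar>\<psi> i x * q x - \<psi> i x * p x\<bar> = \<psi> i x * \<bar>q x - p x\<bar>"
      using nonneg_\<psi>[OF ik(1) x] by (simp add: abs_mult right_diff_distrib[symmetric])
    also have "\<dots> \<le> (e * \<psi> k x + B) * \<bar>q x - p x\<bar>" using B(2)[OF x] by (intro mult_right_mono) auto
    also have "\<dots> = e * \<psi> k x * \<bar>q x - p x\<bar> + B * \<bar>q x - p x\<bar>" by (simp add: algebra_simps)
    also have "\<dots> \<le> e * \<psi> k x * (q x + p x) + B * \<bar>q x - p x\<bar>"
      using q0p0 nonneg_\<psi>[OF ik(2) x] B(1) by (intro add_right_mono mult_left_mono) auto
    finally show "\<bar>\<psi> i x * q x - \<psi> i x * p x\<bar> \<le> e * (\<psi> k x * q x + \<psi> k x * p x) + B * \<bar>q x - p x\<bar>"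
      by (simp add: algebra_simps)
  qed (use I in auto)
  also have "\<dots> = e * (mom k q + mom k p) + B * L1_dist M q p" using I by (simp add: mom_def)
  finally show ?thesis .
qed

text \<open>
  The bound $\psi_i \le e \psi_k + B$ makes the lower moments continuous along the sequence, as the
  top moments are bounded.  The top moment itself is merely lower semicontinuous, which is enough
  for its one-sided constraint.
\<close>

lemma feas_closed:
  assumes q: "\<And>n. q n \<in> feas (d n)" and d: "d \<longlonglongrightarrow> d0" and p: "p \<in> fin_ent M"
    and L1: "(\<lambda>n. L1_dist M (q n) p) \<longlonglongrightarrow> 0"
  shows "p \<in> feas d0"
proof -
  note I = fin_entD(3)[OF feasD(1)[OF q]] fin_entD(3)[OF p]
  note [measurable] = fin_entD(1)[OF p] fin_entD(1)[OF feasD(1)[OF q]]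
  have kk: "k \<in> {1..k}" using k by simp
  note [measurable] = measurable_\<psi>[OF kk]
  have "\<exists>r. strict_mono r \<and> (AE x in M. (\<lambda>n. q (r n) x - p x) \<longlonglongrightarrow> 0)"
    using I L1 by (intro tendsto_L1_AE_subseq) auto
  then obtain r where r: "strict_mono r" "AE x in M. (\<lambda>n. q (r n) x - p x) \<longlonglongrightarrow> 0" by blast
  have lim: "AE x in M. (\<lambda>n. \<psi> k x * q (r n) x) \<longlonglongrightarrow> \<psi> k x * p x"
    using r(2) by eventually_elim (intro tendsto_mult_left, simp add: LIM_zero_iff)
  have fat: "integrable M (\<lambda>x. \<psi> k x * p x)" "mom k p \<le> a k + d0 + e" if "e > 0" for e
  proof -
    have "(\<lambda>n. d (r n)) \<longlonglongrightarrow> d0" using LIMSEQ_subseq_LIMSEQ[OF d r(1)] by (simp add: o_def)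
    then have "eventually (\<lambda>n. d (r n) < d0 + e) sequentially" using that by (simp add: order_tendstoD(2))
    then have ev: "eventually (\<lambda>n. (\<integral>x. \<psi> k x * q (r n) x \<partial>M) \<le> a k + d0 + e) sequentially"
    proof eventually_elim
      case (elim n) then show ?case using feasD(4)[OF q, of "r n"] by (simp add: mom_def)
    qed
    have nn: "0 \<le> \<psi> k x * q (r n) x" if "x \<in> space M" for n x
      using nonneg_\<psi>[OF kk that] fin_entD(2)[OF feasD(1)[OF q]] by simp
    show "integrable M (\<lambda>x. \<psi> k x * p x)" "mom k p \<le> a k + d0 + e"
      using fatou_bound[OF with_momentsD(2)[OF feasD(2)[OF q] kk] nn _ lim ev] by (auto simp: mom_def)
  qed
  have Ik: "integrable M (\<lambda>x. \<psi> k x * p x)" using fat(1)[of 1] by simp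
  have mk: "mom k p \<le> a k + d0" using fat(2) by (rule field_le_epsilon)
  have Ii: "integrable M (\<lambda>x. \<psi> i x * p x)" if i: "i \<in> {1..k}" for i
  proof (cases "i = k")
    case False
    then obtain B where B: "B \<ge> 0" "\<And>x. x \<in> space M \<Longrightarrow> \<psi> i x \<le> 1 * \<psi> k x + B" using dominated_\<psi>[of i 1] i by auto
    note [measurable] = measurable_\<psi>[OF i]
    show ?thesis
    proof (rule Bochner_Integration.integrable_bound)
      show "integrable M (\<lambda>x. \<psi> k x * p x + B * p x)" using Ik I by auto
      show "AE x in M. norm (\<psi> i x * p x) \<le> norm (\<psi> k x * p x + B * p x)"
      proof (rule AE_I2)
        fix x assume x: "x \<in> space M"
        have "\<psi> i x * p x \<le> (\<psi> k x + B) * p x" using B(2)[OF x] fin_entD(2)[OF p] by (intro mult_right_mono) auto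
        then show "norm (\<psi> i x * p x) \<le> norm (\<psi> k x * p x + B * p x)"
          using nonneg_\<psi>[OF i x] nonneg_\<psi>[OF kk x] fin_entD(2)[OF p, of x] B(1) by (simp add: algebra_simps)
      qed
    qed simp
  qed (use Ik in simp)
  have pm: "p \<in> with_moments" using p Ii by (auto simp: with_moments_def)
  obtain D where D: "\<And>n. d n \<le> D"
  proof -
    obtain D where D: "\<forall>n. norm (d n) \<le> D"
      using convergent_imp_Bseq[OF convergentI[OF d]] unfolding Bseq_def by blast
    have "\<bar>d n\<bar> \<le> D" for n using D[rule_format, of n] unfolding real_norm_def .
    then have "d n \<le> D" for n using abs_le_D1 by blast
    then show thesis by (rule that)
  qed
  have mi: "(\<lambda>n. mom i (q n)) \<longlonglongrightarrow> mom i p" if i: "i \<in> {1..<k}" for i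
  proof (rule LIMSEQ_I)
    fix r :: real assume r: "0 < r"
    define S where "S = \<bar>a k + D\<bar> + \<bar>mom k p\<bar> + 1"
    have S: "S > 0" by (simp add: S_def add_nonneg_pos)
    define e where "e = r / (2 * S)"
    have e: "e > 0" using r S by (simp add: e_def)
    obtain B where B: "B \<ge> 0" "\<And>x. x \<in> space M \<Longrightarrow> \<psi> i x \<le> e * \<psi> k x + B" using dominated_\<psi>[OF i e] by auto
    have B0: "(\<lambda>n. B * L1_dist M (q n) p) \<longlonglongrightarrow> B * 0" by (intro tendsto_mult_left L1)
    obtain N where N: "\<And>n. n \<ge> N \<Longrightarrow> norm (B * L1_dist M (q n) p - B * 0) < r / 2"
      using LIMSEQ_D[OF B0, of "r / 2"] r by auto
    have "norm (mom i (q n) - mom i p) < r" if "n \<ge> N" for n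
    proof -
      have "mom k (q n) \<le> a k + D" using feasD(4)[OF q, of n] D[of n] by linarith
      then have "e * (mom k (q n) + mom k p) \<le> e * S" using e by (intro mult_left_mono) (auto simp: S_def)
      also have "\<dots> = r / 2" using S by (simp add: e_def)
      finally show ?thesis
        using moment_diff_le[OF pm feasD(2)[OF q] i less_imp_le[OF e] B(2), of n] N[OF that] unfolding real_norm_def mult_zero_right diff_0_right by linarith
    qed
    then show "\<exists>N. \<forall>n\<ge>N. norm (mom i (q n) - mom i p) < r" by blast
  qed
  have "\<bar>mom i p - a i\<bar> \<le> d0" if i: "i \<in> {1..<k}" for i
    by (rule LIMSEQ_le[OF tendsto_rabs[OF tendsto_diff[OF mi[OF i] tendsto_const]] d]) (use feasD(3)[OF q i] in auto)
  then show ?thesis using pm mk by (auto simp: feas_def)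
qed

lemma rel_ent_ge:
  assumes "q \<in> fin_ent M"
  shows "- 1 \<le> rel_ent M q"
proof -
  have "(\<integral>x. - 1 \<partial>M) \<le> rel_ent M q" unfolding rel_ent_def
  proof (rule integral_mono)
    show "- 1 \<le> q x * ln (q x)" for x using xlnx_ge[OF fin_entD(2)[OF assms]] .
  qed (simp_all add: fin_entD(5)[OF assms])
  then show ?thesis by (simp add: prob_space)
qed

lemma Cauchy_of_entropy_gap:
  fixes q :: "nat \<Rightarrow> 'a \<Rightarrow> real"
  assumes q: "\<And>n. q n \<in> fin_ent M"
    and gap: "\<And>g. 0 < g \<Longrightarrow> \<exists>N. \<forall>m\<ge>N. \<forall>n\<ge>m. entropy_gap M (q m) (q n) < g"
    and e: "0 < e"
  shows "\<exists>N. \<forall>m\<ge>N. \<forall>n\<ge>N. L1_dist M (q m) (q n) < e"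
proof -
  \<comment> \<open>the bound 4 s + gap / (2 s) is at most e/2 + gap / (2 s), which leaves room for a gap below s e\<close>
  define s where "s = e / 8"
  have s: "s > 0" using e by (simp add: s_def)
  obtain N where N: "\<And>m n. m \<ge> N \<Longrightarrow> n \<ge> m \<Longrightarrow> entropy_gap M (q m) (q n) < s * e"
    using gap[of "s * e"] s e by auto
  have *: "L1_dist M (q m) (q n) < e" if "m \<ge> N" "n \<ge> m" for m n
  proof -
    have "(entropy_gap M (q m) (q n)) / (2 * s) < (s * e) / (2 * s)"
      using s N[OF that] by (intro divide_strict_right_mono) auto
    also have "\<dots> = e / 2" using s by simp
    finally show ?thesis using L1_dist_le_entropy_gap[OF q q s, of m n] s_def by linarith
  qed
  have "L1_dist M (q m) (q n) < e" if "m \<ge> N" "n \<ge> N" for m n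
    using linear[of m n] *[of m n] *[of n m] that by (auto simp: abs_minus_commute)
  then show ?thesis by blast
qed

lemma minimizerD:
  assumes "minimizer d p"
  shows "p \<in> feas d" "q \<in> feas d \<Longrightarrow> rel_ent M p \<le> rel_ent M q"
  using assms unfolding minimizer_def by blast+

text \<open>
  Midpoints of a minimizing sequence are feasible, so their entropy is at least the infimum; the
  entropy gaps tend to $0$ and the sequence is Cauchy in $L^1$.
\<close>

lemma minimizer_exists:
  assumes d: "0 \<le> d"
  shows "\<exists>p. minimizer d p"
proof -
  define I where "I = Inf (rel_ent M ` feas d)"
  have bdd: "bdd_below (rel_ent M ` feas d)" using rel_ent_ge feasD(1) by (intro bdd_belowI[of _ "- 1"]) auto
  have I: "I \<le> rel_ent M q" if "q \<in> feas d" for q unfolding I_def using bdd that by (intro cInf_lower) auto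
  have "\<exists>q\<in>feas d. rel_ent M q < I + 1 / Suc n" for n
    using cInf_lessD[of "rel_ent M ` feas d" "I + 1 / Suc n"] q0_feas[OF d] by (auto simp: I_def)
  then obtain q where q: "\<And>n. q n \<in> feas d" "\<And>n. rel_ent M (q n) < I + 1 / Suc n" by metis
  have gap: "\<exists>N. \<forall>m\<ge>N. \<forall>n\<ge>m. entropy_gap M (q m) (q n) < g" if "g > 0" for g
  proof -
    obtain N where N: "1 / Suc N < g / 2" using nat_approx_posE[of "g / 2"] \<open>g > 0\<close> by auto
    have "entropy_gap M (q m) (q n) < g" if "m \<ge> N" "n \<ge> m" for m n
    proof -
      have "1 / Suc m \<le> 1 / Suc N" "1 / Suc n \<le> 1 / Suc N" using that by (auto intro!: divide_left_mono)
      moreover have "I \<le> rel_ent M (mix (1/2) (q m) (q n))" by (intro I feas_mix q) auto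
      ultimately show ?thesis using q(2)[of m] q(2)[of n] N by linarith
    qed
    then show ?thesis by blast
  qed
  have lim: "(\<lambda>n. rel_ent M (q n)) \<longlonglongrightarrow> I"
  proof (rule tendsto_sandwich[of "\<lambda>_. I" _ _ "\<lambda>n. I + 1 / Suc n"])
    show "(\<lambda>n. I + 1 / Suc n) \<longlonglongrightarrow> I" using tendsto_add[OF tendsto_const LIMSEQ_inverse_real_of_nat, of I] by (simp add: inverse_eq_divide)
  qed (use I q in \<open>auto intro!: always_eventually less_imp_le\<close>)
  obtain p where p: "p \<in> fin_ent M" "rel_ent M p \<le> I" "(\<lambda>n. L1_dist M (q n) p) \<longlonglongrightarrow> 0"
    using fin_ent_L1_limit[OF feasD(1)[OF q(1)] Cauchy_of_entropy_gap[OF feasD(1)[OF q(1)] gap] lim] by blast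
  have "p \<in> feas d" by (rule feas_closed[OF q(1) tendsto_const p(1,3)])
  moreover have "rel_ent M p \<le> rel_ent M r" if "r \<in> feas d" for r using p(2) I[OF that] by linarith
  ultimately show ?thesis unfolding minimizer_def by blast
qed

lemma minimizer_unique:
  assumes p: "minimizer d p" and p': "minimizer d p'"
  shows "L1_dist M p (p') = 0"
proof -
  note f = minimizerD(1)[OF p] minimizerD(1)[OF p']
  have "mix (1/2) p p' \<in> feas d" by (rule feas_mix[OF f]) auto
  then have "rel_ent M p \<le> rel_ent M (mix (1/2) p p')" "rel_ent M p' \<le> rel_ent M (mix (1/2) p p')"
    using minimizerD(2)[OF p] minimizerD(2)[OF p'] by simp_all
  then have gap: "entropy_gap M p p' \<le> 0" by linarith
  have "L1_dist M p (p') \<le> 0 + e" if "e > 0" for e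
  proof -
    have "L1_dist M p (p') \<le> 4 * (e / 4) + (entropy_gap M p p') / (2 * (e / 4))"
      using that by (intro L1_dist_le_entropy_gap feasD(1)[OF f(1)] feasD(1)[OF f(2)]) auto
    also have "\<dots> \<le> 4 * (e / 4) + 0" using gap that by (intro add_left_mono divide_nonpos_pos) auto
    finally show ?thesis by simp
  qed
  then have "L1_dist M p (p') \<le> 0" by (rule field_le_epsilon)
  then show ?thesis by (simp add: antisym)
qed

definition opt :: "real \<Rightarrow> 'a \<Rightarrow> real" where
  "opt d = (SOME p. minimizer d p)"

lemma minimizer_opt: "0 \<le> d \<Longrightarrow> minimizer d (opt d)"
  unfolding opt_def using minimizer_exists by (rule someI_ex)

lemma opt_feas: "0 \<le> d \<Longrightarrow> opt d \<in> feas d"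
  and opt_le: "0 \<le> d \<Longrightarrow> q \<in> feas d \<Longrightarrow> rel_ent M (opt d) \<le> rel_ent M q"
  using minimizerD[OF minimizer_opt] by simp_all

text \<open>
  Along $\delta \downarrow 0$ the minimal entropy increases and is bounded by its value at
  $\delta = 0$.  For $\delta' \le \delta$ the midpoint of the two minimizers is feasible for
  $\delta$, so the entropy gap is at most the increment of the minimal entropy.  The $L^1$-limit is
  feasible for $\delta = 0$ and its entropy does not exceed the minimum.
\<close>

lemma opt_tendsto: "((\<lambda>d. L1_dist M (opt d) (opt 0)) \<longlongrightarrow> 0) (at_right 0)"
proof (rule tendsto_at_right_sequentially[of 0 1])
  fix S :: "nat \<Rightarrow> real" assume S: "\<And>n. 0 < S n" "decseq S" "S \<longlonglongrightarrow> 0"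
  have S0: "0 \<le> S n" for n using S(1)[of n] by simp
  let ?q = "\<lambda>n. opt (S n)"
  have q: "?q n \<in> feas (S n)" for n using opt_feas[OF S0] .
  have le: "rel_ent M (?q m) \<le> rel_ent M (?q n)" and le_mix: "rel_ent M (?q m) \<le> rel_ent M (mix (1/2) (?q m) (?q n))" if "m \<le> n" for m n
  proof -
    have n: "?q n \<in> feas (S m)" using feas_mono[of "S n" "S m"] q[of n] S(2) that by (auto simp: decseq_def)
    show "rel_ent M (?q m) \<le> rel_ent M (?q n)" using n by (rule opt_le[OF S0])
    show "rel_ent M (?q m) \<le> rel_ent M (mix (1/2) (?q m) (?q n))" by (intro opt_le[OF S0] feas_mix q n) auto
  qed
  have up: "rel_ent M (?q n) \<le> rel_ent M (opt 0)" for n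
    using feas_mono[OF S0] opt_feas[of 0] by (intro opt_le[OF S0]) auto
  obtain c where c: "(\<lambda>n. rel_ent M (?q n)) \<longlonglongrightarrow> c" "\<And>n. rel_ent M (?q n) \<le> c"
    using incseq_convergent[of "\<lambda>n. rel_ent M (?q n)" "rel_ent M (opt 0)"] le up by (auto simp: incseq_def)
  have gap: "\<exists>N. \<forall>m\<ge>N. \<forall>n\<ge>m. entropy_gap M (?q m) (?q n) < g" if g: "g > 0" for g
  proof -
    obtain N where N: "\<And>n. n \<ge> N \<Longrightarrow> \<bar>rel_ent M (?q n) - c\<bar> < g" using LIMSEQ_D[OF c(1) g] by auto
    have "entropy_gap M (?q m) (?q n) < g" if "m \<ge> N" "n \<ge> m" for m n
      using N[OF that(1)] c(2)[of n] le_mix[OF that(2)] by linarith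
    then show ?thesis by blast
  qed
  obtain p where p: "p \<in> fin_ent M" "rel_ent M p \<le> c" "(\<lambda>n. L1_dist M (?q n) p) \<longlonglongrightarrow> 0"
    using fin_ent_L1_limit[OF feasD(1)[OF q] Cauchy_of_entropy_gap[OF feasD(1)[OF q] gap] c(1)] by blast
  have pf: "p \<in> feas 0" by (rule feas_closed[OF q S(3) p(1,3)])
  have "c \<le> rel_ent M (opt 0)" using LIMSEQ_le_const2[OF c(1)] up by blast
  then have "rel_ent M p \<le> rel_ent M r" if "r \<in> feas 0" for r
    using p(2) opt_le[OF order_refl that] by linarith
  then have "minimizer 0 p" using pf unfolding minimizer_def by blast
  then have eq: "L1_dist M p (opt 0) = 0" using minimizer_unique[OF _ minimizer_opt[OF order_refl]] by simp
  have "L1_dist M (?q n) (opt 0) \<le> L1_dist M (?q n) p" for n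
  proof -
    note I = fin_entD(3)[OF feasD(1)[OF q]] fin_entD(3)[OF p(1)] fin_entD(3)[OF feasD(1)[OF opt_feas[of 0]]]
    have "L1_dist M (?q n) (opt 0) \<le> (\<integral>x. \<bar>?q n x - p x\<bar> + \<bar>p x - opt 0 x\<bar> \<partial>M)"
      using I by (intro integral_mono) auto
    also have "\<dots> = L1_dist M (?q n) p" using I eq by simp
    finally show ?thesis .
  qed
  then show "(\<lambda>n. L1_dist M (opt (S n)) (opt 0)) \<longlonglongrightarrow> 0"
    by (intro tendsto_sandwich[OF _ _ tendsto_const p(3)]) auto
qed simp

section \<open>The probability of the conditioning event\<close>

text \<open>
  The normalized indicator of an event $B$ has relative entropy $- \ln P(B)$.
\<close>

lemma excursion_density:
  assumes e: "0 < e"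
  obtains L \<rho> where "1 / e \<le> L" "\<rho> \<in> with_moments" "rel_ent M \<rho> \<le> e * L" "L \<le> mom k \<rho>" "mom k \<rho> \<le> L + 1"
    "\<And>i. i \<in> {1..<k} \<Longrightarrow> 0 \<le> mom i \<rho> \<and> mom i \<rho> \<le> e * L"
proof -
  obtain L B where L: "1 / e \<le> L" and B[measurable]: "B \<in> sets M" and B0: "0 < prob B" and lnB: "- ln (prob B) \<le> e * L"
    and Bk: "\<And>x. x \<in> B \<Longrightarrow> L \<le> \<psi> k x \<and> \<psi> k x \<le> L + 1" and Bi: "\<And>x i. x \<in> B \<Longrightarrow> i \<in> {1..<k} \<Longrightarrow> \<psi> i x \<le> e * L"
    using excursion[OF e] by metis
  define \<rho> where "\<rho> x = indicator B x / prob B" for x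
  have IB: "integrable M (indicator B :: _ \<Rightarrow> real)" by (auto simp: less_top[symmetric])
  have [measurable]: "\<rho> \<in> borel_measurable M" unfolding \<rho>_def by measurable
  have ent: "\<rho> x * ln (\<rho> x) = indicator B x * (- ln (prob B) / prob B)" for x
    using B0 by (auto simp: \<rho>_def indicator_def ln_div)
  have "integrable M \<rho>" "(\<integral>x. \<rho> x \<partial>M) = 1" unfolding \<rho>_def[abs_def] using IB B0 by simp_all
  moreover have "integrable M (\<lambda>x. \<rho> x * ln (\<rho> x))" unfolding ent using IB by simp
  ultimately have \<rho>: "\<rho> \<in> fin_ent M" by (intro fin_entI) (auto simp: \<rho>_def)
  have e\<rho>: "rel_ent M \<rho> = - ln (prob B)" unfolding rel_ent_def ent using B0 by simp
  have Bsp: "x \<in> B \<Longrightarrow> x \<in> space M" for x using sets.sets_into_space[OF B] by auto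
  have bd: "integrable M (\<lambda>x. \<psi> i x * \<rho> x)" "l \<le> mom i \<rho>" "mom i \<rho> \<le> u"
    if i: "i \<in> {1..k}" and lu: "\<And>x. x \<in> B \<Longrightarrow> l \<le> \<psi> i x \<and> \<psi> i x \<le> u" for i l u
  proof -
    note [measurable] = measurable_\<psi>[OF i]
    have le: "l * \<rho> x \<le> \<psi> i x * \<rho> x" "\<psi> i x * \<rho> x \<le> u * \<rho> x" for x
      using lu[of x] B0 by (auto simp: \<rho>_def indicator_def divide_right_mono)
    note I = fin_entD(3)[OF \<rho>]
    show Ii: "integrable M (\<lambda>x. \<psi> i x * \<rho> x)"
    proof (rule Bochner_Integration.integrable_bound)
      show "integrable M (\<lambda>x. u * \<rho> x)" using I by simp
      show "AE x in M. norm (\<psi> i x * \<rho> x) \<le> norm (u * \<rho> x)"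
      proof (rule AE_I2)
        fix x assume "x \<in> space M"
        then have "0 \<le> \<psi> i x * \<rho> x" using nonneg_\<psi>[OF i] fin_entD(2)[OF \<rho>] by simp
        then show "norm (\<psi> i x * \<rho> x) \<le> norm (u * \<rho> x)" using le(2)[of x] by simp
      qed
    qed simp
    have "(\<integral>x. l * \<rho> x \<partial>M) \<le> mom i \<rho>" "mom i \<rho> \<le> (\<integral>x. u * \<rho> x \<partial>M)"
      unfolding mom_def by (intro integral_mono integrable_mult_right I Ii le)+
    then show "l \<le> mom i \<rho>" "mom i \<rho> \<le> u" using fin_entD(4)[OF \<rho>] by simp_all
  qed
  have kk: "k \<in> {1..k}" using k by simp
  have u: "\<psi> i x \<le> (if i = k then L + 1 else e * L)" if "i \<in> {1..k}" "x \<in> B" for i x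
    using Bk[OF that(2)] Bi[OF that(2), of i] that(1) by auto
  have "integrable M (\<lambda>x. \<psi> i x * \<rho> x)" if i: "i \<in> {1..k}" for i
    by (rule bd(1)[OF i]) (use u[OF i] nonneg_\<psi>[OF i] Bsp in blast)
  then have wm: "\<rho> \<in> with_moments" unfolding with_moments_def using \<rho> by blast
  have "0 \<le> mom i \<rho>" "mom i \<rho> \<le> e * L" if i: "i \<in> {1..<k}" for i
  proof -
    have ik: "i \<in> {1..k}" using i by auto
    have lu: "0 \<le> \<psi> i x \<and> \<psi> i x \<le> e * L" if "x \<in> B" for x using that i nonneg_\<psi>[OF ik] Bsp Bi by blast
    show "0 \<le> mom i \<rho>" "mom i \<rho> \<le> e * L" by (rule bd(2)[OF ik lu], assumption) (rule bd(3)[OF ik lu], assumption)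
  qed
  moreover have "L \<le> mom k \<rho>" "mom k \<rho> \<le> L + 1" by (rule bd(2)[OF kk Bk], assumption) (rule bd(3)[OF kk Bk], assumption)
  ultimately show thesis using that[OF L wm] e\<rho> lnB by simp
qed

text \<open>
  Mixing in a little of \<open>q0\<close> makes all inequalities strict.  If the top moment is then too low by
  an amount $w$, weight $w/L$ is given to an excursion at height $L$: its contribution to the top
  moment is $w$ up to $w/L$, and its contribution to the lower moments and to the entropy is at most
  $(w/L) \cdot t L = w t$ with $t$ as small as desired.
\<close>

lemma interior_approximation:
  assumes d: "0 < d" and e: "0 < e"
  obtains q where "q \<in> with_moments" "\<And>i. i \<in> {1..k} \<Longrightarrow> \<bar>mom i q - a i\<bar> < d" "rel_ent M q < rel_ent M (opt d) + e"
proof -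
  define p where "p = opt d"
  have p: "p \<in> feas d" using opt_feas[of d] d by (simp add: p_def)
  have q0f: "q0 \<in> feas 0" by (rule q0_feas) simp
  have q0m: "mom k q0 < a k" using q0(4) by (simp add: mom_def)
  have "((\<lambda>s. (1 - s) * rel_ent M p + s * rel_ent M q0) \<longlongrightarrow> (1 - 0) * rel_ent M p + 0 * rel_ent M q0) (at_right 0)"
    by (intro tendsto_intros)
  then have "eventually (\<lambda>s. (1 - s) * rel_ent M p + s * rel_ent M q0 < rel_ent M p + e / 2) (at_right 0)"
    using e by (intro order_tendstoD(2)) auto
  moreover have "eventually (\<lambda>s::real. 0 < s \<and> s < 1) (at_right 0)"
    unfolding eventually_at_right_field by (auto intro!: exI[of _ 1])
  ultimately have "eventually (\<lambda>s. 0 < s \<and> s < 1 \<and> (1 - s) * rel_ent M p + s * rel_ent M q0 < rel_ent M p + e / 2) (at_right 0)"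
    by eventually_elim auto
  then obtain s where s: "0 < s" "s < 1" "(1 - s) * rel_ent M p + s * rel_ent M q0 < rel_ent M p + e / 2"
    using eventually_happens' trivial_limit_at_right_real by (metis (mono_tags, lifting))
  define q1 where "q1 = mix s p q0"
  note m1 = mix_with_moments[OF feasD(2)[OF p] feasD(2)[OF q0f] s(1,2), folded q1_def]
  have ent1: "rel_ent M q1 < rel_ent M p + e / 2"
    using rel_ent_mix_le[OF feasD(1)[OF p] feasD(1)[OF q0f] s(1,2)] s(3) by (simp add: q1_def)
  have mom1: "\<bar>mom i q1 - a i\<bar> < d" if i: "i \<in> {1..<k}" for i
  proof -
    have "mom i q1 - a i = (1 - s) * (mom i p - a i) + s * (mom i q0 - a i)"
      using m1(2)[of i] i by (simp add: algebra_simps)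
    also have "\<dots> = (1 - s) * (mom i p - a i)" using q0(3)[OF i] by (simp add: mom_def)
    finally have "\<bar>mom i q1 - a i\<bar> = (1 - s) * \<bar>mom i p - a i\<bar>" using s by (simp add: abs_mult)
    also have "\<dots> \<le> (1 - s) * d" using s feasD(3)[OF p i] by (intro mult_left_mono) auto
    also have "\<dots> < d" using s d by simp
    finally show ?thesis .
  qed
  have mom1k: "mom k q1 < a k + d"
  proof -
    have "mom k q1 \<le> (1 - s) * (a k + d) + s * mom k q0"
      using m1(2)[of k] k s feasD(4)[OF p] by (simp add: mult_left_mono)
    also have "\<dots> < (1 - s) * (a k + d) + s * (a k + d)" using s q0m d by (intro add_strict_left_mono mult_strict_left_mono) auto
    finally show ?thesis by (simp add: algebra_simps)
  qed
  show thesis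
  proof (cases "a k - d < mom k q1")
    case True
    have "\<bar>mom i q1 - a i\<bar> < d" if i: "i \<in> {1..k}" for i
    proof (cases "i = k")
      case True2: True
      then show ?thesis using True mom1k by simp
    qed (use mom1 i in auto)
    then show thesis using that[OF m1(1)] ent1 e by (simp add: p_def)
  next
    case False
    \<comment> \<open>the missing amount w of the top moment is supplied by an excursion of weight w / L\<close>
    define w where "w = a k - mom k q1"
    have w: "w > 0" using False d by (simp add: w_def)
    have small: "eventually (\<lambda>t. w * t * c < b) (at_right 0)" if "0 < b" for c b :: real
    proof -
      have "((\<lambda>t. w * t * c) \<longlongrightarrow> w * 0 * c) (at_right 0)" by (intro tendsto_intros)
      then show ?thesis using that by (intro order_tendstoD(2)) auto
    qed
    have "eventually (\<lambda>t. \<forall>i\<in>{1..<k}. w * t * (\<bar>mom i q1\<bar> + 1) < d - \<bar>mom i q1 - a i\<bar>) (at_right 0)"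
      using mom1 by (intro eventually_ball_finite ballI small) auto
    moreover have "eventually (\<lambda>t. w * t * (\<bar>a k - w\<bar> + 1) < d) (at_right 0)" by (intro small d)
    moreover have "eventually (\<lambda>t. w * t * (\<bar>rel_ent M q1\<bar> + 1) < e / 2) (at_right 0)" using e by (intro small) auto
    moreover have "eventually (\<lambda>t. w * t * 1 < 1) (at_right 0)" by (intro small) auto
    moreover have "eventually (\<lambda>t::real. 0 < t) (at_right 0)" by (simp add: eventually_at_right_less)
    ultimately have "eventually (\<lambda>t. (\<forall>i\<in>{1..<k}. w * t * (\<bar>mom i q1\<bar> + 1) < d - \<bar>mom i q1 - a i\<bar>) \<and> w * t * (\<bar>a k - w\<bar> + 1) < d \<and>
      w * t * (\<bar>rel_ent M q1\<bar> + 1) < e / 2 \<and> w * t < 1 \<and> 0 < t) (at_right 0)"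
      by eventually_elim auto
    then obtain t where t: "\<And>i. i \<in> {1..<k} \<Longrightarrow> w * t * (\<bar>mom i q1\<bar> + 1) < d - \<bar>mom i q1 - a i\<bar>" "w * t * (\<bar>a k - w\<bar> + 1) < d"
      "w * t * (\<bar>rel_ent M q1\<bar> + 1) < e / 2" "w * t < 1" "0 < t"
      using eventually_happens' trivial_limit_at_right_real by (metis (mono_tags, lifting))
    obtain L \<rho> where L: "1 / t \<le> L" and \<rho>: "\<rho> \<in> with_moments" "rel_ent M \<rho> \<le> t * L" "L \<le> mom k \<rho>" "mom k \<rho> \<le> L + 1"
      and \<rho>i: "\<And>i. i \<in> {1..<k} \<Longrightarrow> 0 \<le> mom i \<rho> \<and> mom i \<rho> \<le> t * L"
      using excursion_density[OF t(5)] by metis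
    have L0: "L > 0" using L t(5) by (meson less_le_trans zero_less_divide_1_iff)
    define u where "u = w / L"
    have uL: "u * L = w" using L0 by (simp add: u_def)
    have u0: "0 < u" using w L0 by (simp add: u_def)
    have "1 \<le> t * L" using L t(5) by (simp add: field_simps)
    then have "w * 1 \<le> w * (t * L)" using w by (intro mult_left_mono) auto
    then have ut: "u \<le> w * t" using L0 by (simp add: u_def field_simps)
    have u1: "u < 1" using ut t(4) by linarith
    have utL: "u * (t * L) = w * t" using uL by (simp add: algebra_simps)
    define q2 where "q2 = mix u q1 \<rho>"
    note m2 = mix_with_moments[OF m1(1) \<rho>(1) u0 u1, folded q2_def]
    have mul: "u * \<bar>x\<bar> \<le> w * t * \<bar>x\<bar>" for x using ut by (intro mult_right_mono) auto
    have mom2: "\<bar>mom i q2 - a i\<bar> < d" if i: "i \<in> {1..<k}" for i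
    proof -
      have "mom i q2 - a i = (mom i q1 - a i) - u * mom i q1 + u * mom i \<rho>"
        using m2(2)[of i] i by (simp add: algebra_simps)
      moreover have "0 \<le> u * mom i \<rho>" "u * mom i \<rho> \<le> w * t"
        using \<rho>i[OF i] u0 mult_left_mono[of "mom i \<rho>" "t * L" u] utL by auto
      moreover have "\<bar>u * mom i q1\<bar> \<le> w * t * \<bar>mom i q1\<bar>" using mul[of "mom i q1"] u0 by (simp add: abs_mult)
      moreover have "w * t * (\<bar>mom i q1\<bar> + 1) = w * t * \<bar>mom i q1\<bar> + w * t" by (simp add: algebra_simps)
      ultimately show ?thesis using t(1)[OF i] by linarith
    qed
    have mom2k: "\<bar>mom k q2 - a k\<bar> < d"
    proof -
      have "mom k q2 - a k = u * (mom k \<rho> - L) - u * (a k - w)"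
        using m2(2)[of k] k uL by (simp add: w_def algebra_simps)
      moreover have "0 \<le> u * (mom k \<rho> - L)" "u * (mom k \<rho> - L) \<le> u * 1"
        using u0 \<rho>(3,4) by (auto intro!: mult_nonneg_nonneg mult_left_mono)
      moreover have "\<bar>u * (a k - w)\<bar> \<le> w * t * \<bar>a k - w\<bar>" using mul[of "a k - w"] u0 by (simp add: abs_mult)
      moreover have "w * t * (\<bar>a k - w\<bar> + 1) = w * t * \<bar>a k - w\<bar> + w * t" by (simp add: algebra_simps)
      ultimately show ?thesis using t(2) ut by linarith
    qed
    have ent2: "rel_ent M q2 < rel_ent M p + e"
    proof -
      have "rel_ent M q2 \<le> (1 - u) * rel_ent M q1 + u * rel_ent M \<rho>"
        unfolding q2_def using with_momentsD(1)[OF m1(1)] with_momentsD(1)[OF \<rho>(1)] u0 u1 by (rule rel_ent_mix_le)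
      also have "\<dots> = rel_ent M q1 - u * rel_ent M q1 + u * rel_ent M \<rho>" by (simp add: algebra_simps)
      finally have "rel_ent M q2 \<le> rel_ent M q1 - u * rel_ent M q1 + u * rel_ent M \<rho>" .
      moreover have "u * rel_ent M \<rho> \<le> w * t" using \<rho>(2) u0 mult_left_mono[of "rel_ent M \<rho>" "t * L" u] utL by auto
      moreover have "\<bar>u * rel_ent M q1\<bar> \<le> w * t * \<bar>rel_ent M q1\<bar>" using mul[of "rel_ent M q1"] u0 by (simp add: abs_mult)
      moreover have "w * t * (\<bar>rel_ent M q1\<bar> + 1) = w * t * \<bar>rel_ent M q1\<bar> + w * t" by (simp add: algebra_simps)
      ultimately show ?thesis using t(3) ent1 by linarith
    qed
    have "\<bar>mom i q2 - a i\<bar> < d" if i: "i \<in> {1..k}" for i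
      using mom2[of i] mom2k i by (cases "i = k") auto
    then show thesis using that[OF m2(1)] ent2 by (simp add: p_def)
  qed
qed

text \<open>
  The sets on which all $\psi_i$ are at most $T$ exhaust the space.
\<close>

lemma tendsto_integral_core:
  fixes g :: "'a \<Rightarrow> real"
  assumes g[measurable]: "integrable M g"
  defines "core T \<equiv> {x \<in> space M. \<forall>i\<in>{1..k}. \<psi> i x \<le> real T}"
  shows "(\<lambda>T. \<integral>x. g x * indicator (core T) x \<partial>M) \<longlonglongrightarrow> (\<integral>x. g x \<partial>M)"
proof (rule integral_dominated_convergence[where w="\<lambda>x. \<bar>g x\<bar>"])
  have [measurable]: "core T \<in> sets M" for T unfolding core_def by measurable
  show "(\<lambda>x. g x * indicator (core T) x) \<in> borel_measurable M" for T by measurable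
  show "AE x in M. (\<lambda>T. g x * indicator (core T) x) \<longlonglongrightarrow> g x"
  proof (rule AE_I2)
    fix x assume x: "x \<in> space M"
    have "eventually (\<lambda>T. \<psi> i x \<le> real T) sequentially" for i
      using filterlim_real_sequentially by (auto simp: filterlim_at_top)
    then have "eventually (\<lambda>T. \<forall>i\<in>{1..k}. \<psi> i x \<le> real T) sequentially" by (intro eventually_ball_finite) auto
    then have "eventually (\<lambda>T. g x * indicator (core T) x = g x) sequentially"
      by eventually_elim (use x in \<open>auto simp: core_def\<close>)
    then show "(\<lambda>T. g x * indicator (core T) x) \<longlonglongrightarrow> g x" by (rule tendsto_eventually)
  qed
qed (use g in \<open>auto simp: indicator_def\<close>)

text \<open>
  On the support of the truncated density all $\psi_i$ are bounded, as required for Hoeffding's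
  inequality.
\<close>

lemma truncation:
  assumes q: "q \<in> with_moments" and m: "\<And>i. i \<in> {1..k} \<Longrightarrow> \<bar>mom i q - a i\<bar> < d" and ent: "rel_ent M q < c"
  obtains r T where "r \<in> with_moments" "\<And>i. i \<in> {1..k} \<Longrightarrow> \<bar>mom i r - a i\<bar> < d" "rel_ent M r < c"
    "0 < T" "\<And>x i. x \<in> space M \<Longrightarrow> r x \<noteq> 0 \<Longrightarrow> i \<in> {1..k} \<Longrightarrow> \<psi> i x \<le> T"
proof -
  note qf = with_momentsD(1)[OF q]
  note [measurable] = fin_entD(1)[OF qf]
  define core where "core T = {x \<in> space M. \<forall>i\<in>{1..k}. \<psi> i x \<le> real T}" for T
  have core[measurable]: "core T \<in> sets M" for T unfolding core_def by measurable
  note lim = tendsto_integral_core[folded core_def]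
  define z where "z T = (\<integral>x. q x * indicator (core T) x \<partial>M)" for T
  have z: "z \<longlonglongrightarrow> 1" unfolding z_def using lim[OF fin_entD(3)[OF qf]] fin_entD(4)[OF qf] by simp
  define r where "r T x = q x * indicator (core T) x / z T" for T x
  have rI: "integrable M (\<lambda>x. q x * indicator (core T) x)" "integrable M (\<lambda>x. q x * ln (q x) * indicator (core T) x)" for T
    using fin_entD(3,5)[OF qf] by (auto intro!: integrable_real_mult_indicator)
  have \<psi>I: "integrable M (\<lambda>x. \<psi> i x * q x * indicator (core T) x)" if "i \<in> {1..k}" for i T
    using with_momentsD(2)[OF q that] by (auto intro!: integrable_real_mult_indicator)
  have ent_eq: "r T x * ln (r T x) = (q x * ln (q x) * indicator (core T) x) / z T - ln (z T) * (q x * indicator (core T) x) / z T"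
    if "z T > 0" for T x
    using that fin_entD(2)[OF qf, of x] by (cases "q x = 0") (auto simp: r_def indicator_def ln_div field_simps)
  have rw: "r T \<in> with_moments" if T: "z T > 0" for T
  proof -
    have "integrable M (\<lambda>x. r T x * ln (r T x))" unfolding ent_eq[OF T] using rI[of T] by auto
    moreover have "integrable M (\<lambda>x. \<psi> i x * r T x)" if "i \<in> {1..k}" for i
      using \<psi>I[OF that, of T] by (simp add: r_def algebra_simps)
    moreover have "(\<integral>x. r T x \<partial>M) = 1" using T by (simp add: r_def z_def)
    moreover have "integrable M (r T)" using rI(1)[of T] unfolding r_def by simp
    moreover have "r T \<in> borel_measurable M" unfolding r_def by measurable
    moreover have "0 \<le> r T x" for x using T fin_entD(2)[OF qf] by (simp add: r_def)
    ultimately show ?thesis unfolding with_moments_def by (auto intro: fin_entI)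
  qed
  have "eventually (\<lambda>T. z T > 0) sequentially" using z by (intro order_tendstoD(1)) auto
  moreover have "eventually (\<lambda>T. \<forall>i\<in>{1..k}. \<bar>mom i (r T) - a i\<bar> < d) sequentially"
  proof (intro eventually_ball_finite ballI)
    fix i assume i: "i \<in> {1..k}"
    have "(\<lambda>T. (\<integral>x. \<psi> i x * q x * indicator (core T) x \<partial>M) / z T) \<longlonglongrightarrow> mom i q / 1"
      using lim[OF with_momentsD(2)[OF q i]] z by (intro tendsto_divide) (auto simp: mom_def)
    moreover have "mom i (r T) = (\<integral>x. \<psi> i x * q x * indicator (core T) x \<partial>M) / z T" for T
      by (simp add: mom_def r_def mult.assoc)
    ultimately have "(\<lambda>T. \<bar>mom i (r T) - a i\<bar>) \<longlonglongrightarrow> \<bar>mom i q / 1 - a i\<bar>" by (simp only:) (rule tendsto_rabs[OF tendsto_diff[OF _ tendsto_const]])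
    then show "eventually (\<lambda>T. \<bar>mom i (r T) - a i\<bar> < d) sequentially" using m[OF i] by (intro order_tendstoD(2)) auto
  qed simp
  moreover have "eventually (\<lambda>T. (\<integral>x. q x * ln (q x) * indicator (core T) x \<partial>M) / z T - ln (z T) < c) sequentially"
  proof -
    have "(\<lambda>T. (\<integral>x. q x * ln (q x) * indicator (core T) x \<partial>M) / z T - ln (z T)) \<longlonglongrightarrow> rel_ent M q / 1 - ln 1"
      using lim[OF fin_entD(5)[OF qf]] z by (intro tendsto_diff tendsto_divide tendsto_ln) (auto simp: rel_ent_def)
    then show ?thesis using ent by (intro order_tendstoD(2)) auto
  qed
  moreover have "eventually (\<lambda>T::nat. 0 < T) sequentially" by (rule eventually_gt_at_top)
  ultimately have "eventually (\<lambda>T. z T > 0 \<and> (\<forall>i\<in>{1..k}. \<bar>mom i (r T) - a i\<bar> < d) \<and>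
    (\<integral>x. q x * ln (q x) * indicator (core T) x \<partial>M) / z T - ln (z T) < c \<and> 0 < T) sequentially"
    by eventually_elim auto
  then obtain T where T: "z T > 0" "\<forall>i\<in>{1..k}. \<bar>mom i (r T) - a i\<bar> < d"
    "(\<integral>x. q x * ln (q x) * indicator (core T) x \<partial>M) / z T - ln (z T) < c" "0 < T"
    by (auto simp: eventually_sequentially)
  have "rel_ent M (r T) = (\<integral>x. q x * ln (q x) * indicator (core T) x \<partial>M) / z T - ln (z T)"
    unfolding rel_ent_def ent_eq[OF T(1)] using rI[of T] T(1) by (simp add: z_def[symmetric])
  then have "rel_ent M (r T) < c" using T(3) by simp
  moreover have "\<psi> i x \<le> real T" if "r T x \<noteq> 0" "i \<in> {1..k}" for x i
    using that by (auto simp: r_def core_def indicator_def split: if_splits)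
  ultimately show thesis using that[OF rw[OF T(1)], of "real T"] T(2,4) by auto
qed

definition avg_event :: "nat \<Rightarrow> real \<Rightarrow> (nat \<Rightarrow> 'a) set" where
  "avg_event n d = {x \<in> space (iid {..<n}). \<forall>i\<in>{1..k}. \<bar>(\<Sum>l<n. \<psi> i (x l)) / n - a i\<bar> \<le> d}"

lemma sets_avg_event[measurable]: "avg_event n d \<in> sets (iid {..<n})"
  unfolding avg_event_def by measurable

lemma symmetric_avg_event: "symmetric_event n (avg_event n d)"
  unfolding symmetric_event_def
proof (intro allI impI ballI)
  fix \<pi> x assume \<pi>: "\<pi> permutes {..<n}" and x: "x \<in> space (iid {..<n})"
  have "(\<lambda>i\<in>{..<n}. x (\<pi> i)) \<in> space (iid {..<n})"
    using x permutes_in_image[OF \<pi>] by (auto simp: space_PiM PiE_def Pi_def)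
  moreover have "(\<Sum>l<n. \<psi> i ((\<lambda>i\<in>{..<n}. x (\<pi> i)) l)) = (\<Sum>l<n. \<psi> i (x l))" for i
    using sum.permute[OF \<pi>, of "\<lambda>l. \<psi> i (x l)"] by (simp add: o_def)
  ultimately show "(\<lambda>i\<in>{..<n}. x (\<pi> i)) \<in> avg_event n d \<longleftrightarrow> x \<in> avg_event n d"
    using x by (simp add: avg_event_def)
qed

lemma truncated_concentration:
  assumes r: "r \<in> with_moments" and m: "\<And>i. i \<in> {1..k} \<Longrightarrow> \<bar>mom i r - a i\<bar> < d"
    and T: "0 < T" "\<And>x i. x \<in> space M \<Longrightarrow> r x \<noteq> 0 \<Longrightarrow> i \<in> {1..k} \<Longrightarrow> \<psi> i x \<le> T"
  shows "(\<lambda>n. measure (PiM {..<n} (\<lambda>_. law M r)) (avg_event n d)) \<longlonglongrightarrow> 1"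
proof -
  let ?N = "law M r"
  note rf = with_momentsD(1)[OF r]
  note [measurable] = fin_entD(1)[OF rf]
  interpret N: prob_space ?N by (rule fin_ent_prob_space[OF rf])
  have setsN[measurable_cong]: "sets (N.iid J) = sets (iid J)" for J by (intro sets_PiM_cong) auto
  have spN: "space (N.iid J) = space (iid J)" for J by (simp add: space_PiM)
  define \<tau> where "\<tau> i = d - \<bar>mom i r - a i\<bar>" for i
  have \<tau>: "0 < \<tau> i" if "i \<in> {1..k}" for i using m[OF that] by (simp add: \<tau>_def)
  define b where "b i n = 2 * exp (- (2 * (\<tau> i)\<^sup>2 / T\<^sup>2) * real n)" for i and n :: nat
  have dev: "measure (N.iid {..<n}) {x \<in> space (N.iid {..<n}). n * \<tau> i \<le> \<bar>(\<Sum>l<n. \<psi> i (x l)) - n * mom i r\<bar>} \<le> b i n"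
    if i: "i \<in> {1..k}" and n: "0 < n" for i n
  proof -
    interpret R: prob_space "N.iid {..<n}" by (rule N.prob_space_iid)
    note [measurable] = measurable_\<psi>[OF i]
    have mN: "\<psi> i \<in> borel_measurable ?N" by simp
    have ind: "R.indep_vars (\<lambda>_. borel) (\<lambda>l x. \<psi> i (x l)) {..<n}"
      using R.indep_vars_compose2[OF N.indep_coordinates[OF n], of "\<lambda>_. \<psi> i" "\<lambda>_. borel"] mN by simp
    have AE: "AE x in N.iid {..<n}. \<psi> i (x l) \<in> {0..T}" if l: "l < n" for l
    proof -
      have "AE x in ?N. \<psi> i x \<in> {0..T}"
        using T(2)[OF _ _ i] nonneg_\<psi>[OF i] by (subst AE_density) auto
      then show ?thesis using l by (intro AE_PiM_component[where P="\<lambda>y. \<psi> i y \<in> {0..T}"]) (auto intro: N.prob_space_axioms)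
    qed
    have E: "(\<integral>x. \<psi> i (x l) \<partial>N.iid {..<n}) = mom i r" if l: "l < n" for l
    proof -
      have "distr (N.iid {..<n}) ?N (\<lambda>x. x l) = ?N" using l by (intro distr_PiM_component) (auto intro: N.prob_space_axioms)
      then have "(\<integral>x. \<psi> i x \<partial>?N) = (\<integral>x. \<psi> i x \<partial>distr (N.iid {..<n}) ?N (\<lambda>x. x l))" by simp
      also have "\<dots> = (\<integral>x. \<psi> i (x l) \<partial>N.iid {..<n})" using l by (intro integral_distr) auto
      also have "(\<integral>x. \<psi> i x \<partial>?N) = mom i r" unfolding mom_def
        by (subst integral_density) (auto simp: fin_entD(2)[OF rf] mult.commute)
      finally show ?thesis by simp
    qed
    interpret H: Hoeffding_ineq "N.iid {..<n}" "{..<n}" "\<lambda>l x. \<psi> i (x l)" "\<lambda>_. 0" "\<lambda>_. T" "\<Sum>l<n. \<integral>x. \<psi> i (x l) \<partial>N.iid {..<n}"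
      using ind AE by unfold_locales auto
    have "measure (N.iid {..<n}) {x \<in> space (N.iid {..<n}). n * \<tau> i \<le> \<bar>(\<Sum>l<n. \<psi> i (x l)) - (\<Sum>l<n. \<integral>x. \<psi> i (x l) \<partial>N.iid {..<n})\<bar>}
        \<le> 2 * exp (- 2 * (n * \<tau> i)\<^sup>2 / (\<Sum>l<n. (T - 0)\<^sup>2))"
      using \<tau>[OF i] T(1) n by (intro H.Hoeffding_ineq_abs_ge) auto
    also have "(\<Sum>l<n. \<integral>x. \<psi> i (x l) \<partial>N.iid {..<n}) = n * mom i r" using E by simp
    also have "2 * exp (- 2 * (n * \<tau> i)\<^sup>2 / (\<Sum>l<n. (T - 0)\<^sup>2)) = b i n"
      using n T(1) by (simp add: b_def power2_eq_square field_simps)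
    finally show ?thesis .
  qed
  have low: "1 - (\<Sum>i\<in>{1..k}. b i n) \<le> measure (N.iid {..<n}) (avg_event n d)" if n: "0 < n" for n
  proof -
    interpret R: prob_space "N.iid {..<n}" by (rule N.prob_space_iid)
    have C[measurable]: "avg_event n d \<in> sets (N.iid {..<n})" using sets_avg_event setsN by blast
    let ?D = "\<lambda>i. {x \<in> space (N.iid {..<n}). n * \<tau> i \<le> \<bar>(\<Sum>l<n. \<psi> i (x l)) - n * mom i r\<bar>}"
    have D: "?D i \<in> sets (N.iid {..<n})" if "i \<in> {1..k}" for i
      using measurable_\<psi>[OF that] by measurable
    have sub: "space (N.iid {..<n}) - avg_event n d \<subseteq> (\<Union>i\<in>{1..k}. ?D i)"
    proof
      fix x assume x: "x \<in> space (N.iid {..<n}) - avg_event n d"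
      then obtain i where i: "i \<in> {1..k}" "d < \<bar>(\<Sum>l<n. \<psi> i (x l)) / n - a i\<bar>"
        by (auto simp: avg_event_def spN not_le)
      have "\<bar>(\<Sum>l<n. \<psi> i (x l)) / n - a i\<bar> \<le> \<bar>(\<Sum>l<n. \<psi> i (x l)) / n - mom i r\<bar> + \<bar>mom i r - a i\<bar>" by linarith
      then have "\<tau> i \<le> \<bar>(\<Sum>l<n. \<psi> i (x l)) / n - mom i r\<bar>" using i by (simp add: \<tau>_def)
      then have "n * \<tau> i \<le> n * \<bar>(\<Sum>l<n. \<psi> i (x l)) / n - mom i r\<bar>" by (intro mult_left_mono) auto
      also have "\<dots> = \<bar>n * ((\<Sum>l<n. \<psi> i (x l)) / n - mom i r)\<bar>" by (simp add: abs_mult)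
      also have "n * ((\<Sum>l<n. \<psi> i (x l)) / n - mom i r) = (\<Sum>l<n. \<psi> i (x l)) - n * mom i r"
        using n by (simp add: right_diff_distrib)
      finally show "x \<in> (\<Union>i\<in>{1..k}. ?D i)" using i x by auto
    qed
    have "1 - measure (N.iid {..<n}) (avg_event n d) = measure (N.iid {..<n}) (space (N.iid {..<n}) - avg_event n d)"
      using R.prob_compl[OF C] by simp
    also have "\<dots> \<le> measure (N.iid {..<n}) (\<Union>i\<in>{1..k}. ?D i)" using D by (intro R.finite_measure_mono sub) auto
    also have "\<dots> \<le> (\<Sum>i\<in>{1..k}. measure (N.iid {..<n}) (?D i))" using D by (intro R.finite_measure_subadditive_finite) auto
    also have "\<dots> \<le> (\<Sum>i\<in>{1..k}. b i n)" using dev n by (intro sum_mono) auto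
    finally show ?thesis by linarith
  qed
  have "(\<lambda>n. 1 - (\<Sum>i\<in>{1..k}. b i n)) \<longlonglongrightarrow> 1 - (\<Sum>i\<in>{1..k}. 0)"
  proof (intro tendsto_diff tendsto_const tendsto_sum)
    fix i assume i: "i \<in> {1..k}"
    have "(\<lambda>n. 2 * exp (- c * real n)) \<longlonglongrightarrow> 0" if "0 < c" for c :: real using that by real_asymp
    moreover have "0 < 2 * (\<tau> i)\<^sup>2 / T\<^sup>2" using \<tau>[OF i] T(1) by simp
    ultimately show "b i \<longlonglongrightarrow> 0" unfolding b_def by blast
  qed
  then have lim: "(\<lambda>n. 1 - (\<Sum>i\<in>{1..k}. b i n)) \<longlonglongrightarrow> 1" by simp
  show ?thesis
  proof (rule tendsto_sandwich[OF _ _ lim tendsto_const])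
    show "eventually (\<lambda>n. 1 - (\<Sum>i\<in>{1..k}. b i n) \<le> measure (N.iid {..<n}) (avg_event n d)) sequentially"
      using eventually_gt_at_top[of 0] by eventually_elim (rule low)
    show "eventually (\<lambda>n. measure (N.iid {..<n}) (avg_event n d) \<le> 1) sequentially"
      by (intro always_eventually allI prob_space.prob_le_1 N.prob_space_iid)
  qed
qed

text \<open>
  The lower bound of a large deviation principle, by change of measure to a truncated density
  strictly inside the constraints, under which the event has probability close to $1$.
\<close>

lemma log_prob_lower_bound:
  fixes c :: real
  assumes d: "0 < d" and c: "rel_ent M (opt d) < c"
  shows "eventually (\<lambda>n. 0 < measure (iid {..<n}) (avg_event n d) \<and> - ln (measure (iid {..<n}) (avg_event n d)) \<le> n * c) sequentially"
proof -
  obtain q where q: "q \<in> with_moments" "\<And>i. i \<in> {1..k} \<Longrightarrow> \<bar>mom i q - a i\<bar> < d" "rel_ent M q < rel_ent M (opt d) + (c - rel_ent M (opt d))"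
    using interior_approximation[OF d, of "c - rel_ent M (opt d)"] c by auto
  then have "rel_ent M q < c" by simp
  from truncation[OF q(1,2) this] obtain r T where r: "r \<in> with_moments" "\<And>i. i \<in> {1..k} \<Longrightarrow> \<bar>mom i r - a i\<bar> < d" "rel_ent M r < c"
    and T: "0 < T" "\<And>x i. x \<in> space M \<Longrightarrow> r x \<noteq> 0 \<Longrightarrow> i \<in> {1..k} \<Longrightarrow> \<psi> i x \<le> T"
    by metis
  note rf = with_momentsD(1)[OF r(1)]
  define A where "A n = measure (PiM {..<n} (\<lambda>_. law M r)) (avg_event n d)" for n
  define P where "P n = measure (iid {..<n}) (avg_event n d)" for n
  have A: "A \<longlonglongrightarrow> 1" unfolding A_def using r(1,2) T by (rule truncated_concentration)
  have "(\<lambda>n. rel_ent M r / A n + 1 / n / A n - ln (A n) * (1 / n)) \<longlonglongrightarrow> rel_ent M r / 1 + 0 / 1 - ln 1 * 0"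
    by (intro tendsto_intros A lim_1_over_n) auto
  then have ev: "eventually (\<lambda>n. rel_ent M r / A n + 1 / n / A n - ln (A n) * (1 / n) < c) sequentially"
    using r(3) by (intro order_tendstoD(2)) auto
  have "eventually (\<lambda>n. 0 < A n) sequentially" using A by (intro order_tendstoD(1)) auto
  then show ?thesis using ev eventually_gt_at_top[of 0]
  proof eventually_elim
    case (elim n)
    from iid_event_lower_bound[OF finite_lessThan rf sets_avg_event, of n d]
    have P0: "0 < P n" and le: "A n * ln (A n / P n) \<le> n * rel_ent M r + 1"
      using elim(1) by (auto simp: A_def P_def)
    have "ln (A n) - ln (P n) \<le> (n * rel_ent M r + 1) / A n"
      using le elim(1) P0 by (simp add: ln_div pos_le_divide_eq mult.commute)
    then have "- ln (P n) \<le> n * rel_ent M r / A n + 1 / A n - ln (A n)" by (simp add: add_divide_distrib)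
    also have "\<dots> = n * (rel_ent M r / A n + 1 / n / A n - ln (A n) * (1 / n))"
      using elim(3) by (simp add: right_diff_distrib distrib_left)
    also have "\<dots> \<le> n * c" using elim(2) by (intro mult_left_mono) auto
    finally show ?case using P0 by (simp add: P_def)
  qed
qed

section \<open>Limits of the conditioned laws\<close>

text \<open>
  The common marginal of the coordinates has as its moments the conditional means of the
  empirical averages, which lie within $d$ of the $a_i$ on the event.
\<close>

lemma marginal_feas:
  assumes n: "0 < n" and P: "0 < measure (iid {..<n}) (avg_event n d)" and q: "q \<in> fin_ent M"
    and Uq: "distr (uniform_measure (iid {..<n}) (avg_event n d)) M (\<lambda>x. x 0) = law M q"
  shows "q \<in> feas d"
proof -
  define U where "U = uniform_measure (iid {..<n}) (avg_event n d)"
  interpret U: prob_space U unfolding U_def by (rule prob_space_conditioned[OF P])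
  have setsU[measurable_cong]: "sets U = sets (iid {..<n})" by (simp add: U_def)
  have AEU: "AE x in U. x \<in> avg_event n d" unfolding U_def by (rule AE_uniform_measureI) auto
  note [measurable] = fin_entD(1)[OF q]
  have Uql: "distr U M (\<lambda>x. x l) = law M q" if "l < n" for l
    using distr_coordinate_conditioned[OF sets_avg_event symmetric_avg_event that] Uq by (simp add: U_def)
  have main: "integrable M (\<lambda>x. \<psi> i x * q x) \<and> \<bar>mom i q - a i\<bar> \<le> d" if i: "i \<in> {1..k}" for i
  proof -
    note [measurable] = measurable_\<psi>[OF i]
    have bd: "AE x in U. norm (\<psi> i (x l)) \<le> n * (a i + d)" if l: "l < n" for l
      using AEU
    proof eventually_elim
      case (elim x)
      then have x: "x \<in> space (iid {..<n})" and av: "\<bar>(\<Sum>l<n. \<psi> i (x l)) / n - a i\<bar> \<le> d" using i by (auto simp: avg_event_def)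
      have xl: "x m \<in> space M" if "m < n" for m using x that by (auto simp: space_PiM)
      have "\<psi> i (x l) \<le> (\<Sum>l<n. \<psi> i (x l))" using l xl nonneg_\<psi>[OF i] by (intro member_le_sum) auto
      also have "\<dots> = n * ((\<Sum>l<n. \<psi> i (x l)) / n)" using n by simp
      also have "\<dots> \<le> n * (a i + d)" using av by (intro mult_left_mono) auto
      finally show ?case using nonneg_\<psi>[OF i xl[OF l]] by simp
    qed
    have I: "integrable U (\<lambda>x. \<psi> i (x l))" if l: "l < n" for l
      using l by (intro U.integrable_const_bound[OF bd]) auto
    have E: "(\<integral>x. \<psi> i (x l) \<partial>U) = mom i q" if l: "l < n" for l
    proof -
      have "(\<integral>x. \<psi> i (x l) \<partial>U) = (\<integral>x. \<psi> i x \<partial>distr U M (\<lambda>x. x l))" using l by (intro integral_distr[symmetric]) auto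
      also have "\<dots> = mom i q" unfolding Uql[OF l] mom_def
        by (subst integral_density) (auto simp: fin_entD(2)[OF q] mult.commute)
      finally show ?thesis .
    qed
    have "integrable (distr U M (\<lambda>x. x 0)) (\<psi> i)" using I[OF n] n by (subst integrable_distr_eq) auto
    then have "integrable M (\<lambda>x. q x * \<psi> i x)" unfolding Uql[OF n]
      by (subst (asm) integrable_density) (auto simp: fin_entD(2)[OF q])
    then have J: "integrable M (\<lambda>x. \<psi> i x * q x)" by (simp add: mult.commute)
    have IS: "integrable U (\<lambda>x. (\<Sum>l<n. \<psi> i (x l)) / n)"
      using I by (intro integrable_divide Bochner_Integration.integrable_sum) auto
    have ES: "(\<integral>x. (\<Sum>l<n. \<psi> i (x l)) / n \<partial>U) = mom i q"
    proof -
      have "(\<integral>x. (\<Sum>l<n. \<psi> i (x l)) \<partial>U) = (\<Sum>l<n. mom i q)"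
        using I E by (subst Bochner_Integration.integral_sum) auto
      then show ?thesis using n by simp
    qed
    have AEav: "AE x in U. \<bar>(\<Sum>l<n. \<psi> i (x l)) / n - a i\<bar> \<le> d"
      using AEU by eventually_elim (use i in \<open>auto simp: avg_event_def\<close>)
    have "AE x in U. (\<Sum>l<n. \<psi> i (x l)) / n \<le> a i + d" using AEav by eventually_elim linarith
    then have "mom i q \<le> a i + d" unfolding ES[symmetric] by (rule U.integral_le_const[OF IS])
    moreover have "AE x in U. a i - d \<le> (\<Sum>l<n. \<psi> i (x l)) / n" using AEav by eventually_elim linarith
    then have "a i - d \<le> mom i q" unfolding ES[symmetric] by (rule U.integral_ge_const[OF IS])
    ultimately show ?thesis using J by auto
  qed
  have kk: "k \<in> {1..k}" using k by simp
  show ?thesis using q main main[OF kk] by (auto simp: feas_def with_moments_def)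
qed

abbreviation cond_integral :: "nat \<Rightarrow> real \<Rightarrow> nat \<Rightarrow> ((nat \<Rightarrow> 'a) \<Rightarrow> real) \<Rightarrow> real" where
  "cond_integral n d j f \<equiv> (\<integral>x. f (restrict x {..<j}) \<partial>uniform_measure (iid {..<n}) (avg_event n d))"

abbreviation opt_integral :: "real \<Rightarrow> nat \<Rightarrow> ((nat \<Rightarrow> 'a) \<Rightarrow> real) \<Rightarrow> real" where
  "opt_integral d j f \<equiv> (\<integral>x. f x \<partial>PiM {..<j} (\<lambda>_. law M (opt d)))"

lemma conditional_limit_upper:
  fixes f :: "(nat \<Rightarrow> 'a) \<Rightarrow> real"
  assumes d: "0 < d" and j: "0 < j"
    and f: "f \<in> borel_measurable (iid {..<j})" and K: "\<And>x. x \<in> space (iid {..<j}) \<Longrightarrow> \<bar>f x\<bar> \<le> K"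
    and e: "0 < e"
  shows "eventually (\<lambda>n. cond_integral n d j f \<le> opt_integral d j f + e) sequentially"
proof -
  \<comment> \<open>t makes the quadratic error at most e/2\<close>
  define t where "t = min (1 / (2 * (\<bar>K\<bar> + 1))) (e / (4 * (K\<^sup>2 + 1)))"
  have K1: "0 < \<bar>K\<bar> + 1" "0 < K\<^sup>2 + 1" by (auto intro: add_nonneg_pos)
  have t: "0 < t" using e K1 by (simp add: t_def)
  have "t * K \<le> t * (\<bar>K\<bar> + 1)" using t by (intro mult_left_mono) auto
  also have "\<dots> \<le> 1 / (2 * (\<bar>K\<bar> + 1)) * (\<bar>K\<bar> + 1)" by (intro mult_right_mono) (auto simp: t_def)
  also have "\<dots> = 1 / 2" using K1 by simp
  finally have tK: "t * K \<le> 1 / 2" .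
  have "2 * t * K\<^sup>2 \<le> 2 * (e / (4 * (K\<^sup>2 + 1))) * (K\<^sup>2 + 1)"
    using t e K1 by (intro mult_mono) (auto simp: t_def)
  also have "\<dots> = e / 2"
  proof -
    have "2 * (e / (4 * s)) * s = e / 2" if "0 < s" for s using that by simp
    then show ?thesis using K1(2) by blast
  qed
  finally have tK2: "2 * t * K\<^sup>2 \<le> e / 2" .
  \<comment> \<open>the tolerance h per coordinate costs at most 2 j h / t = e/2, because n is at most 2 j m\<close>
  define h where "h = e * t / (4 * j)"
  have h: "0 < h" using e t j by (simp add: h_def)
  have feas: "opt d \<in> feas d" using opt_feas d by simp
  note pf = feasD(1)[OF feas]
  have "eventually (\<lambda>n. 0 < measure (iid {..<n}) (avg_event n d) \<and> - ln (measure (iid {..<n}) (avg_event n d)) \<le> n * (rel_ent M (opt d) + h)) sequentially"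
    using h by (intro log_prob_lower_bound[OF d]) auto
  then show ?thesis using eventually_ge_at_top[of j]
  proof eventually_elim
    case (elim n)
    define m where "m = n div j"
    have m: "0 < m" using elim j by (simp add: m_def div_greater_zero_iff)
    have mj: "m * j \<le> n" by (simp add: m_def)
    have n0: "0 < n" using elim j by simp
    have "n < m * j + j" using j by (metis m_def div_mult_mod_eq mod_less_divisor nat_add_left_cancel_less)
    moreover have "j \<le> m * j" using m by simp
    ultimately have "n \<le> 2 * (m * j)" by linarith
    then have nm: "real n \<le> 2 * real m * real j" by (metis of_nat_le_iff of_nat_mult of_nat_numeral mult.assoc)
    have P: "0 < measure (iid {..<n}) (avg_event n d)" using elim by simp
    have "cond_integral n d j f \<le> opt_integral d j f + 2 * t * K\<^sup>2
      + (- ln (measure (iid {..<n}) (avg_event n d)) - n * rel_ent M (opt d)) / (t * m)"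
    proof (rule conditional_law_upper_bound[OF pf sets_avg_event symmetric_avg_event P m j mj _ f K t tK])
      fix q e assume q: "q \<in> fin_ent M" "distr (uniform_measure (iid {..<n}) (avg_event n d)) M (\<lambda>x. x 0) = law M q"
        and e: "0 < e" "e < (1::real)"
      show "rel_ent M (opt d) \<le> rel_ent M (mix e (opt d) q)"
        using d by (intro opt_le feas_mix feas marginal_feas[OF n0 P q] e) auto
    qed
    also have "(- ln (measure (iid {..<n}) (avg_event n d)) - n * rel_ent M (opt d)) / (t * m) \<le> (n * h) / (t * m)"
      using elim t m by (intro divide_right_mono) (auto simp: algebra_simps)
    also have "(n * h) / (t * m) \<le> (2 * real m * real j * h) / (t * m)"
      using nm h t by (intro divide_right_mono mult_right_mono) auto
    also have "\<dots> = e / 2" using t m j by (simp add: h_def field_simps)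
    finally show ?case using tK2 by linarith
  qed
qed

text \<open>
  The one-sided bound above, for $f$ and for $-f$.
\<close>

theorem conditional_limit:
  fixes f :: "(nat \<Rightarrow> 'a) \<Rightarrow> real"
  assumes d: "0 < d" and j: "0 < j"
    and f[measurable]: "f \<in> borel_measurable (iid {..<j})" and K: "\<And>x. x \<in> space (iid {..<j}) \<Longrightarrow> \<bar>f x\<bar> \<le> K"
  shows "(\<lambda>n. cond_integral n d j f) \<longlonglongrightarrow> opt_integral d j f"
proof (rule tendstoI)
  fix e :: real assume e: "0 < e"
  have "eventually (\<lambda>n. cond_integral n d j f \<le> opt_integral d j f + e / 2) sequentially"
    using e by (intro conditional_limit_upper[OF d j f K]) auto
  moreover have "eventually (\<lambda>n. cond_integral n d j (\<lambda>x. - f x) \<le> opt_integral d j (\<lambda>x. - f x) + e / 2) sequentially"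
    using e by (intro conditional_limit_upper[OF d j _ , where K=K]) (auto simp: K)
  ultimately show "eventually (\<lambda>n. dist (cond_integral n d j f) (opt_integral d j f) < e) sequentially"
    by eventually_elim (use e in \<open>auto simp: dist_real_def abs_le_iff\<close>)
qed

theorem opt_integral_tendsto:
  fixes f :: "(nat \<Rightarrow> 'a) \<Rightarrow> real"
  assumes f: "f \<in> borel_measurable (iid {..<j})" and K: "\<And>x. x \<in> space (iid {..<j}) \<Longrightarrow> \<bar>f x\<bar> \<le> K"
  shows "((\<lambda>d. opt_integral d j f) \<longlongrightarrow> opt_integral 0 j f) (at_right 0)"
proof (rule LIM_zero_cancel, rule Lim_null_comparison)
  have "((\<lambda>d. K * card {..<j} * L1_dist M (opt d) (opt 0)) \<longlongrightarrow> K * card {..<j} * 0) (at_right 0)"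
    by (intro tendsto_mult_left opt_tendsto)
  then show "((\<lambda>d. K * card {..<j} * L1_dist M (opt d) (opt 0)) \<longlongrightarrow> 0) (at_right 0)" by simp
  have "eventually (\<lambda>d::real. 0 < d) (at_right 0)" by (simp add: eventually_at_right_less)
  then show "eventually (\<lambda>d. norm (opt_integral d j f - opt_integral 0 j f) \<le> K * card {..<j} * L1_dist M (opt d) (opt 0)) (at_right 0)"
  proof eventually_elim
    case (elim d)
    then show ?case unfolding real_norm_def
      using feasD(1)[OF opt_feas] by (intro PiM_density_diff_le f K) auto
  qed
qed

end

section \<open>Entropy and weak convergence on the half-line\<close>

text \<open>
  The topology on extensional functions is carried over to the full function space: composed with
  the restriction to $\{0,\dots,j-1\}$, the function $f$ is continuous on a subset of
  \<open>nat \<Rightarrow> real\<close>, where the Borel sets are those of the countable product.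
\<close>

lemma continuous_map_pos_power_measurable:
  assumes f: "continuous_map (pos_power_top j) euclideanreal f"
  shows "f \<in> borel_measurable (\<Pi>\<^sub>M i\<in>{..<j}. pos_borel)"
proof -
  let ?S = "{\<omega> :: nat \<Rightarrow> real. \<forall>i\<in>{..<j}. 0 < \<omega> i}"
  have cont: "continuous_on ?S (\<lambda>\<omega>. f (restrict \<omega> {..<j}))"
  proof -
    have "continuous_map (top_of_set ?S) (pos_power_top j) (\<lambda>\<omega>. restrict \<omega> {..<j})"
      unfolding continuous_map_componentwise
    proof (intro conjI ballI)
      show "(\<lambda>\<omega>. restrict \<omega> {..<j}) ` topspace (top_of_set ?S) \<subseteq> extensional {..<j}" by auto
      fix i assume i: "i \<in> {..<j}"
      have "continuous_on ?S (\<lambda>\<omega>. \<omega> i)" by (intro continuous_on_product_coordinates continuous_on_subset[OF continuous_on_product_coordinates]) auto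
      then show "continuous_map (top_of_set ?S) (top_of_set {0<..}) (\<lambda>\<omega>. restrict \<omega> {..<j} i)"
        using i by (auto simp: continuous_map_in_subtopology)
    qed
    from continuous_map_compose[OF this f] show ?thesis by (simp add: o_def)
  qed
  have emb: "(\<lambda>x. x) \<in> (\<Pi>\<^sub>M i\<in>{..<j}. pos_borel) \<rightarrow>\<^sub>M restrict_space borel ?S"
  proof (rule measurable_restrict_space2)
    show "(\<lambda>x. x) \<in> space (\<Pi>\<^sub>M i\<in>{..<j}. pos_borel) \<rightarrow> ?S" by (auto simp: space_PiM space_restrict_space)
    have "(\<lambda>x. x) \<in> (\<Pi>\<^sub>M i\<in>{..<j}. pos_borel) \<rightarrow>\<^sub>M (\<Pi>\<^sub>M i\<in>UNIV. borel :: real measure)"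
    proof (rule measurable_PiM_single')
      fix i :: nat
      show "(\<lambda>x. x i) \<in> (\<Pi>\<^sub>M i\<in>{..<j}. pos_borel) \<rightarrow>\<^sub>M borel"
      proof (cases "i < j")
        case True
        have "(\<lambda>x::real. x) \<in> pos_borel \<rightarrow>\<^sub>M borel" by (rule measurable_restrict_space1) simp
        with True show ?thesis by (intro measurable_compose[OF measurable_component_singleton]) auto
      next
        case False
        have "(\<lambda>x. undefined) \<in> (\<Pi>\<^sub>M i\<in>{..<j}. pos_borel) \<rightarrow>\<^sub>M (borel :: real measure)" by simp
        then show ?thesis using False by (subst measurable_cong[where g="\<lambda>x. undefined"]) (auto simp: space_PiM PiE_def extensional_def)
      qed
    qed auto
    then show "(\<lambda>x. x) \<in> (\<Pi>\<^sub>M i\<in>{..<j}. pos_borel) \<rightarrow>\<^sub>M borel"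
      by (subst (asm) measurable_cong_sets[OF refl sets_PiM_equal_borel])
  qed
  have "(\<lambda>x. f (restrict x {..<j})) \<in> borel_measurable (\<Pi>\<^sub>M i\<in>{..<j}. pos_borel)"
    using measurable_compose[OF emb borel_measurable_continuous_on_restrict[OF cont]] .
  then show ?thesis by (subst measurable_cong[where g="\<lambda>x. f (restrict x {..<j})"]) (auto simp: space_PiM PiE_def extensional_restrict)
qed

lemma ereal_diff_eq_integral:
  fixes g :: "'a \<Rightarrow> real"
  assumes g: "integrable N g"
  shows "enn2ereal (\<integral>\<^sup>+x. ennreal (g x) \<partial>N) - enn2ereal (\<integral>\<^sup>+x. ennreal (- g x) \<partial>N) = ereal (\<integral>x. g x \<partial>N)"
proof -
  have fin: "(\<integral>\<^sup>+x. ennreal (g x) \<partial>N) < \<infinity>" "(\<integral>\<^sup>+x. ennreal (- g x) \<partial>N) < \<infinity>"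
    using g by (auto simp: real_integrable_def less_top[symmetric])
  obtain u v where u: "(\<integral>\<^sup>+x. ennreal (g x) \<partial>N) = ennreal u" "0 \<le> u" and v: "(\<integral>\<^sup>+x. ennreal (- g x) \<partial>N) = ennreal v" "0 \<le> v"
    using fin by (metis ennreal_cases infinity_ennreal_def less_irrefl)
  have "(\<integral>x. g x \<partial>N) = u - v" using real_lebesgue_integral_def[OF g] u v by simp
  then show ?thesis using u v by simp
qed

lemma distr_uniform_measure:
  assumes T[measurable]: "T \<in> M \<rightarrow>\<^sub>M N" and N: "distr M N T = N" and C[measurable]: "C \<in> sets N"
  shows "distr (uniform_measure M (T -` C \<inter> space M)) N T = uniform_measure N C"
proof (rule measure_eqI)
  fix A assume "A \<in> sets (distr (uniform_measure M (T -` C \<inter> space M)) N T)"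
  then have A[measurable]: "A \<in> sets N" by simp
  have NM: "emeasure N B = emeasure M (T -` B \<inter> space M)" if "B \<in> sets N" for B
    using that by (subst N[symmetric]) (rule emeasure_distr[OF T])
  have "emeasure (distr (uniform_measure M (T -` C \<inter> space M)) N T) A = emeasure (uniform_measure M (T -` C \<inter> space M)) (T -` A \<inter> space M)"
    by (subst emeasure_distr) auto
  also have "\<dots> = emeasure M ((T -` C \<inter> space M) \<inter> (T -` A \<inter> space M)) / emeasure M (T -` C \<inter> space M)"
    by (rule emeasure_uniform_measure) auto
  also have "(T -` C \<inter> space M) \<inter> (T -` A \<inter> space M) = T -` (C \<inter> A) \<inter> space M" by auto
  also have "emeasure M \<dots> / emeasure M (T -` C \<inter> space M) = emeasure (uniform_measure N C) A"
    by (simp add: NM emeasure_uniform_measure)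
  finally show "emeasure (distr (uniform_measure M (T -` C \<inter> space M)) N T) A = emeasure (uniform_measure N C) A" .
qed simp

lemma space_pos_lborel: "space pos_lborel = {0<..}" by (simp add: space_restrict_space)

lemma sets_pos_lborel: "sets pos_lborel = sets pos_borel" by (simp add: sets_restrict_space)

lemma sigma_finite_pos_lborel: "sigma_finite_measure pos_lborel"
  by (intro sigma_finite_measure_restrict_space sigma_finite_lborel) auto

lemma emeasure_pos_lborel_Icc:
  "0 < x \<Longrightarrow> x \<le> y \<Longrightarrow> {x..y} \<in> sets pos_lborel \<and> emeasure pos_lborel {x..y} = ennreal (y - x)"
  by (subst emeasure_restrict_space) (auto simp: sets_restrict_space_iff)

lemma diff_entropy_density:
  assumes f[measurable]: "f \<in> borel_measurable pos_lborel" and f0: "\<And>x. 0 \<le> f x"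
    and \<mu>: "\<mu> = law pos_lborel f"
  shows "diff_entropy \<mu> = - (enn2ereal (\<integral>\<^sup>+x. ennreal (f x * ln (f x)) \<partial>pos_lborel)
               - enn2ereal (\<integral>\<^sup>+x. ennreal (- (f x * ln (f x))) \<partial>pos_lborel))"
proof -
  interpret sigma_finite_measure pos_lborel by (rule sigma_finite_pos_lborel)
  have ac: "absolutely_continuous pos_lborel \<mu>" unfolding \<mu>
    by (intro absolutely_continuousI_density) simp
  have "AE x in pos_lborel. ennreal (f x) = RN_deriv pos_lborel \<mu> x" unfolding \<mu> by (rule RN_deriv_unique) auto
  then have eq: "AE x in pos_lborel. enn2real (RN_deriv pos_lborel \<mu> x) = f x"
    by eventually_elim (metis enn2real_ennreal f0)
  have "(\<integral>\<^sup>+x. ennreal (enn2real (RN_deriv pos_lborel \<mu> x) * ln (enn2real (RN_deriv pos_lborel \<mu> x))) \<partial>pos_lborel) = (\<integral>\<^sup>+x. ennreal (f x * ln (f x)) \<partial>pos_lborel)"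
    "(\<integral>\<^sup>+x. ennreal (- (enn2real (RN_deriv pos_lborel \<mu> x) * ln (enn2real (RN_deriv pos_lborel \<mu> x)))) \<partial>pos_lborel) = (\<integral>\<^sup>+x. ennreal (- (f x * ln (f x))) \<partial>pos_lborel)"
    using eq by (auto intro!: nn_integral_cong_AE elim!: eventually_mono)
  then show ?thesis using ac by (simp add: diff_entropy_def Let_def)
qed

lemma finite_entropy_density:
  assumes \<mu>: "\<mu> \<in> M1_pos" "diff_entropy \<mu> \<noteq> - \<infinity>"
  obtains f where "f \<in> borel_measurable pos_lborel" "\<And>x. 0 \<le> f x" "\<mu> = law pos_lborel f"
    "(\<integral>\<^sup>+x. ennreal (f x * ln (f x)) \<partial>pos_lborel) < \<infinity>"
proof -
  interpret sigma_finite_measure pos_lborel by (rule sigma_finite_pos_lborel)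
  have sets: "sets \<mu> = sets pos_lborel" and p: "prob_space \<mu>" using \<mu>(1) by (auto simp: space_prob_algebra sets_pos_lborel)
  interpret \<mu>: prob_space \<mu> by (rule p)
  have ac: "absolutely_continuous pos_lborel \<mu>" using \<mu>(2) by (auto simp: diff_entropy_def split: if_splits)
  obtain D where D: "D \<in> borel_measurable pos_lborel" "AE x in pos_lborel. RN_deriv pos_lborel \<mu> x = ennreal (D x)" "AE x in \<mu>. 0 < D x" "\<And>x. 0 \<le> D x"
    using real_RN_deriv[OF \<mu>.finite_measure_axioms ac sets] by blast
  have "\<mu> = density pos_lborel (RN_deriv pos_lborel \<mu>)" using density_RN_deriv[OF ac sets] by simp
  also have "\<dots> = law pos_lborel D" using D by (intro density_cong) auto
  finally have eq: "\<mu> = law pos_lborel D" .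
  have "(\<integral>\<^sup>+x. ennreal (D x * ln (D x)) \<partial>pos_lborel) < \<infinity>"
  proof (rule ccontr)
    assume "\<not> ?thesis"
    then have "(\<integral>\<^sup>+x. ennreal (D x * ln (D x)) \<partial>pos_lborel) = \<infinity>" by (simp add: less_top[symmetric])
    then show False using \<mu>(2) diff_entropy_density[OF D(1,4) eq] by simp
  qed
  with that[OF D(1,4) eq] show thesis .
qed

section \<open>The reference measure\<close>

lemma emeasure_density_space:
  "f \<in> borel_measurable N \<Longrightarrow> emeasure (density N f) (space N) = (\<integral>\<^sup>+x. f x \<partial>N)"
  by (simp add: emeasure_density cong: nn_integral_cong)

lemma superlinear_excursion_cost:
  fixes c p m e :: real
  assumes "0 < p" "p < 1" "0 < e" "0 < m"
  shows "eventually (\<lambda>L. (L + 1) powr p + c + m * ln (L + 1) \<le> e * L) at_top"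
proof -
  have "((\<lambda>L. ((L + 1) powr p + c + m * ln (L + 1)) / L) \<longlongrightarrow> 0) at_top"
    using assms by real_asymp
  then have "eventually (\<lambda>L. ((L + 1) powr p + c + m * ln (L + 1)) / L < e) at_top"
    using assms by (intro order_tendstoD(2)) auto
  then show ?thesis using eventually_gt_at_top[of 0]
    by eventually_elim (simp add: field_simps)
qed

locale microcanonical =
  fixes k :: nat and \<phi> :: "nat \<Rightarrow> real \<Rightarrow> real" and a :: "nat \<Rightarrow> real"
  assumes k: "k \<ge> 2"
    and pos: "\<forall>i\<in>{1..k}. \<forall>x>0. \<phi> i x > 0"
    and C1: "\<forall>i\<in>{1..k}. \<phi> i C1_differentiable_on {0<..} \<and> mono_on {0<..} (\<phi> i) \<and>
               filterlim (\<phi> i) at_top at_top"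
    and C2: "\<forall>i\<in>{1..k}. \<forall>c::real. c > 0 \<longrightarrow>
               (\<integral>\<^sup>+x. ennreal (exp (- c * \<phi> i x)) \<partial>pos_lborel) < \<infinity>"
    and C3: "\<exists>\<kappa>::real. \<kappa> > 1 \<and>
               (\<forall>i\<in>{1..<k}. \<forall>\<^sub>F x in at_top. \<phi> i x powr \<kappa> < \<phi> (i + 1) x)"
    and C4: "\<exists>C M::real. C > 0 \<and> M > 0 \<and>
               (\<forall>x>C. \<forall>i\<in>{1..k}. 1 / C * \<phi> i x powr (- M) < deriv (\<phi> i) x \<and>
                                 deriv (\<phi> i) x < C * \<phi> i x powr M)"
    and a: "a \<in> admissible k \<phi>"
begin

definition Z :: real where "Z = (\<integral>x. exp (- \<phi> 1 x) \<partial>pos_lborel)"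

definition w :: "real \<Rightarrow> real" where "w x = exp (- \<phi> 1 x) / Z"

abbreviation M :: "real measure" where "M \<equiv> ref_measure \<phi>"

lemma one_k: "1 \<in> {1..k}" "k \<in> {1..k}" "1 \<in> {1..<k}" using k by auto

lemma \<phi>_continuous: "i \<in> {1..k} \<Longrightarrow> continuous_on {0<..} (\<phi> i)"
  using C1 by (auto intro: C1_differentiable_imp_continuous_on)

lemma \<phi>_mono: "i \<in> {1..k} \<Longrightarrow> 0 < x \<Longrightarrow> x \<le> y \<Longrightarrow> \<phi> i x \<le> \<phi> i y"
  using C1 by (auto simp: mono_on_def)

lemma \<phi>_nonneg: "i \<in> {1..k} \<Longrightarrow> 0 < x \<Longrightarrow> 0 \<le> \<phi> i x"
  using pos by (simp add: less_imp_le)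

lemma \<phi>_measurable[measurable]: "i \<in> {1..k} \<Longrightarrow> \<phi> i \<in> borel_measurable pos_lborel"
  using borel_measurable_continuous_on_restrict[OF \<phi>_continuous] by (simp add: measurable_cong_sets[OF sets_pos_lborel refl])

lemma \<phi>1_measurable[measurable]: "\<phi> 1 \<in> borel_measurable pos_lborel" using one_k by measurable

lemma \<phi>1_measurable'[measurable]: "\<phi> (Suc 0) \<in> borel_measurable pos_lborel" using \<phi>1_measurable by simp

lemma integrable_exp: "integrable pos_lborel (\<lambda>x. exp (- \<phi> 1 x))"
  using C2[rule_format, OF one_k(1), of 1] by (intro integrableI_nonneg) auto

lemma Z_pos: "0 < Z"
proof -
  have "0 \<le> Z" by (simp add: Z_def)
  moreover have "Z \<noteq> 0"
  proof
    assume "Z = 0"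
    then have "AE x in pos_lborel. exp (- \<phi> 1 x) = 0"
      unfolding Z_def by (subst (asm) integral_nonneg_eq_0_iff_AE[OF integrable_exp]) auto
    then have AE: "AE x in pos_lborel. False" by simp
    have "emeasure pos_lborel {x \<in> space pos_lborel. x \<in> {1..2}} = 0"
      by (rule emeasure_eq_0_AE) (use AE in \<open>auto elim: eventually_mono\<close>)
    moreover have "{x \<in> space pos_lborel. x \<in> {1..2}} = {1..2}" by (auto simp: space_pos_lborel)
    ultimately show False using emeasure_pos_lborel_Icc[of 1 2] by simp
  qed
  ultimately show ?thesis by simp
qed

lemma w_pos: "0 < w x" using Z_pos by (simp add: w_def)

lemma ln_w: "ln (w x) = - \<phi> 1 x - ln Z" using Z_pos by (simp add: w_def ln_div)

lemma w_measurable[measurable]: "w \<in> borel_measurable pos_lborel" unfolding w_def by measurable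

lemma w_integrable: "integrable pos_lborel w" and w_integral: "(\<integral>x. w x \<partial>pos_lborel) = 1"
  using integrable_exp Z_pos unfolding w_def Z_def by simp_all

lemma M_eq: "M = law pos_lborel w"
  by (simp add: ref_measure_def Let_def w_def Z_def)

lemma sets_M[measurable_cong]: "sets M = sets pos_lborel" by (simp add: M_eq)

lemma space_M: "space M = {0<..}" using sets_eq_imp_space_eq[OF sets_M] space_pos_lborel by simp

lemma prob_space_M: "prob_space M"
proof
  have "(\<integral>\<^sup>+x. ennreal (w x) \<partial>pos_lborel) = ennreal 1"
    using nn_integral_eq_integral[OF w_integrable] w_pos w_integral by (simp add: less_imp_le)
  then show "emeasure M (space M) = 1" unfolding M_eq space_density by (subst emeasure_density_space) auto
qed

sublocale M: prob_space M by (rule prob_space_M)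

lemma density_M:
  assumes [measurable]: "q \<in> borel_measurable pos_lborel"
  shows "law M q = density pos_lborel (\<lambda>x. ennreal (w x * q x))"
  unfolding M_eq using w_pos by (subst density_density_eq) (auto simp: ennreal_mult' less_imp_le)

lemma integrable_M: "g \<in> borel_measurable pos_lborel \<Longrightarrow> integrable M g \<longleftrightarrow> integrable pos_lborel (\<lambda>x. w x * g x :: real)"
  unfolding M_eq using w_pos by (subst integrable_density) (auto simp: less_imp_le)

lemma integral_M: "g \<in> borel_measurable pos_lborel \<Longrightarrow> (\<integral>x. g x \<partial>M) = (\<integral>x. w x * g x \<partial>pos_lborel)" for g :: "real \<Rightarrow> real"
  unfolding M_eq using w_pos by (subst integral_density) (auto simp: less_imp_le)

text \<open>
  Change of reference measure from \<open>dx\<close> to \<open>w dx\<close>, where $\ln w = - \phi_1 - \ln Z$.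
\<close>

lemma xlnx_w: "0 \<le> q \<Longrightarrow> w x * (q * ln q) = (w x * q) * ln (w x * q) + w x * (\<phi> 1 x * q) + ln Z * (w x * q)"
  using w_pos[of x] by (cases "q = 0") (auto simp: ln_mult ln_w algebra_simps)

text \<open>
  When the $\phi_1$-moment is prescribed, maximal differential entropy is minimal relative
  entropy with respect to the reference law.
\<close>

lemma entropy_density_M:
  assumes q: "q \<in> fin_ent M" and I: "integrable M (\<lambda>x. \<phi> 1 x * q x)"
  shows "diff_entropy (law M q) = ereal ((\<integral>x. \<phi> 1 x * q x \<partial>M) + ln Z - rel_ent M q)"
proof -
  have [measurable]: "q \<in> borel_measurable pos_lborel" using fin_entD(1)[OF q] by (simp add: measurable_cong_sets[OF sets_M refl])
  let ?f = "\<lambda>x. w x * q x"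
  have I1: "integrable pos_lborel (\<lambda>x. w x * (\<phi> 1 x * q x))" using I by (subst (asm) integrable_M) auto
  have I2: "integrable pos_lborel ?f" using fin_entD(3)[OF q] by (subst (asm) integrable_M) auto
  have I3: "integrable pos_lborel (\<lambda>x. w x * (q x * ln (q x)))" using fin_entD(5)[OF q] by (subst (asm) integrable_M) auto
  have eq: "?f x * ln (?f x) = w x * (q x * ln (q x)) - w x * (\<phi> 1 x * q x) - ln Z * ?f x" for x
    using xlnx_w[of "q x" x] fin_entD(2)[OF q] by simp
  have If: "integrable pos_lborel (\<lambda>x. ?f x * ln (?f x))" unfolding eq using I1 I2 I3 by simp
  have "(\<integral>x. ?f x \<partial>pos_lborel) = 1" using fin_entD(4)[OF q] by (subst (asm) integral_M) auto
  then have "(\<integral>x. ?f x * ln (?f x) \<partial>pos_lborel) = rel_ent M q - (\<integral>x. \<phi> 1 x * q x \<partial>M) - ln Z"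
    unfolding eq rel_ent_def using I1 I2 I3 by (simp add: integral_M)
  moreover have "diff_entropy (law M q) = - ereal (\<integral>x. ?f x * ln (?f x) \<partial>pos_lborel)"
    using fin_entD(2)[OF q] w_pos ereal_diff_eq_integral[OF If]
    by (subst diff_entropy_density[of ?f]) (auto simp: density_M less_imp_le)
  ultimately show ?thesis by simp
qed

lemma moment_density_M:
  assumes q: "q \<in> fin_ent M" and i: "i \<in> {1..k}"
  shows "moment (\<phi> i) (law M q) = (\<integral>\<^sup>+x. ennreal (\<phi> i x * q x) \<partial>M)"
proof -
  note [measurable] = fin_entD(1)[OF q] \<phi>_measurable[OF i]
  have "moment (\<phi> i) (law M q) = (\<integral>\<^sup>+x. ennreal (q x) * ennreal (\<phi> i x) \<partial>M)"
    unfolding moment_def by (subst nn_integral_density) auto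
  also have "\<dots> = (\<integral>\<^sup>+x. ennreal (\<phi> i x * q x) \<partial>M)"
    using fin_entD(2)[OF q] \<phi>_nonneg[OF i] by (intro nn_integral_cong) (auto simp: space_M ennreal_mult mult.commute)
  finally show ?thesis .
qed

lemma moment_finite:
  assumes q: "q \<in> fin_ent M" and i: "i \<in> {1..k}" and fin: "moment (\<phi> i) (law M q) < \<infinity>"
  shows "integrable M (\<lambda>x. \<phi> i x * q x)"
proof -
  note [measurable] = fin_entD(1)[OF q] \<phi>_measurable[OF i]
  have "AE x in M. 0 \<le> \<phi> i x * q x"
    using \<phi>_nonneg[OF i] fin_entD(2)[OF q] by (intro AE_I2) (auto simp: space_M)
  then show ?thesis using fin moment_density_M[OF q i] by (intro integrableI_nonneg) auto
qed

lemma moment_eq_integral: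
  assumes q: "q \<in> fin_ent M" and i: "i \<in> {1..k}" and I: "integrable M (\<lambda>x. \<phi> i x * q x)"
  shows "moment (\<phi> i) (law M q) = ennreal (\<integral>x. \<phi> i x * q x \<partial>M)"
    and "0 \<le> (\<integral>x. \<phi> i x * q x \<partial>M)"
proof -
  have nn: "AE x in M. 0 \<le> \<phi> i x * q x"
    using \<phi>_nonneg[OF i] fin_entD(2)[OF q] by (intro AE_I2) (auto simp: space_M)
  show "moment (\<phi> i) (law M q) = ennreal (\<integral>x. \<phi> i x * q x \<partial>M)"
    unfolding moment_density_M[OF q i] by (rule nn_integral_eq_integral[OF I nn])
  show "0 \<le> (\<integral>x. \<phi> i x * q x \<partial>M)" by (rule integral_nonneg_AE[OF nn])
qed

text \<open>
  Finite entropy bounds the positive part of $f \ln f$.  Its negative part is at most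
  $w + f \phi_1 + |\ln Z| f$, because $x \ln x \ge -1$ for the density $x = f/w$ relative to the
  reference law.
\<close>

lemma density_of_finite_entropy:
  assumes \<mu>: "\<mu> \<in> M1_pos" "diff_entropy \<mu> \<noteq> - \<infinity>" and m1: "moment (\<phi> 1) \<mu> < \<infinity>"
  obtains q where "q \<in> fin_ent M" "\<mu> = law M q"
proof -
  obtain f where f[measurable]: "f \<in> borel_measurable pos_lborel" and f0: "\<And>x. 0 \<le> f x" and \<mu>f: "\<mu> = law pos_lborel f"
    and fin: "(\<integral>\<^sup>+x. ennreal (f x * ln (f x)) \<partial>pos_lborel) < \<infinity>"
    using finite_entropy_density[OF \<mu>] by blast
  interpret \<mu>: prob_space \<mu> using \<mu>(1) by (simp add: space_prob_algebra)
  define q where "q x = f x / w x" for x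
  have [measurable]: "q \<in> borel_measurable pos_lborel" unfolding q_def by measurable
  have q0: "0 \<le> q x" for x using f0 w_pos[of x] by (simp add: q_def)
  have wq: "w x * q x = f x" for x using w_pos[of x] by (simp add: q_def)
  have eq: "\<mu> = law M q" by (simp add: density_M wq \<mu>f)
  have "(\<integral>\<^sup>+x. ennreal (f x) \<partial>pos_lborel) = 1"
    using \<mu>.emeasure_space_1 unfolding \<mu>f space_density by (subst (asm) emeasure_density_space) auto
  then have fI: "integrable pos_lborel f" and f1: "(\<integral>x. f x \<partial>pos_lborel) = 1"
    using f0 by (auto intro!: integrableI_nonneg simp: integral_eq_nn_integral)
  have "(\<integral>\<^sup>+x. ennreal (f x * \<phi> 1 x) \<partial>pos_lborel) < \<infinity>"
    using m1 unfolding moment_def \<mu>f by (subst (asm) nn_integral_density) (auto simp: ennreal_mult' f0)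
  moreover have "AE x in pos_lborel. 0 \<le> f x * \<phi> 1 x" using \<phi>_nonneg[OF one_k(1)] f0 by (intro AE_I2) (auto simp: space_pos_lborel)
  ultimately have f\<phi>: "integrable pos_lborel (\<lambda>x. f x * \<phi> 1 x)" by (intro integrableI_nonneg) auto
  have wlnq: "w x * (q x * ln (q x)) = f x * ln (f x) + f x * \<phi> 1 x + ln Z * f x" for x
    using xlnx_w[OF q0, of x x] by (simp add: wq[symmetric] algebra_simps)
  have fln: "integrable pos_lborel (\<lambda>x. f x * ln (f x))"
    unfolding real_integrable_def
  proof (intro conjI)
    let ?g = "\<lambda>x. w x + f x * \<phi> 1 x + \<bar>ln Z\<bar> * f x"
    have gI: "integrable pos_lborel ?g" using w_integrable f\<phi> fI by simp
    have "(\<integral>\<^sup>+x. ennreal (- (f x * ln (f x))) \<partial>pos_lborel) \<le> (\<integral>\<^sup>+x. ennreal (?g x) \<partial>pos_lborel)"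
    proof (intro nn_integral_mono ennreal_leI)
      fix x
      have "w x * (- 1) \<le> w x * (q x * ln (q x))" using xlnx_ge[OF q0] w_pos[of x] by (intro mult_left_mono) auto
      moreover have "ln Z * f x \<le> \<bar>ln Z\<bar> * f x" using f0 by (intro mult_right_mono) auto
      ultimately show "- (f x * ln (f x)) \<le> ?g x" using wlnq[of x] by linarith
    qed
    also have "\<dots> < \<infinity>"
      using gI by (simp add: real_integrable_def less_top[symmetric])
    finally show "(\<integral>\<^sup>+x. ennreal (- (f x * ln (f x))) \<partial>pos_lborel) \<noteq> \<infinity>" by simp
  qed (use fin in auto)
  have "integrable M (\<lambda>x. q x * ln (q x))"
    unfolding integrable_M[of "\<lambda>x. q x * ln (q x)", simplified] wlnq using fln f\<phi> fI by simp
  moreover have "integrable M q" "(\<integral>x. q x \<partial>M) = 1" using fI f1 by (simp_all add: integrable_M integral_M wq)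
  ultimately have "q \<in> fin_ent M" using q0 by (intro fin_entI) auto
  then show thesis using eq that by blast
qed

section \<open>Excursions and feasibility\<close>

text \<open>
  The gap between consecutive functions gives the gap to the last one, since
  $\phi_{i+1} \le \phi_k$ eventually.
\<close>

lemma power_gap: "\<exists>\<kappa>>1. \<forall>i\<in>{1..<k}. eventually (\<lambda>x. \<phi> i x powr \<kappa> \<le> \<phi> k x \<and> 1 \<le> \<phi> i x) at_top"
proof -
  obtain \<kappa> where \<kappa>: "\<kappa> > 1" "\<And>i. i \<in> {1..<k} \<Longrightarrow> eventually (\<lambda>x. \<phi> i x powr \<kappa> < \<phi> (i + 1) x) at_top"
    using C3 by auto
  have one: "eventually (\<lambda>x. 1 \<le> \<phi> i x) at_top" if "i \<in> {1..k}" for i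
    using C1 that by (auto simp: filterlim_at_top)
  have next_le: "eventually (\<lambda>x. \<phi> i x \<le> \<phi> (i + 1) x) at_top" if i: "i \<in> {1..<k}" for i
  proof -
    have "i \<in> {1..k}" using i by auto
    from \<kappa>(2)[OF i] one[OF this] show ?thesis
    proof eventually_elim
      case (elim x)
      have "\<phi> i x powr 1 \<le> \<phi> i x powr \<kappa>" using elim \<kappa>(1) by (intro powr_mono) auto
      then show ?case using elim by simp
    qed
  qed
  have le: "eventually (\<lambda>x. \<phi> i x \<le> \<phi> k x) at_top" if i: "1 \<le> i" "i \<le> k" for i
    using i(2)
  proof (induction rule: inc_induct)
    case (step n)
    then have "n \<in> {1..<k}" using i(1) by auto
    from next_le[OF this] step.IH show ?case by eventually_elim simp
  qed simp
  have "eventually (\<lambda>x. \<phi> i x powr \<kappa> \<le> \<phi> k x \<and> 1 \<le> \<phi> i x) at_top" if i: "i \<in> {1..<k}" for i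
  proof -
    have 1: "eventually (\<lambda>x. \<phi> (i + 1) x \<le> \<phi> k x) at_top" using i by (intro le) auto
    have 2: "eventually (\<lambda>x. 1 \<le> \<phi> i x) at_top" using i by (intro one) auto
    show ?thesis using \<kappa>(2)[OF i] 1 2 by eventually_elim auto
  qed
  then show ?thesis using \<kappa>(1) by blast
qed

text \<open>
  Far out $\phi_k \ge \phi_i^\kappa = \phi_i \cdot \phi_i^{\kappa - 1}$ with the last factor
  tending to infinity; elsewhere monotonicity bounds $\phi_i$.
\<close>

lemma lower_moments_dominated:
  assumes i: "i \<in> {1..<k}" and e: "0 < e"
  shows "\<exists>B\<ge>0. \<forall>x\<in>space M. \<phi> i x \<le> e * \<phi> k x + B"
proof -
  have ik: "i \<in> {1..k}" using i by auto
  obtain \<kappa> where \<kappa>: "\<kappa> > 1" "eventually (\<lambda>x. \<phi> i x powr \<kappa> \<le> \<phi> k x \<and> 1 \<le> \<phi> i x) at_top"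
    using power_gap i by blast
  have "filterlim (\<lambda>y::real. y powr (\<kappa> - 1)) at_top at_top" using \<kappa>(1) by real_asymp
  then have "filterlim (\<lambda>x. \<phi> i x powr (\<kappa> - 1)) at_top at_top"
    by (rule filterlim_compose) (use C1 ik in blast)
  then have "eventually (\<lambda>x. 1 / e \<le> \<phi> i x powr (\<kappa> - 1)) at_top" by (auto simp: filterlim_at_top)
  with \<kappa>(2) have "eventually (\<lambda>x. \<phi> i x \<le> e * \<phi> k x) at_top"
  proof eventually_elim
    case (elim x)
    have "\<phi> i x \<le> e * (1 / e) * \<phi> i x" using e by simp
    also have "\<dots> \<le> e * (\<phi> i x powr (\<kappa> - 1)) * \<phi> i x" using elim e by (intro mult_right_mono mult_left_mono) auto
    also have "\<dots> = e * (\<phi> i x powr (\<kappa> - 1) * \<phi> i x powr 1)" using elim by simp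
    also have "\<dots> = e * \<phi> i x powr \<kappa>" by (simp only: powr_add[symmetric]) simp
    also have "\<dots> \<le> e * \<phi> k x" using elim e by (intro mult_left_mono) auto
    finally show ?case .
  qed
  then obtain x0 where x0: "\<And>x. x \<ge> x0 \<Longrightarrow> \<phi> i x \<le> e * \<phi> k x" by (auto simp: eventually_at_top_linorder)
  define x1 where "x1 = max x0 1"
  have "\<phi> i x \<le> e * \<phi> k x + \<phi> i x1" if x: "0 < x" for x
  proof (cases "x \<ge> x1")
    case True
    then have "x0 \<le> x" "0 < x1" by (auto simp: x1_def)
    then show ?thesis using x0[of x] \<phi>_nonneg[OF ik, of x1] by linarith
  next
    case False
    then have "\<phi> i x \<le> \<phi> i x1" using \<phi>_mono[OF ik x, of x1] by simp
    then show ?thesis using \<phi>_nonneg[OF one_k(2) x] e by (meson add_increasing mult_nonneg_nonneg less_imp_le)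
  qed
  then show ?thesis using \<phi>_nonneg[OF ik, of x1] by (intro exI[of _ "\<phi> i x1"]) (auto simp: space_M x1_def)
qed

text \<open>
  The interval on which $\phi_k$ increases from $L$ to $L+1$ is an excursion.  On it the lower
  functions are at most $(L+1)^{1/\kappa} = o(L)$, in particular $\phi_1$, and its length is at
  least a negative power of $L$ because $\phi_k' \le C \phi_k^m$.  Hence its probability is
  $e^{-o(L)}$.
\<close>

lemma cheap_excursion:
  assumes e: "0 < e"
  shows "\<exists>L B. 1 / e \<le> L \<and> B \<in> sets M \<and> 0 < M.prob B \<and> - ln (M.prob B) \<le> e * L \<and>
      (\<forall>x\<in>B. L \<le> \<phi> k x \<and> \<phi> k x \<le> L + 1 \<and> (\<forall>i\<in>{1..<k}. \<phi> i x \<le> e * L))"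
proof -
  obtain \<kappa> where \<kappa>: "\<kappa> > 1" "\<And>i. i \<in> {1..<k} \<Longrightarrow> eventually (\<lambda>x. \<phi> i x powr \<kappa> \<le> \<phi> k x \<and> 1 \<le> \<phi> i x) at_top"
    using power_gap by blast
  obtain C m where C: "C > 0" "m > 0" "\<And>x. x > C \<Longrightarrow> deriv (\<phi> k) x < C * \<phi> k x powr m"
    using C4 one_k(2) by blast
  have "eventually (\<lambda>x. \<forall>i\<in>{1..<k}. \<phi> i x powr \<kappa> \<le> \<phi> k x \<and> 1 \<le> \<phi> i x) at_top"
    using \<kappa>(2) by (intro eventually_ball_finite) auto
  then obtain x0 where x0: "\<And>x i. x \<ge> x0 \<Longrightarrow> i \<in> {1..<k} \<Longrightarrow> \<phi> i x powr \<kappa> \<le> \<phi> k x \<and> 1 \<le> \<phi> i x"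
    unfolding eventually_at_top_linorder by blast
  define y where "y = max x0 (C + 1)"
  have y: "y \<ge> x0" "y > C" "y > 0" using C(1) by (auto simp: y_def)
  define p where "p = 1 / \<kappa>"
  have p: "0 < p" "p < 1" using \<kappa>(1) by (auto simp: p_def)
  have "eventually (\<lambda>L. (L + 1) powr p + (\<bar>ln Z\<bar> + \<bar>ln C\<bar>) + m * ln (L + 1) \<le> e * L) at_top"
    using p e C(2) by (intro superlinear_excursion_cost)
  moreover have "eventually (\<lambda>L. max 1 (max (1 / e) (\<phi> k y)) \<le> L) at_top" by (rule eventually_ge_at_top)
  ultimately have "eventually (\<lambda>L. (L + 1) powr p + (\<bar>ln Z\<bar> + \<bar>ln C\<bar>) + m * ln (L + 1) \<le> e * L \<and> max 1 (max (1 / e) (\<phi> k y)) \<le> L) at_top"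
    by eventually_elim auto
  then obtain L where L: "(L + 1) powr p + (\<bar>ln Z\<bar> + \<bar>ln C\<bar>) + m * ln (L + 1) \<le> e * L" "1 \<le> L" "1 / e \<le> L" "\<phi> k y \<le> L"
    by (auto simp: eventually_at_top_linorder)
  have top: "filterlim (\<phi> k) at_top at_top" using C1 one_k(2) by blast
  then have "eventually (\<lambda>x. L + 1 \<le> \<phi> k x) at_top" by (auto simp: filterlim_at_top)
  then obtain N where N: "\<And>x. x \<ge> N \<Longrightarrow> L + 1 \<le> \<phi> k x" by (auto simp: eventually_at_top_linorder)
  define b where "b = max N y"
  have b: "L + 1 \<le> \<phi> k b" "y \<le> b" using N[of b] by (auto simp: b_def)
  have cont: "continuous_on {u..v} (\<phi> k)" if "0 < u" for u v
    using \<phi>_continuous[OF one_k(2)] by (rule continuous_on_subset) (use that in auto)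
  obtain x1 where x1: "y \<le> x1" "x1 \<le> b" "\<phi> k x1 = L"
    using IVT'[of "\<phi> k" y L b] L(4) b cont[OF y(3)] by auto
  obtain x2 where x2: "x1 \<le> x2" "x2 \<le> b" "\<phi> k x2 = L + 1"
    using IVT'[of "\<phi> k" x1 "L + 1" b] x1 b cont[of x1] y(3) by auto
  have x12: "x1 < x2" using x1 x2 by (cases "x1 = x2") auto
  define B where "B = {x1..x2}"
  have B: "B \<in> sets M" "emeasure pos_lborel B = ennreal (x2 - x1)"
    using emeasure_pos_lborel_Icc[of x1 x2] x12 x1 y by (auto simp: B_def sets_M)
  have Bk: "L \<le> \<phi> k x" "\<phi> k x \<le> L + 1" and x0B: "0 < x" "x0 \<le> x" "C < x" if "x \<in> B" for x
  proof -
    show *: "0 < x" "x0 \<le> x" "C < x" using that x1 y by (auto simp: B_def)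
    show "L \<le> \<phi> k x" "\<phi> k x \<le> L + 1"
      using \<phi>_mono[OF one_k(2), of x1 x] \<phi>_mono[OF one_k(2) *(1), of x2] that x1 x2 y by (auto simp: B_def)
  qed
  have Bi: "\<phi> i x \<le> (L + 1) powr p" if x: "x \<in> B" and i: "i \<in> {1..<k}" for x i
  proof -
    have "\<phi> i x = (\<phi> i x powr \<kappa>) powr p" using x0[OF x0B(2)[OF x] i] \<kappa>(1) by (simp add: powr_powr p_def)
    also have "\<dots> \<le> (L + 1) powr p" using x0[OF x0B(2)[OF x] i] Bk[OF x] p by (intro powr_mono2) auto
    finally show ?thesis .
  qed
  \<comment> \<open>the mean value theorem turns the upper bound on the derivative into a lower bound on the length of B\<close>
  have len: "1 \<le> C * (L + 1) powr m * (x2 - x1)"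
  proof -
    have "\<exists>z>x1. z < x2 \<and> \<phi> k x2 - \<phi> k x1 = (x2 - x1) * deriv (\<phi> k) z"
    proof (rule MVT2[OF x12])
      fix z assume "x1 \<le> z" "z \<le> x2"
      then have "z \<in> {0<..}" using x1 y by auto
      then have "\<phi> k differentiable at z" using C1 one_k(2) by (auto simp: C1_differentiable_on_eq)
      then show "(\<phi> k has_real_derivative deriv (\<phi> k) z) (at z)"
        by (metis DERIV_imp_deriv real_differentiable_def)
    qed
    then obtain z where z: "x1 < z" "z < x2" "1 = (x2 - x1) * deriv (\<phi> k) z" using x1 x2 by auto
    have zB: "z \<in> B" using z by (simp add: B_def)
    have "deriv (\<phi> k) z \<le> C * \<phi> k z powr m" using C(3)[OF x0B(3)[OF zB]] by simp
    also have "\<dots> \<le> C * (L + 1) powr m" using C Bk[OF zB] L(2) by (intro mult_left_mono powr_mono2) auto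
    finally have "(x2 - x1) * deriv (\<phi> k) z \<le> (x2 - x1) * (C * (L + 1) powr m)" using x12 by (intro mult_left_mono) auto
    then show ?thesis using z by (simp add: mult.commute)
  qed
  define l where "l = exp (- ((L + 1) powr p)) / Z * (x2 - x1)"
  have l0: "0 < l" using Z_pos x12 by (simp add: l_def)
  have "ennreal l = (\<integral>\<^sup>+x. ennreal (exp (- ((L + 1) powr p)) / Z) * indicator B x \<partial>pos_lborel)"
  proof (subst nn_integral_cmult_indicator)
    show "B \<in> sets pos_lborel" using B(1) by (simp add: sets_M)
    show "ennreal l = ennreal (exp (- ((L + 1) powr p)) / Z) * emeasure pos_lborel B"
      unfolding l_def B(2) using x12 Z_pos by (intro ennreal_mult) auto
  qed
  also have "\<dots> \<le> (\<integral>\<^sup>+x. ennreal (w x) * indicator B x \<partial>pos_lborel)"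
    using Bi[OF _ one_k(3)] Z_pos by (intro nn_integral_mono) (auto simp: indicator_def w_def intro!: ennreal_leI divide_right_mono)
  also have "\<dots> = emeasure M B" unfolding M_eq using B(1) by (subst emeasure_density) (auto simp: sets_M)
  finally have lB: "l \<le> M.prob B" by (simp add: M.emeasure_eq_measure)
  have "- ln (M.prob B) \<le> - ln l" using lB l0 by simp
  also have "\<dots> = (L + 1) powr p + ln Z - ln (x2 - x1)" using Z_pos x12 by (simp add: l_def ln_mult ln_div)
  finally have "- ln (M.prob B) \<le> (L + 1) powr p + ln Z - ln (x2 - x1)" .
  moreover have "- ln (x2 - x1) \<le> ln C + m * ln (L + 1)"
  proof -
    have "0 \<le> ln (C * (L + 1) powr m * (x2 - x1))" using len by simp
    then show ?thesis using C x12 L(2) by (simp add: ln_mult ln_powr)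
  qed
  ultimately have "- ln (M.prob B) \<le> e * L" using L(1) by linarith
  moreover have "\<phi> i x \<le> e * L" if "x \<in> B" "i \<in> {1..<k}" for x i
  proof -
    have "0 \<le> m * ln (L + 1)" using C L(2) by (intro mult_nonneg_nonneg) auto
    then show ?thesis using Bi[OF that] L(1) by linarith
  qed
  moreover have "0 < M.prob B" using lB l0 by linarith
  ultimately show ?thesis using B(1) Bk L(3) by blast
qed

lemma A1_subset:
  "A1 k \<phi> \<subseteq> {v \<in> (\<Pi>\<^sub>E i\<in>{1..<k}. {0<..}). \<exists>\<mu>\<in>finite_entropy_class k \<phi> v. moment (\<phi> k) \<mu> < \<infinity>}"
  unfolding A1_def by (rule interior_of_subset)

lemma constraint_pos: "i \<in> {1..<k} \<Longrightarrow> 0 < a i" "0 < a k"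
proof -
  have A1: "restrict a {1..<k} \<in> A1 k \<phi>" and g: "g1 k \<phi> (restrict a {1..<k}) < a k"
    using a by (auto simp: admissible_def)
  have "0 \<le> g1 k \<phi> (restrict a {1..<k})" by (simp add: g1_def)
  then show "0 < a k" using g by linarith
  have "restrict a {1..<k} \<in> (\<Pi>\<^sub>E i\<in>{1..<k}. {0<..})"
    using subsetD[OF A1_subset A1] by simp
  then show "i \<in> {1..<k} \<Longrightarrow> 0 < a i" by (auto simp: PiE_def Pi_def)
qed

text \<open>
  Finite moments of the law become integrable functions under the reference law, so that moments
  in $[0,\infty]$ turn into real integrals.
\<close>

lemma density_with_moments:
  assumes \<mu>: "\<mu> \<in> M1_pos" "diff_entropy \<mu> \<noteq> - \<infinity>"
    and m: "\<And>i. i \<in> {1..<k} \<Longrightarrow> moment (\<phi> i) \<mu> = ennreal (a i)" "moment (\<phi> k) \<mu> \<le> ennreal b"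
  obtains q where "q \<in> fin_ent M" "\<And>i. i \<in> {1..k} \<Longrightarrow> integrable M (\<lambda>x. \<phi> i x * q x)"
    "\<And>i. i \<in> {1..<k} \<Longrightarrow> (\<integral>x. \<phi> i x * q x \<partial>M) = a i"
    "\<mu> = law M q" "moment (\<phi> k) \<mu> = ennreal (\<integral>x. \<phi> k x * q x \<partial>M)"
proof -
  have fin: "moment (\<phi> i) \<mu> < \<infinity>" if "i \<in> {1..k}" for i
  proof (cases "i = k")
    case True
    then show ?thesis using m(2) by (auto intro: le_less_trans)
  next
    case False
    then show ?thesis using m(1)[of i] that by simp
  qed
  obtain q where q: "q \<in> fin_ent M" and \<mu>q: "\<mu> = law M q"
    using density_of_finite_entropy[OF \<mu> fin[OF one_k(1)]] by blast
  have I: "integrable M (\<lambda>x. \<phi> i x * q x)" if "i \<in> {1..k}" for i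
    using moment_finite[OF q that] fin[OF that] by (simp add: \<mu>q)
  note E = moment_eq_integral[OF q]
  have "(\<integral>x. \<phi> i x * q x \<partial>M) = a i" if i: "i \<in> {1..<k}" for i
  proof -
    have ik: "i \<in> {1..k}" using i by auto
    have "ennreal (\<integral>x. \<phi> i x * q x \<partial>M) = ennreal (a i)"
      using m(1)[OF i] E(1)[OF ik I[OF ik]] by (simp add: \<mu>q)
    then show ?thesis using E(2)[OF ik I[OF ik]] constraint_pos(1)[OF i] by simp
  qed
  moreover have "moment (\<phi> k) \<mu> = ennreal (\<integral>x. \<phi> k x * q x \<partial>M)"
    unfolding \<mu>q by (rule E(1)[OF one_k(2) I[OF one_k(2)]])
  ultimately show thesis using that[OF q I _ \<mu>q] by blast
qed

text \<open>
  As $a_k$ exceeds the infimum $g_1$ of the top moments, some law of finite entropy has the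
  prescribed lower moments and a top moment below $a_k$.
\<close>

lemma feasible_density:
  obtains q0 where "q0 \<in> fin_ent M" "\<And>i. i \<in> {1..k} \<Longrightarrow> integrable M (\<lambda>x. \<phi> i x * q0 x)"
      "\<And>i. i \<in> {1..<k} \<Longrightarrow> (\<integral>x. \<phi> i x * q0 x \<partial>M) = a i" "(\<integral>x. \<phi> k x * q0 x \<partial>M) < a k"
proof -
  let ?v = "restrict a {1..<k}"
  have A1: "?v \<in> A1 k \<phi>" and g: "g1 k \<phi> ?v < a k" using a by (auto simp: admissible_def)
  have "?v \<in> {v \<in> (\<Pi>\<^sub>E i\<in>{1..<k}. {0<..}). \<exists>\<mu>\<in>finite_entropy_class k \<phi> v. moment (\<phi> k) \<mu> < \<infinity>}"
    by (rule subsetD[OF A1_subset A1])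
  then obtain \<mu>1 where \<mu>1: "\<mu>1 \<in> finite_entropy_class k \<phi> ?v" "moment (\<phi> k) \<mu>1 < \<infinity>" by blast
  let ?I = "INF \<mu>\<in>finite_entropy_class k \<phi> ?v. moment (\<phi> k) \<mu>"
  have "?I \<le> moment (\<phi> k) \<mu>1" using \<mu>1(1) by (rule INF_lower)
  then have fin: "?I < \<infinity>" using \<mu>1(2) by (rule le_less_trans)
  have "?I = ennreal (g1 k \<phi> ?v)" using fin by (simp add: g1_def ennreal_enn2real)
  also have "\<dots> < ennreal (a k)" using g constraint_pos(2) by (intro ennreal_lessI)
  finally obtain \<mu> where \<mu>: "\<mu> \<in> finite_entropy_class k \<phi> ?v" "moment (\<phi> k) \<mu> < ennreal (a k)"
    by (auto simp: INF_less_iff)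
  obtain q where q: "q \<in> fin_ent M" "\<And>i. i \<in> {1..k} \<Longrightarrow> integrable M (\<lambda>x. \<phi> i x * q x)"
    "\<And>i. i \<in> {1..<k} \<Longrightarrow> (\<integral>x. \<phi> i x * q x \<partial>M) = a i"
    and \<mu>q: "\<mu> = law M q" and mk: "moment (\<phi> k) \<mu> = ennreal (\<integral>x. \<phi> k x * q x \<partial>M)"
    using density_with_moments[of \<mu> "a k"] \<mu>(1) less_imp_le[OF \<mu>(2)] by (auto simp: finite_entropy_class_def)
  have "(\<integral>x. \<phi> k x * q x \<partial>M) < a k"
    using \<mu>(2) moment_eq_integral(2)[OF q(1) one_k(2) q(2)[OF one_k(2)]] by (simp add: mk ennreal_less_iff)
  then show thesis using that[OF q] by blast
qed

lemma moment_constraints: "\<exists>q0. moment_constraints M \<phi> k a q0"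
proof -
  obtain q0 where q0: "q0 \<in> fin_ent M" "\<And>i. i \<in> {1..k} \<Longrightarrow> integrable M (\<lambda>x. \<phi> i x * q0 x)"
      "\<And>i. i \<in> {1..<k} \<Longrightarrow> (\<integral>x. \<phi> i x * q0 x \<partial>M) = a i" "(\<integral>x. \<phi> k x * q0 x \<partial>M) < a k"
    using feasible_density by blast
  have "moment_constraints M \<phi> k a q0"
  proof unfold_locales
    show "1 \<le> k" using k by simp
    show "\<phi> i \<in> borel_measurable M" if "i \<in> {1..k}" for i using \<phi>_measurable[OF that] by simp
    show "0 \<le> \<phi> i x" if "i \<in> {1..k}" "x \<in> space M" for i x using \<phi>_nonneg that by (simp add: space_M)
  qed (use q0 lower_moments_dominated cheap_excursion in blast)+
  then show ?thesis by blast
qed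

section \<open>The conditional limit theorem\<close>

context
  fixes q0 assumes mc: "moment_constraints M \<phi> k a q0"
begin

interpretation mc: moment_constraints M \<phi> k a q0 by (rule mc)

lemma density_in_constraint_set:
  assumes q: "q \<in> mc.feas 0"
  shows "law M q \<in> constraint_set k \<phi> a"
    and "diff_entropy (law M q) = ereal (a 1 + ln Z - rel_ent M q)"
proof -
  note qf = mc.feasD(1)[OF q]
  note I = mc.with_momentsD(2)[OF mc.feasD(2)[OF q]]
  have m: "mc.mom i q = a i" if "i \<in> {1..<k}" for i using mc.feasD(3)[OF q that] by simp
  have "moment (\<phi> i) (law M q) = ennreal (a i)" if i: "i \<in> {1..<k}" for i
  proof -
    have ik: "i \<in> {1..k}" using i by auto
    show ?thesis using moment_eq_integral(1)[OF qf ik I[OF ik]] m[OF i] by (simp add: mc.mom_def)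
  qed
  moreover have "moment (\<phi> k) (law M q) \<le> ennreal (a k)"
    using moment_eq_integral(1)[OF qf one_k(2) I[OF one_k(2)]] mc.feasD(4)[OF q] by (simp add: mc.mom_def ennreal_leI)
  moreover have "law M q \<in> M1_pos"
    using fin_ent_prob_space[OF qf] by (simp add: space_prob_algebra sets_M sets_pos_lborel)
  ultimately show "law M q \<in> constraint_set k \<phi> a" by (simp add: constraint_set_def)
  show "diff_entropy (law M q) = ereal (a 1 + ln Z - rel_ent M q)"
    using entropy_density_M[OF qf I[OF one_k(1)]] m[OF one_k(3)] by (simp add: mc.mom_def)
qed

lemma constraint_set_density:
  assumes \<mu>: "\<mu> \<in> constraint_set k \<phi> a" "diff_entropy \<mu> \<noteq> - \<infinity>"
  obtains q where "q \<in> mc.feas 0" "\<mu> = law M q"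
proof -
  obtain q where q: "q \<in> fin_ent M" "\<And>i. i \<in> {1..k} \<Longrightarrow> integrable M (\<lambda>x. \<phi> i x * q x)"
    "\<And>i. i \<in> {1..<k} \<Longrightarrow> (\<integral>x. \<phi> i x * q x \<partial>M) = a i"
    and \<mu>q: "\<mu> = law M q" and mk: "moment (\<phi> k) \<mu> = ennreal (\<integral>x. \<phi> k x * q x \<partial>M)"
    using density_with_moments[of \<mu> "a k"] \<mu> by (auto simp: constraint_set_def)
  have "(\<integral>x. \<phi> k x * q x \<partial>M) \<le> a k" using \<mu>(1) constraint_pos(2) by (simp add: constraint_set_def mk)
  then have "q \<in> mc.feas 0" using q by (simp add: mc.feas_def mc.with_moments_def mc.mom_def)
  then show thesis using \<mu>q that by blast
qed

abbreviation maximizer :: "real measure" where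
  "maximizer \<equiv> law M (mc.opt 0)"

lemma maximizer_is_arg_max: "is_arg_max diff_entropy (\<lambda>\<mu>. \<mu> \<in> constraint_set k \<phi> a) maximizer"
  unfolding is_arg_max_linorder
proof (intro conjI allI impI)
  have o: "mc.opt 0 \<in> mc.feas 0" by (rule mc.opt_feas) simp
  show "maximizer \<in> constraint_set k \<phi> a" by (rule density_in_constraint_set(1)[OF o])
  fix \<mu> assume \<mu>: "\<mu> \<in> constraint_set k \<phi> a"
  show "diff_entropy \<mu> \<le> diff_entropy maximizer"
  proof (cases "diff_entropy \<mu> = - \<infinity>")
    case False
    then obtain q where q: "q \<in> mc.feas 0" and \<mu>q: "\<mu> = law M q"
      using constraint_set_density[OF \<mu>] by blast
    have "rel_ent M (mc.opt 0) \<le> rel_ent M q" by (rule mc.opt_le[OF order_refl q])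
    then show ?thesis unfolding \<mu>q density_in_constraint_set(2)[OF q] density_in_constraint_set(2)[OF o] by simp
  qed simp
qed

text \<open>
  An arg max has entropy at least that of \<open>maximizer\<close>, hence has a density; this density is then
  a minimizer of the relative entropy, and minimizers are unique.
\<close>

lemma arg_max_eq_maximizer:
  assumes \<nu>: "is_arg_max diff_entropy (\<lambda>\<mu>. \<mu> \<in> constraint_set k \<phi> a) \<nu>"
  shows "\<nu> = maximizer"
proof -
  have o: "mc.opt 0 \<in> mc.feas 0" by (rule mc.opt_feas) simp
  have \<nu>c: "\<nu> \<in> constraint_set k \<phi> a" using \<nu> by (simp add: is_arg_max_def)
  have le: "diff_entropy maximizer \<le> diff_entropy \<nu>"
    using \<nu> density_in_constraint_set(1)[OF o] unfolding is_arg_max_linorder by blast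
  then have "diff_entropy \<nu> \<noteq> - \<infinity>" unfolding density_in_constraint_set(2)[OF o] by auto
  then obtain q where q: "q \<in> mc.feas 0" and \<nu>q: "\<nu> = law M q"
    using constraint_set_density[OF \<nu>c] by blast
  have "rel_ent M q \<le> rel_ent M (mc.opt 0)"
    using le unfolding \<nu>q density_in_constraint_set(2)[OF q] density_in_constraint_set(2)[OF o] by simp
  then have "rel_ent M q \<le> rel_ent M r" if "r \<in> mc.feas 0" for r using mc.opt_le[OF order_refl that] by linarith
  then have "mc.minimizer 0 q" using q by (simp add: mc.minimizer_def)
  then have "L1_dist M q (mc.opt 0) = 0" using mc.minimizer_unique mc.minimizer_opt[OF order_refl] by blast
  moreover have I: "integrable M q" "integrable M (mc.opt 0)" using fin_entD(3) mc.feasD(1) q o by blast+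
  ultimately have "AE x in M. \<bar>q x - mc.opt 0 x\<bar> = 0" by (subst (asm) integral_nonneg_eq_0_iff_AE) auto
  then have "AE x in M. ennreal (q x) = ennreal (mc.opt 0 x)" by eventually_elim simp
  then show ?thesis unfolding \<nu>q using I by (intro density_cong) auto
qed

text \<open>
  The event depends on the first $n$ coordinates only, so the conditioned law can be computed in
  the finite product.
\<close>

lemma integral_cond_law:
  assumes f: "f \<in> borel_measurable (M.iid {..<j})" and n: "j \<le> n"
  shows "(\<integral>x. f x \<partial>cond_law k \<phi> a j n d) = mc.cond_integral n d j f"
proof -
  let ?S = "seq_measure \<phi>" and ?T = "\<lambda>\<omega>. restrict \<omega> {..<n}"
  have S: "?S = PiM UNIV (\<lambda>_. M)" by (simp add: seq_measure_def)
  have T: "?T \<in> ?S \<rightarrow>\<^sub>M M.iid {..<n}" unfolding S by (rule measurable_restrict_subset) simp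
  have D: "distr ?S (M.iid {..<n}) ?T = M.iid {..<n}" unfolding S
    using distr_PiM_reindex[of UNIV "\<lambda>_. M" "\<lambda>i. i" "{..<n}"] by (simp add: prob_space_M restrict_def)
  have E: "cond_event k \<phi> a n d = ?T -` mc.avg_event n d \<inter> space ?S"
    using measurable_space[OF T] by (auto simp: cond_event_def mc.avg_event_def emp_avg_def)
  have Em: "cond_event k \<phi> a n d \<in> sets ?S" unfolding E by (rule measurable_sets[OF T mc.sets_avg_event])
  let ?U = "uniform_measure ?S (cond_event k \<phi> a n d)"
  have setsj: "sets (\<Pi>\<^sub>M i\<in>{..<j}. pos_borel) = sets (M.iid {..<j})" for j
    by (intro sets_PiM_cong) (simp_all add: sets_M sets_pos_lborel)
  have R: "(\<lambda>\<omega>. restrict \<omega> {..<j}) \<in> ?U \<rightarrow>\<^sub>M (\<Pi>\<^sub>M i\<in>{..<j}. pos_borel)"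
  proof (subst measurable_cong_sets[OF _ setsj])
    show "sets ?U = sets ?S" by simp
    show "(\<lambda>\<omega>. restrict \<omega> {..<j}) \<in> ?S \<rightarrow>\<^sub>M M.iid {..<j}" unfolding S by (rule measurable_restrict_subset) simp
  qed
  have TU: "?T \<in> ?U \<rightarrow>\<^sub>M M.iid {..<n}" using T by (subst measurable_cong_sets[of _ ?S _ "M.iid {..<n}"]) auto
  have r: "(\<lambda>x. restrict x {..<j}) \<in> M.iid {..<n} \<rightarrow>\<^sub>M M.iid {..<j}" using n by (intro measurable_restrict_subset) auto
  have "(\<integral>x. f x \<partial>cond_law k \<phi> a j n d) = (\<integral>\<omega>. f (restrict \<omega> {..<j}) \<partial>?U)"
    unfolding cond_law_def using f by (intro integral_distr R) (simp add: measurable_cong_sets[OF setsj refl])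
  also have "\<dots> = (\<integral>\<omega>. f (restrict (?T \<omega>) {..<j}) \<partial>?U)"
    using n by (intro Bochner_Integration.integral_cong refl arg_cong[where f=f]) (auto simp: restrict_def fun_eq_iff)
  also have "\<dots> = (\<integral>x. f (restrict x {..<j}) \<partial>distr ?U (M.iid {..<n}) ?T)"
    by (rule integral_distr[OF TU measurable_compose[OF r f], symmetric])
  also have "distr ?U (M.iid {..<n}) ?T = uniform_measure (M.iid {..<n}) (mc.avg_event n d)"
    unfolding E by (rule distr_uniform_measure[OF T D mc.sets_avg_event])
  finally show ?thesis .
qed

lemma conditional_laws_converge:
  assumes j: "j > 0"
  shows "iterated_weak_limit j (\<lambda>n \<delta>. cond_law k \<phi> a j n \<delta>) (\<Pi>\<^sub>M i\<in>{..<j}. maximizer)"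
proof -
  define N where "N d = (\<Pi>\<^sub>M i\<in>{..<j}. law M (mc.opt d))" for d
  have sets_pow: "sets (\<Pi>\<^sub>M i\<in>{..<j}. pos_borel) = sets (M.iid {..<j})"
    by (intro sets_PiM_cong) (simp_all add: sets_M sets_pos_lborel)
  have f: "f \<in> borel_measurable (M.iid {..<j}) \<and> (\<exists>K. \<forall>x\<in>space (M.iid {..<j}). \<bar>f x\<bar> \<le> K)"
    if "continuous_map (pos_power_top j) euclideanreal f" "bounded (f ` topspace (pos_power_top j))" for f :: "(nat \<Rightarrow> real) \<Rightarrow> real"
  proof -
    have "f \<in> borel_measurable (M.iid {..<j})"
      using continuous_map_pos_power_measurable[OF that(1)] by (simp add: measurable_cong_sets[OF sets_pow refl])
    moreover have "topspace (pos_power_top j) = space (M.iid {..<j})" by (simp add: space_PiM space_M)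
    ultimately show ?thesis using that(2) by (auto simp: bounded_iff)
  qed
  have "weakly_converges (pos_power_top j) (\<lambda>n. cond_law k \<phi> a j n d) (N d) sequentially" if d: "0 < d" for d
    unfolding weakly_converges_def
  proof (intro allI impI)
    fix g :: "(nat \<Rightarrow> real) \<Rightarrow> real"
    assume "continuous_map (pos_power_top j) euclideanreal g \<and> bounded (g ` topspace (pos_power_top j))"
    with f[of g] obtain K where g: "g \<in> borel_measurable (M.iid {..<j})" and K: "\<And>x. x \<in> space (M.iid {..<j}) \<Longrightarrow> \<bar>g x\<bar> \<le> K" by blast
    have "(\<lambda>n. mc.cond_integral n d j g) \<longlonglongrightarrow> (\<integral>x. g x \<partial>N d)"
      unfolding N_def by (rule mc.conditional_limit[OF d j g K])
    then show "(\<lambda>n. \<integral>x. g x \<partial>cond_law k \<phi> a j n d) \<longlonglongrightarrow> (\<integral>x. g x \<partial>N d)"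
      by (rule Lim_transform_eventually) (use eventually_ge_at_top[of j] in \<open>eventually_elim, simp add: integral_cond_law[OF g]\<close>)
  qed
  moreover have "N d \<in> space (prob_algebra (\<Pi>\<^sub>M i\<in>{..<j}. pos_borel))" if d: "0 < d" for d
  proof -
    have "mc.opt d \<in> fin_ent M" using mc.feasD(1)[OF mc.opt_feas] d by simp
    then have "prob_space (N d)" unfolding N_def by (intro prob_space_PiM fin_ent_prob_space)
    moreover have "sets (N d) = sets (\<Pi>\<^sub>M i\<in>{..<j}. pos_borel)"
      unfolding N_def by (intro sets_PiM_cong) (simp_all add: sets_M sets_pos_lborel)
    ultimately show ?thesis by (simp add: space_prob_algebra)
  qed
  moreover have "weakly_converges (pos_power_top j) N (\<Pi>\<^sub>M i\<in>{..<j}. maximizer) (at_right 0)"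
    unfolding weakly_converges_def
  proof (intro allI impI)
    fix g :: "(nat \<Rightarrow> real) \<Rightarrow> real"
    assume "continuous_map (pos_power_top j) euclideanreal g \<and> bounded (g ` topspace (pos_power_top j))"
    with f[of g] obtain K where g: "g \<in> borel_measurable (M.iid {..<j})" and K: "\<And>x. x \<in> space (M.iid {..<j}) \<Longrightarrow> \<bar>g x\<bar> \<le> K" by blast
    show "((\<lambda>d. \<integral>x. g x \<partial>N d) \<longlongrightarrow> (\<integral>x. g x \<partial>(\<Pi>\<^sub>M i\<in>{..<j}. maximizer))) (at_right 0)"
      unfolding N_def by (rule mc.opt_integral_tendsto[OF g K])
  qed
  moreover have "eventually (\<lambda>d::real. 0 < d) (at_right 0)" by (simp add: eventually_at_right_less)
  ultimately show ?thesis unfolding iterated_weak_limit_def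
    by (intro exI[of _ N]) (auto elim!: eventually_mono)
qed

lemma arg_max_and_limit:
  assumes j: "j > 0"
  shows "(\<exists>!\<mu>. is_arg_max diff_entropy (\<lambda>\<mu>. \<mu> \<in> constraint_set k \<phi> a) \<mu>) \<and>
         (\<forall>\<nu>. is_arg_max diff_entropy (\<lambda>\<mu>. \<mu> \<in> constraint_set k \<phi> a) \<nu> \<longrightarrow>
            iterated_weak_limit j (\<lambda>n \<delta>. cond_law k \<phi> a j n \<delta>) (\<Pi>\<^sub>M i\<in>{..<j}. \<nu>))"
  using maximizer_is_arg_max arg_max_eq_maximizer conditional_laws_converge[OF j] by blast

end
end

theorem theorem2p1:
  fixes k j :: nat and \<phi> :: "nat \<Rightarrow> real \<Rightarrow> real" and a :: "nat \<Rightarrow> real"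
  assumes k: "k \<ge> 2"
    and pos: "\<forall>i\<in>{1..k}. \<forall>x>0. \<phi> i x > 0"
    and C1: "\<forall>i\<in>{1..k}. \<phi> i C1_differentiable_on {0<..} \<and> mono_on {0<..} (\<phi> i) \<and>
               filterlim (\<phi> i) at_top at_top"
    and C2: "\<forall>i\<in>{1..k}. \<forall>c::real. c > 0 \<longrightarrow>
               (\<integral>\<^sup>+x. ennreal (exp (- c * \<phi> i x)) \<partial>pos_lborel) < \<infinity>"
    and C3: "\<exists>\<kappa>::real. \<kappa> > 1 \<and>
               (\<forall>i\<in>{1..<k}. \<forall>\<^sub>F x in at_top. \<phi> i x powr \<kappa> < \<phi> (i + 1) x)"
    and C4: "\<exists>C M::real. C > 0 \<and> M > 0 \<and>
               (\<forall>x>C. \<forall>i\<in>{1..k}. 1 / C * \<phi> i x powr (- M) < deriv (\<phi> i) x \<and>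
                                 deriv (\<phi> i) x < C * \<phi> i x powr M)"
    and g1_cont: "continuous_map (subtopology (powertop_real {1..<k}) (A1 k \<phi>)) euclideanreal (g1 k \<phi>)"
    and a: "a \<in> admissible k \<phi>"
    and j: "j > 0"
  shows "(\<exists>!\<mu>. is_arg_max diff_entropy (\<lambda>\<mu>. \<mu> \<in> constraint_set k \<phi> a) \<mu>) \<and>
         (\<forall>\<nu>. is_arg_max diff_entropy (\<lambda>\<mu>. \<mu> \<in> constraint_set k \<phi> a) \<nu> \<longrightarrow>
            iterated_weak_limit j (\<lambda>n \<delta>. cond_law k \<phi> a j n \<delta>) (\<Pi>\<^sub>M i\<in>{..<j}. \<nu>))"
proof -
  interpret microcanonical k \<phi> a by unfold_locales (fact k pos C1 C2 C3 C4 a)+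
  obtain q0 where "moment_constraints M \<phi> k a q0" using moment_constraints by blast
  from arg_max_and_limit[OF this j] show ?thesis .
qed

end
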